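(* Let $f:G\to H$ be an epimorphism of prounipotent groups over $k$ (where $k$ is a field of characteristic zero, or $k=\mathbb{F}_p$), with $\mathrm{rank}(G)\le e$. Let $h_1,\dots,h_e$ be a system of generators of $H$. Then there exists a system of generators $g_1,\dots,g_e$ of $G$ such that $f(g_i)=h_i$ for $i=1,\dots,e$.
   Context: A unipotent group is, over a field $k$ of characteristic $0$, an affine algebraic group scheme each of whose nonzero linear representations has a nonzero fixed vector; for $k=\mathbb{F}_p$, it is the constant group scheme of a finite $p$-group. A prounipotent group is an inverse limit of unipotent groups (for $k=\mathbb{F}_p$ these are the pro-$p$-groups). A system of generators of $G$ is a family of elements of $G(k)$ which is not contained in $G'(k)$ for any proper closed subgroup $G'$ of $G$, i.e. whose Zariski closure (the smallest closed subgroup containing it) is $G$ (in the pro-$p$ case: topological generators). $\mathrm{rank}(G)$ is the minimal cardinality of a system of generators of $G$; $e$ is a natural number. *)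

theory Defs
  imports
    "HOL-Algebra.Algebraic_Closure_Type"
    "HOL-Library.Cardinality"
    "HOL-Library.Extended_Nat"
begin

text \<open>
  An affine group scheme \<open>G\<close> over a field \<open>k\<close> is represented by its coordinate ring \<open>O(G)\<close>, a
  commutative Hopf algebra over \<open>k\<close>. The category of affine group schemes over \<open>k\<close> is dual to the
  category of commutative Hopf algebras over \<open>k\<close>, so a morphism \<open>G \<rightarrow> H\<close> is given by its comorphism
  \<open>O(H) \<rightarrow> O(G)\<close>. The field \<open>k\<close> is the type \<^typ>\<open>'k\<close>, of class \<^class>\<open>field\<close>.
\<close>

section \<open>Algebras over the base field\<close>

abbreviation base_ring :: "'k::field ring" where
  "base_ring \<equiv> ring_of_type_algebra"

definition base_algebra :: "('k::field, 'k) module" where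
  "base_algebra = ring.extend base_ring (module.fields (*))"

definition linear_map ::
  "('k::field, 'a, 'm) module_scheme \<Rightarrow> ('k, 'b, 'n) module_scheme \<Rightarrow> ('a \<Rightarrow> 'b) \<Rightarrow> bool" where
  "linear_map A B \<phi> \<longleftrightarrow>
     \<phi> \<in> carrier A \<rightarrow> carrier B \<and>
     (\<forall>x\<in>carrier A. \<forall>y\<in>carrier A. \<phi> (x \<oplus>\<^bsub>A\<^esub> y) = \<phi> x \<oplus>\<^bsub>B\<^esub> \<phi> y) \<and>
     (\<forall>c. \<forall>x\<in>carrier A. \<phi> (c \<odot>\<^bsub>A\<^esub> x) = c \<odot>\<^bsub>B\<^esub> \<phi> x)"

definition algebra_hom ::
  "('k::field, 'a, 'm) module_scheme \<Rightarrow> ('k, 'b, 'n) module_scheme \<Rightarrow> ('a \<Rightarrow> 'b) \<Rightarrow> bool" where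
  "algebra_hom A B \<phi> \<longleftrightarrow> linear_map A B \<phi> \<and> \<phi> \<in> ring_hom A B"

definition finitely_generated_algebra :: "('k::field, 'a, 'm) module_scheme \<Rightarrow> bool" where
  "finitely_generated_algebra A \<longleftrightarrow>
     (\<exists>T. finite T \<and> T \<subseteq> carrier A \<and>
        (\<forall>S. subring S A \<and> (\<forall>c. \<forall>x\<in>S. c \<odot>\<^bsub>A\<^esub> x \<in> S) \<and> T \<subseteq> S \<longrightarrow> S = carrier A))"

section \<open>Tensors\<close>

text \<open>
  An element of \<open>A \<otimes> A\<close> is given by a list of pairs \<open>[(x\<^sub>1, y\<^sub>1), \<dots>]\<close> representing
  \<open>x\<^sub>1 \<otimes> y\<^sub>1 + \<dots>\<close>; similarly lists of triples represent elements of \<open>A \<otimes> A \<otimes> A\<close>. The linear forms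
  on \<open>A \<otimes> A\<close> are exactly the bilinear forms on \<open>A\<close>, and over a field the linear forms on a vector
  space separate its points. So two lists represent the same tensor iff all bilinear
  (resp. trilinear) forms agree on them.
\<close>

abbreviation linear_form :: "('k::field, 'a, 'm) module_scheme \<Rightarrow> ('a \<Rightarrow> 'k) \<Rightarrow> bool" where
  "linear_form A \<equiv> linear_map A base_algebra"

definition bilinear_form :: "('k::field, 'a, 'm) module_scheme \<Rightarrow> ('a \<Rightarrow> 'a \<Rightarrow> 'k) \<Rightarrow> bool" where
  "bilinear_form A \<beta> \<longleftrightarrow>
     (\<forall>x\<in>carrier A. linear_form A (\<lambda>y. \<beta> x y)) \<and>
     (\<forall>y\<in>carrier A. linear_form A (\<lambda>x. \<beta> x y))"

definition trilinear_form :: "('k::field, 'a, 'm) module_scheme \<Rightarrow> ('a \<Rightarrow> 'a \<Rightarrow> 'a \<Rightarrow> 'k) \<Rightarrow> bool" where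
  "trilinear_form A \<gamma> \<longleftrightarrow>
     (\<forall>x\<in>carrier A. \<forall>y\<in>carrier A. linear_form A (\<lambda>z. \<gamma> x y z)) \<and>
     (\<forall>x\<in>carrier A. \<forall>z\<in>carrier A. linear_form A (\<lambda>y. \<gamma> x y z)) \<and>
     (\<forall>y\<in>carrier A. \<forall>z\<in>carrier A. linear_form A (\<lambda>x. \<gamma> x y z))"

definition tensor_eq ::
  "('k::field, 'a, 'm) module_scheme \<Rightarrow> ('a \<times> 'a) list \<Rightarrow> ('a \<times> 'a) list \<Rightarrow> bool" where
  "tensor_eq A s t \<longleftrightarrow>
     (\<forall>\<beta>. bilinear_form A \<beta> \<longrightarrow> (\<Sum>(x, y)\<leftarrow>s. \<beta> x y) = (\<Sum>(x, y)\<leftarrow>t. \<beta> x y))"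

definition tensor_eq3 ::
  "('k::field, 'a, 'm) module_scheme \<Rightarrow> ('a \<times> 'a \<times> 'a) list \<Rightarrow> ('a \<times> 'a \<times> 'a) list \<Rightarrow> bool" where
  "tensor_eq3 A s t \<longleftrightarrow>
     (\<forall>\<gamma>. trilinear_form A \<gamma> \<longrightarrow> (\<Sum>(x, y, z)\<leftarrow>s. \<gamma> x y z) = (\<Sum>(x, y, z)\<leftarrow>t. \<gamma> x y z))"

definition list_sum :: "('a, 'm) ring_scheme \<Rightarrow> 'a list \<Rightarrow> 'a" where
  "list_sum A xs = foldr (add A) xs \<zero>\<^bsub>A\<^esub>"

section \<open>Commutative Hopf algebras\<close>

record ('k, 'a) hopf = "('k, 'a) module" +
  comult :: "'a \<Rightarrow> ('a \<times> 'a) list"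
  counit :: "'a \<Rightarrow> 'k"
  antipode :: "'a \<Rightarrow> 'a"

text \<open>
  The list \<open>comult A x\<close> is a representative of the comultiplication of \<open>x\<close>; its choice is immaterial.
  The assumptions \<open>comult_closed\<close> to \<open>comult_one\<close> say that it induces an algebra homomorphism
  \<open>A \<rightarrow> A \<otimes> A\<close>.
\<close>

locale hopf_algebra = algebra "base_ring :: 'k ring" A
  for A :: "('k::field, 'a) hopf" (structure) +
  assumes comult_closed: "x \<in> carrier A \<Longrightarrow> set (comult A x) \<subseteq> carrier A \<times> carrier A"
    and comult_add: "\<lbrakk>x \<in> carrier A; y \<in> carrier A\<rbrakk> \<Longrightarrow>
      tensor_eq A (comult A (x \<oplus> y)) (comult A x @ comult A y)"
    and comult_smult: "x \<in> carrier A \<Longrightarrow>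
      tensor_eq A (comult A (c \<odot> x)) [(c \<odot> u, v). (u, v) \<leftarrow> comult A x]"
    and comult_mult: "\<lbrakk>x \<in> carrier A; y \<in> carrier A\<rbrakk> \<Longrightarrow>
      tensor_eq A (comult A (x \<otimes> y))
        [(u \<otimes> u', v \<otimes> v'). (u, v) \<leftarrow> comult A x, (u', v') \<leftarrow> comult A y]"
    and comult_one: "tensor_eq A (comult A \<one>) [(\<one>, \<one>)]"
    and coassoc: "x \<in> carrier A \<Longrightarrow>
      tensor_eq3 A
        [(u', u'', v). (u, v) \<leftarrow> comult A x, (u', u'') \<leftarrow> comult A u]
        [(u, v', v''). (u, v) \<leftarrow> comult A x, (v', v'') \<leftarrow> comult A v]"
    and counit_hom: "algebra_hom A base_algebra (counit A)"
    and counit_left: "x \<in> carrier A \<Longrightarrow>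
      list_sum A [counit A u \<odot> v. (u, v) \<leftarrow> comult A x] = x"
    and counit_right: "x \<in> carrier A \<Longrightarrow>
      list_sum A [counit A v \<odot> u. (u, v) \<leftarrow> comult A x] = x"
    and antipode_linear: "linear_map A A (antipode A)"
    and antipode_left: "x \<in> carrier A \<Longrightarrow>
      list_sum A [antipode A u \<otimes> v. (u, v) \<leftarrow> comult A x] = counit A x \<odot> \<one>"
    and antipode_right: "x \<in> carrier A \<Longrightarrow>
      list_sum A [u \<otimes> antipode A v. (u, v) \<leftarrow> comult A x] = counit A x \<odot> \<one>"

text \<open>Compatibility with the antipodes is automatic.\<close>

definition hopf_hom :: "('k::field, 'a) hopf \<Rightarrow> ('k, 'b) hopf \<Rightarrow> ('a \<Rightarrow> 'b) \<Rightarrow> bool" where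
  "hopf_hom A B \<phi> \<longleftrightarrow>
     algebra_hom A B \<phi> \<and>
     (\<forall>x\<in>carrier A. tensor_eq B (comult B (\<phi> x)) [(\<phi> u, \<phi> v). (u, v) \<leftarrow> comult A x]) \<and>
     (\<forall>x\<in>carrier A. counit B (\<phi> x) = counit A x)"

text \<open>
  The closed subgroup schemes of \<open>Spec A\<close> are the \<open>Spec (A/J)\<close> for the Hopf ideals \<open>J\<close> of \<open>A\<close>. The
  condition on \<^const>\<open>comult\<close> reads \<open>\<Delta>(J) \<subseteq> J \<otimes> A + A \<otimes> J\<close>.
\<close>

definition hopf_ideal :: "('k::field, 'a) hopf \<Rightarrow> 'a set \<Rightarrow> bool" where
  "hopf_ideal A J \<longleftrightarrow>
     ideal J A \<and>
     (\<forall>x\<in>J. \<exists>s. set s \<subseteq> J \<times> carrier A \<union> carrier A \<times> J \<and> tensor_eq A (comult A x) s) \<and>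
     (\<forall>x\<in>J. counit A x = 0) \<and>
     (\<forall>x\<in>J. antipode A x \<in> J)"

section \<open>Unipotent and prounipotent groups\<close>

text \<open>
  A linear representation of \<open>Spec A\<close> on \<open>k\<^sup>n\<close> is a comodule structure
  \<open>e\<^sub>j \<mapsto> \<Sum>i<n. e\<^sub>i \<otimes> a i j\<close>, i.e. a morphism \<open>Spec A \<rightarrow> GL\<^sub>n\<close>; indices outside \<open>{..<n}\<close> are irrelevant.
  A vector \<open>v\<close> is fixed iff it is mapped to \<open>v \<otimes> 1\<close>.
\<close>

definition linear_representation ::
  "('k::field, 'a) hopf \<Rightarrow> nat \<Rightarrow> (nat \<Rightarrow> nat \<Rightarrow> 'a) \<Rightarrow> bool" where
  "linear_representation A n a \<longleftrightarrow>
     (\<forall>i<n. \<forall>j<n.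
        a i j \<in> carrier A \<and>
        tensor_eq A (comult A (a i j)) [(a i l, a l j). l \<leftarrow> [0..<n]] \<and>
        counit A (a i j) = (if i = j then 1 else 0))"

definition fixed_vector ::
  "('k::field, 'a) hopf \<Rightarrow> nat \<Rightarrow> (nat \<Rightarrow> nat \<Rightarrow> 'a) \<Rightarrow> (nat \<Rightarrow> 'k) \<Rightarrow> bool" where
  "fixed_vector A n a v \<longleftrightarrow>
     (\<forall>i<n. (\<Oplus>\<^bsub>A\<^esub>j\<in>{..<n}. v j \<odot>\<^bsub>A\<^esub> a i j) = v i \<odot>\<^bsub>A\<^esub> \<one>\<^bsub>A\<^esub>)"

text \<open>
  \<open>A\<close> is the coordinate ring of the constant group scheme of the finite group \<open>\<Gamma>\<close>: it is isomorphic
  to the algebra of all functions \<open>\<Gamma> \<rightarrow> k\<close>, and under \<open>k\<^sup>\<Gamma> \<otimes> k\<^sup>\<Gamma> = k\<^bsup>\<Gamma> \<times> \<Gamma>\<^esup>\<close> the comultiplication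
  becomes \<open>(\<Delta> x)(g, h) = x (g h)\<close>. Here \<open>\<phi> x g\<close> is the value of \<open>x\<close> at \<open>g\<close>.
\<close>

definition constant_group_scheme :: "('g, 'm) monoid_scheme \<Rightarrow> ('k::field, 'a) hopf \<Rightarrow> bool" where
  "constant_group_scheme \<Gamma> A \<longleftrightarrow>
     (\<exists>\<phi>. bij_betw \<phi> (carrier A) (carrier \<Gamma> \<rightarrow>\<^sub>E UNIV) \<and>
        (\<forall>g\<in>carrier \<Gamma>. algebra_hom A base_algebra (\<lambda>x. \<phi> x g)) \<and>
        (\<forall>x\<in>carrier A. \<forall>g\<in>carrier \<Gamma>. \<forall>h\<in>carrier \<Gamma>.
           (\<Sum>(u, v)\<leftarrow>comult A x. \<phi> u g * \<phi> v h) = \<phi> x (g \<otimes>\<^bsub>\<Gamma>\<^esub> h)))"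

text \<open>
  The second branch is only meant for \<open>k = F\<^sub>p\<close>. Every finite group is isomorphic to one whose elements
  are natural numbers.
\<close>

definition unipotent :: "('k::field, 'a) hopf \<Rightarrow> bool" where
  "unipotent A \<longleftrightarrow>
     hopf_algebra A \<and>
     (if CHAR('k) = 0 then
        finitely_generated_algebra A \<and>
        (\<forall>n a. n > 0 \<and> linear_representation A n a \<longrightarrow>
           (\<exists>v. (\<exists>i<n. v i \<noteq> 0) \<and> fixed_vector A n a v))
      else
        (\<exists>\<Gamma> :: nat monoid. group \<Gamma> \<and> finite (carrier \<Gamma>) \<and>
           (\<exists>m. card (carrier \<Gamma>) = CHAR('k) ^ m) \<and> constant_group_scheme \<Gamma> A))"

text \<open>
  The projections \<open>Spec A \<rightarrow> Spec (B i)\<close> given by \<open>u i\<close> exhibit \<open>Spec A\<close> as the limit of the inverse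
  system of the \<open>Spec (B i)\<close>, with transition maps \<open>Spec (B j) \<rightarrow> Spec (B i)\<close> given by \<open>t i j\<close> for
  \<open>(i, j) \<in> r\<close>. The last two conditions say that the canonical map from the direct limit of the
  \<open>B i\<close> (the disjoint union modulo eventual equality) to \<open>A\<close> is bijective.
\<close>

definition inverse_limit ::
  "'i set \<Rightarrow> 'i rel \<Rightarrow> ('i \<Rightarrow> ('k::field, 'b) hopf) \<Rightarrow> ('i \<Rightarrow> 'i \<Rightarrow> 'b \<Rightarrow> 'b) \<Rightarrow>
   ('k, 'a) hopf \<Rightarrow> ('i \<Rightarrow> 'b \<Rightarrow> 'a) \<Rightarrow> bool" where
  "inverse_limit I r B t A u \<longleftrightarrow>
     I \<noteq> {} \<and> partial_order_on I r \<and>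
     (\<forall>i\<in>I. \<forall>j\<in>I. \<exists>l\<in>I. (i, l) \<in> r \<and> (j, l) \<in> r) \<and>
     (\<forall>i\<in>I. hopf_algebra (B i)) \<and> hopf_algebra A \<and>
     (\<forall>(i, j)\<in>r. hopf_hom (B i) (B j) (t i j)) \<and>
     (\<forall>i\<in>I. \<forall>x\<in>carrier (B i). t i i x = x) \<and>
     (\<forall>i j l. (i, j) \<in> r \<and> (j, l) \<in> r \<longrightarrow> (\<forall>x\<in>carrier (B i). t j l (t i j x) = t i l x)) \<and>
     (\<forall>i\<in>I. hopf_hom (B i) A (u i)) \<and>
     (\<forall>(i, j)\<in>r. \<forall>x\<in>carrier (B i). u j (t i j x) = u i x) \<and>
     (\<Union>i\<in>I. u i ` carrier (B i)) = carrier A \<and>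
     (\<forall>i\<in>I. \<forall>x\<in>carrier (B i). \<forall>y\<in>carrier (B i).
        u i x = u i y \<longrightarrow> (\<exists>j. (i, j) \<in> r \<and> t i j x = t i j y))"

text \<open>
  The two type arguments are the types of the indices and of the elements of the coordinate rings in
  the inverse system. A theorem assuming prounipotence should leave both of them arbitrary.
\<close>

definition prounipotent :: "'i itself \<Rightarrow> 'b itself \<Rightarrow> ('k::field, 'a) hopf \<Rightarrow> bool" where
  "prounipotent _ _ A \<longleftrightarrow>
     (\<exists>(I :: 'i set) r (B :: 'i \<Rightarrow> ('k, 'b) hopf) t u.
        inverse_limit I r B t A u \<and> (\<forall>i\<in>I. unipotent (B i)))"

text \<open>
  \<open>\<phi> : O(H) \<rightarrow> O(G)\<close> is the comorphism of a morphism \<open>G \<rightarrow> H\<close>. Its image is the closed subgroup of \<open>H\<close>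
  defined by the kernel of \<open>\<phi>\<close>, so the morphism is an epimorphism iff \<open>\<phi>\<close> is injective.
\<close>

definition epimorphism :: "('k::field, 'a) hopf \<Rightarrow> ('k, 'b) hopf \<Rightarrow> ('b \<Rightarrow> 'a) \<Rightarrow> bool" where
  "epimorphism G H \<phi> \<longleftrightarrow> hopf_hom H G \<phi> \<and> inj_on \<phi> (carrier H)"

section \<open>Rational points and systems of generators\<close>

text \<open>\<open>G(k)\<close>: the algebra homomorphisms \<open>O(G) \<rightarrow> k\<close>, as extensional functions.\<close>

definition points :: "('k::field, 'a) hopf \<Rightarrow> ('a \<Rightarrow> 'k) set" where
  "points G = {g \<in> extensional (carrier G). algebra_hom G base_algebra g}"

definition on_points :: "('k::field, 'b) hopf \<Rightarrow> ('b \<Rightarrow> 'a) \<Rightarrow> ('a \<Rightarrow> 'k) \<Rightarrow> ('b \<Rightarrow> 'k)" where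
  "on_points H \<phi> g = restrict (g \<circ> \<phi>) (carrier H)"

definition subgroup_points :: "('k::field, 'a) hopf \<Rightarrow> 'a set \<Rightarrow> ('a \<Rightarrow> 'k) set" where
  "subgroup_points G J = {g \<in> points G. \<forall>x\<in>J. g x = 0}"

text \<open>
  \<open>g 1, \<dots>, g n\<close> generate \<open>G\<close>. The closed subgroup defined by \<open>J\<close> is proper iff \<open>J\<close> is nonzero.
\<close>

definition generating_system :: "('k::field, 'a) hopf \<Rightarrow> nat \<Rightarrow> (nat \<Rightarrow> 'a \<Rightarrow> 'k) \<Rightarrow> bool" where
  "generating_system G n g \<longleftrightarrow>
     g ` {1..n} \<subseteq> points G \<and>
     \<not> (\<exists>J. hopf_ideal G J \<and> J \<noteq> {\<zero>\<^bsub>G\<^esub>} \<and> g ` {1..n} \<subseteq> subgroup_points G J)"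

text \<open>All infinite ranks are identified with \<open>\<infinity>\<close>.\<close>

definition rank :: "('k::field, 'a) hopf \<Rightarrow> enat" where
  "rank G = Inf {enat n |n. \<exists>g. generating_system G n g}"

end

theory Submission
  imports Defs "HOL-Algebra.Group_Action" "HOL-Number_Theory.Residues" "HOL-Library.Function_Algebras"
begin

text \<open>
  Write \<open>A = O(G)\<close>. Whether \<open>k\<close> has characteristic zero or is \<open>F\<^sub>p\<close>, prounipotence makes \<open>A\<close> conilpotent,
  and consequently points \<open>g\<^sub>1, \<dots>, g\<^sub>e\<close> generate \<open>G\<close> iff no nonzero primitive element of \<open>A\<close> is killed by all
  of them: every nonzero Hopf ideal contains a nonzero primitive element, and every primitive element
  generates a Hopf ideal. The primitive elements are the homomorphisms from \<open>G\<close> to the additive group, so this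
  is the analogue of Burnside's basis theorem. By linear algebra the injective map given by the \<open>h\<^sub>i\<close> from the
  primitive elements of \<open>O(H)\<close> to \<open>k\<^sup>e\<close> extends to an injective map on those of \<open>A\<close>. It remains to find a
  point of \<open>G\<close> that extends \<open>h\<^sub>i\<close> and has prescribed values on the primitive elements. Zorn's lemma
  reduces this to adjoining to a subalgebra \<open>C\<close>, stable under translation, an element \<open>x\<close> that is
  translation invariant modulo \<open>C\<close>. In such an extension the powers of \<open>x\<close> (below \<open>x\<^sup>p\<close> in
  characteristic \<open>p\<close>, where \<open>x\<^sup>p = x\<close>) are linearly independent over \<open>C\<close>, so the value at \<open>x\<close> can be
  chosen freely.
\<close>

section \<open>Linear forms and tensors\<close>

text \<open>The values on the primitive elements are prescribed before any point exists, so
  adjoining \<open>x\<close> must not bring in primitive elements on which the extended point takes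
  a wrong value. One computation controls this and also the freeness of the powers of
  \<open>x\<close>: a form that kills 1 acts to top order like a derivation, so looking one degree
  below a leading term \<gamma> x^n with \<gamma> scalar, where the coefficient is \<open>d\<close>,
  one finds that d + n \<gamma> x is invariant. It is then a scalar, and n \<gamma> = 0 because
  \<open>x\<close> is not in \<open>C\<close>. This needs \<open>n\<close> invertible in
  \<open>k\<close>, which is why the relation \<open>x^p = x\<close> and degrees below
  \<open>p\<close> enter in characteristic \<open>p\<close>. Tensors are lists that are compared by
  bilinear forms. They become manageable through contractions with linear forms: a tensor whose
  contractions all lie in a subspace U has a representative with left factors in U. In the same
  spirit identities between vectors are checked by applying every linear form, which turns them into
  identities in \<open>k\<close>.\<close>

lemma base_ring_simps [simp]:
  "carrier (base_ring :: 'k::field ring) = UNIV"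
  "add (base_ring :: 'k ring) = (+)"
  "x \<otimes>\<^bsub>(base_ring :: 'k ring)\<^esub> y = x * y"
  "one (base_ring :: 'k ring) = 1"
  "zero (base_ring :: 'k ring) = 0"
  by (simp_all add: ring_of_type_algebra_def)

lemma base_algebra_simps [simp]:
  "carrier (base_algebra :: ('k::field, 'k) module) = UNIV"
  "add (base_algebra :: ('k, 'k) module) = (+)"
  "x \<otimes>\<^bsub>(base_algebra :: ('k, 'k) module)\<^esub> y = x * y"
  "one (base_algebra :: ('k, 'k) module) = 1"
  "zero (base_algebra :: ('k, 'k) module) = 0"
  "c \<odot>\<^bsub>(base_algebra :: ('k, 'k) module)\<^esub> y = c * y"
  by (simp_all add: base_algebra_def ring.extend_def module.fields_def)

lemma linear_form_def:
  "linear_form V \<phi> \<longleftrightarrow>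
     (\<forall>x\<in>carrier V. \<forall>y\<in>carrier V. \<phi> (x \<oplus>\<^bsub>V\<^esub> y) = \<phi> x + \<phi> y) \<and>
     (\<forall>c. \<forall>x\<in>carrier V. \<phi> (c \<odot>\<^bsub>V\<^esub> x) = c * \<phi> x)"
  by (auto simp: linear_map_def)

lemma linear_mapD:
  assumes "linear_map A B f"
  shows "x \<in> carrier A \<Longrightarrow> f x \<in> carrier B"
    and "\<lbrakk>x \<in> carrier A; y \<in> carrier A\<rbrakk> \<Longrightarrow> f (x \<oplus>\<^bsub>A\<^esub> y) = f x \<oplus>\<^bsub>B\<^esub> f y"
    and "x \<in> carrier A \<Longrightarrow> f (c \<odot>\<^bsub>A\<^esub> x) = c \<odot>\<^bsub>B\<^esub> f x"
  using assms by (auto simp: linear_map_def)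

lemma linear_form_comp: "linear_map A B f \<Longrightarrow> linear_form B \<psi> \<Longrightarrow> linear_form A (\<psi> \<circ> f)"
  by (simp add: linear_map_def Pi_iff)

lemma form_simps:
  assumes "linear_form V \<phi>"
  shows "\<lbrakk>x \<in> carrier V; y \<in> carrier V\<rbrakk> \<Longrightarrow> \<phi> (x \<oplus>\<^bsub>V\<^esub> y) = \<phi> x + \<phi> y"
    and "x \<in> carrier V \<Longrightarrow> \<phi> (c \<odot>\<^bsub>V\<^esub> x) = c * \<phi> x"
  using assms by (auto simp: linear_form_def)

lemma linear_form_combine:
  assumes "linear_form V \<phi>" "linear_form V \<psi>"
  shows "linear_form V (\<lambda>x. \<phi> x + \<psi> x)" "linear_form V (\<lambda>x. \<phi> x - \<psi> x)"
    "linear_form V (\<lambda>x. c * \<phi> x)" "linear_form V (\<lambda>x. \<phi> x * c)" "linear_form V (\<lambda>x. 0)"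
    "linear_form V (\<lambda>x. - \<phi> x)"
  using assms by (auto simp: linear_form_def algebra_simps)

definition lin_subspace :: "('k::field, 'a, 'm) module_scheme \<Rightarrow> 'a set \<Rightarrow> bool" where
  "lin_subspace V U \<longleftrightarrow> U \<subseteq> carrier V \<and> \<zero>\<^bsub>V\<^esub> \<in> U \<and> (\<forall>x\<in>U. \<forall>y\<in>U. x \<oplus>\<^bsub>V\<^esub> y \<in> U) \<and>
     (\<forall>c. \<forall>x\<in>U. c \<odot>\<^bsub>V\<^esub> x \<in> U)"

lemma lin_subspaceD:
  assumes "lin_subspace V U"
  shows "x \<in> U \<Longrightarrow> x \<in> carrier V" "\<zero>\<^bsub>V\<^esub> \<in> U" "\<lbrakk>x \<in> U; y \<in> U\<rbrakk> \<Longrightarrow> x \<oplus>\<^bsub>V\<^esub> y \<in> U"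
    "x \<in> U \<Longrightarrow> c \<odot>\<^bsub>V\<^esub> x \<in> U"
  using assms by (auto simp: lin_subspace_def)

fun lspan :: "('k::field, 'a, 'm) module_scheme \<Rightarrow> 'a set \<Rightarrow> 'a list \<Rightarrow> 'a set" where
  "lspan V U [] = U"
| "lspan V U (v # vs) = {x \<oplus>\<^bsub>V\<^esub> c \<odot>\<^bsub>V\<^esub> v | x c. x \<in> lspan V U vs}"

fun lindep :: "('k::field, 'a, 'm) module_scheme \<Rightarrow> 'a set \<Rightarrow> 'a list \<Rightarrow> bool" where
  "lindep V U [] \<longleftrightarrow> True"
| "lindep V U (v # vs) \<longleftrightarrow> v \<notin> lspan V U vs \<and> lindep V U vs"

text \<open>The contraction id \<otimes> \<psi> from V \<otimes> V to V, evaluated on a representing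
  list.\<close>

definition ctr :: "('k::field, 'a, 'm) module_scheme \<Rightarrow> ('a \<Rightarrow> 'k) \<Rightarrow> ('a \<times> 'a) list \<Rightarrow> 'a" where
  "ctr V \<psi> s = list_sum V [\<psi> v \<odot>\<^bsub>V\<^esub> u. (u, v) \<leftarrow> s]"

lemma list_sum_simps [simp]:
  "list_sum V [] = \<zero>\<^bsub>V\<^esub>" "list_sum V (x # xs) = x \<oplus>\<^bsub>V\<^esub> list_sum V xs"
  by (simp_all add: list_sum_def)

lemma ctr_simps [simp]:
  "ctr V \<psi> [] = \<zero>\<^bsub>V\<^esub>" "ctr V \<psi> ((u, v) # s) = \<psi> v \<odot>\<^bsub>V\<^esub> u \<oplus>\<^bsub>V\<^esub> ctr V \<psi> s"
  by (simp_all add: ctr_def)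

section \<open>Linear algebra over k: relative spans, separating forms, dual bases\<close>

locale vspace = module "base_ring :: 'k ring" V for V :: "('k::field, 'a, 'm) module_scheme" (structure)
begin

lemma smult_closed' [simp, intro]: "x \<in> carrier V \<Longrightarrow> c \<odot> x \<in> carrier V"
  using smult_closed[of c x] by simp

lemma smult_simps:
  "x \<in> carrier V \<Longrightarrow> (c + d) \<odot> x = c \<odot> x \<oplus> d \<odot> x"
  "x \<in> carrier V \<Longrightarrow> y \<in> carrier V \<Longrightarrow> c \<odot> (x \<oplus> y) = c \<odot> x \<oplus> c \<odot> y"
  "x \<in> carrier V \<Longrightarrow> c \<odot> (d \<odot> x) = (c * d) \<odot> x"
  using smult_l_distr[of c d x] smult_r_distr[of c x y] smult_assoc1[of c d x] by auto

lemma smult_units [simp]: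
  "x \<in> carrier V \<Longrightarrow> 1 \<odot> x = x" "x \<in> carrier V \<Longrightarrow> 0 \<odot> x = \<zero>" "c \<odot> \<zero> = \<zero>"
  using smult_one[of x] smult_l_null[of x] smult_r_null[of c] by auto

lemma minus_conv: "x \<in> carrier V \<Longrightarrow> \<ominus> x = (-1) \<odot> x"
proof -
  assume x: "x \<in> carrier V"
  have "x \<oplus> (-1) \<odot> x = (1 + -1) \<odot> x"
    using x by (subst smult_simps) auto
  also have "\<dots> = \<zero>" using x by simp
  finally show ?thesis using x by (metis M.minus_equality M.a_comm smult_closed')
qed

lemma form_zero: "linear_form V \<phi> \<Longrightarrow> \<phi> \<zero> = 0"
  by (metis form_simps(2) M.zero_closed mult_zero_left smult_units(2))

lemma form_minus: "linear_form V \<phi> \<Longrightarrow> x \<in> carrier V \<Longrightarrow> \<phi> (\<ominus> x) = - \<phi> x"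
  by (simp add: minus_conv form_simps)

lemma form_diff: "linear_form V \<phi> \<Longrightarrow> x \<in> carrier V \<Longrightarrow> y \<in> carrier V \<Longrightarrow> \<phi> (x \<ominus> y) = \<phi> x - \<phi> y"
  by (simp add: a_minus_def form_simps form_minus)

lemmas fsimps = form_simps form_zero form_minus form_diff

lemma subspace_minus: "lin_subspace V U \<Longrightarrow> x \<in> U \<Longrightarrow> \<ominus> x \<in> U"
  by (metis lin_subspaceD(1,4) minus_conv)

lemma subspace_diff: "lin_subspace V U \<Longrightarrow> x \<in> U \<Longrightarrow> y \<in> U \<Longrightarrow> x \<ominus> y \<in> U"
  by (simp add: a_minus_def lin_subspaceD subspace_minus)

lemma subspace_zero: "lin_subspace V {\<zero>}"
  by (auto simp: lin_subspace_def)

lemma subspace_Int: "lin_subspace V U \<Longrightarrow> lin_subspace V W \<Longrightarrow> lin_subspace V (U \<inter> W)"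
  by (auto simp: lin_subspace_def)

lemma subspace_add_cancel:
  assumes "lin_subspace V U" "u \<in> U" "x \<in> carrier V" "x \<oplus> u \<in> U"
  shows "x \<in> U"
proof -
  have "x = (x \<oplus> u) \<ominus> u"
    using assms by (metis M.add.inv_solve_right a_minus_def lin_subspaceD(1) M.add.m_closed)
  thus ?thesis using assms by (metis subspace_diff)
qed

lemma subspace_smult_cancel:
  assumes "lin_subspace V U" "c \<odot> x \<in> U" "c \<noteq> 0" "x \<in> carrier V"
  shows "x \<in> U"
proof -
  have "x = inverse c \<odot> (c \<odot> x)" using assms by (simp add: smult_simps)
  thus ?thesis using assms lin_subspaceD(4) by metis
qed

lemma lspan_subspace:
  "lin_subspace V U \<Longrightarrow> set vs \<subseteq> carrier V \<Longrightarrow> lin_subspace V (lspan V U vs)"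
proof (induction vs)
  case (Cons v vs)
  then have L: "lin_subspace V (lspan V U vs)" and v: "v \<in> carrier V" by auto
  show ?case unfolding lin_subspace_def
  proof (intro conjI ballI allI)
    show "lspan V U (v # vs) \<subseteq> carrier V" using lin_subspaceD(1)[OF L] v by auto
    have "\<zero> = \<zero> \<oplus> 0 \<odot> v" using v by simp
    thus "\<zero> \<in> lspan V U (v # vs)" using lin_subspaceD(2)[OF L] by force
  next
    fix x y assume "x \<in> lspan V U (v # vs)" "y \<in> lspan V U (v # vs)"
    then obtain a c b d where "a \<in> lspan V U vs" "b \<in> lspan V U vs"
      and xy: "x = a \<oplus> c \<odot> v" "y = b \<oplus> d \<odot> v" by auto
    moreover have "a \<in> carrier V" "b \<in> carrier V" using \<open>a \<in> lspan V U vs\<close> \<open>b \<in> lspan V U vs\<close> lin_subspaceD(1)[OF L] by blast+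
    ultimately show "x \<oplus> y \<in> lspan V U (v # vs)"
      using v lin_subspaceD(3)[OF L, of a b]
      by (auto intro!: exI[of _ "a \<oplus> b"] exI[of _ "c + d"] simp: smult_simps M.a_ac)
  next
    fix c x assume "x \<in> lspan V U (v # vs)"
    then obtain a d where "a \<in> lspan V U vs" and x: "x = a \<oplus> d \<odot> v" by auto
    moreover have "a \<in> carrier V" using \<open>a \<in> lspan V U vs\<close> lin_subspaceD(1)[OF L] by blast
    ultimately show "c \<odot> x \<in> lspan V U (v # vs)"
      using v lin_subspaceD(4)[OF L, of a c]
      by (auto intro!: exI[of _ "c \<odot> a"] exI[of _ "c * d"] simp: smult_simps)
  qed
qed simp

lemma lspan_base: "lin_subspace V U \<Longrightarrow> set vs \<subseteq> carrier V \<Longrightarrow> U \<subseteq> lspan V U vs"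
proof (induction vs)
  case (Cons v vs)
  show ?case
  proof
    fix x assume "x \<in> U"
    with Cons have "x \<in> lspan V U vs" "x = x \<oplus> 0 \<odot> v" using lin_subspaceD(1)[OF Cons(2)] by auto
    thus "x \<in> lspan V U (v # vs)" by force
  qed
qed simp

lemma lspan_mem: "lin_subspace V U \<Longrightarrow> set vs \<subseteq> carrier V \<Longrightarrow> set vs \<subseteq> lspan V U vs"
proof (induction vs)
  case (Cons v vs)
  then have L: "lin_subspace V (lspan V U vs)" and v: "v \<in> carrier V" by (auto simp: lspan_subspace)
  have "v = \<zero> \<oplus> 1 \<odot> v" using v by simp
  hence "v \<in> lspan V U (v # vs)" using lin_subspaceD(2)[OF L] by force
  moreover have "lspan V U vs \<subseteq> lspan V U (v # vs)"
  proof
    fix x assume "x \<in> lspan V U vs"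
    moreover from this have "x = x \<oplus> 0 \<odot> v" using lin_subspaceD(1)[OF L] v by auto
    ultimately show "x \<in> lspan V U (v # vs)" by force
  qed
  ultimately show ?case using Cons by auto
qed simp

lemma lspan_least:
  "lin_subspace V S \<Longrightarrow> U \<subseteq> S \<Longrightarrow> set vs \<subseteq> S \<Longrightarrow> lspan V U vs \<subseteq> S"
proof (induction vs)
  case (Cons v vs)
  then have "lspan V U vs \<subseteq> S" "v \<in> S" by auto
  then show ?case using lin_subspaceD(3,4)[OF Cons.prems(1)] by (auto simp: subset_iff)
qed simp

lemma list_sum_closed: "set xs \<subseteq> carrier V \<Longrightarrow> list_sum V xs \<in> carrier V"
  by (induction xs) auto

lemma list_sum_subspace: "lin_subspace V U \<Longrightarrow> set xs \<subseteq> U \<Longrightarrow> list_sum V xs \<in> U"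
  by (induction xs) (auto simp: lin_subspaceD)

lemma form_list_sum: "linear_form V \<phi> \<Longrightarrow> set xs \<subseteq> carrier V \<Longrightarrow> \<phi> (list_sum V xs) = sum_list (map \<phi> xs)"
  by (induction xs) (auto simp: fsimps list_sum_closed)

lemma ctr_closed: "set s \<subseteq> carrier V \<times> carrier V \<Longrightarrow> ctr V \<psi> s \<in> carrier V"
  by (induction s) auto

lemma form_ctr: "linear_form V \<phi> \<Longrightarrow> set s \<subseteq> carrier V \<times> carrier V \<Longrightarrow>
    \<phi> (ctr V \<psi> s) = (\<Sum>(u, v)\<leftarrow>s. \<phi> u * \<psi> v)"
  by (induction s) (auto simp: fsimps ctr_closed)

text \<open>Among the subspaces that contain \<open>U\<close> and avoid \<open>x\<close>, Zorn's
  lemma gives a maximal one, \<open>M\<close>. Maximality makes V the direct sum of \<open>M\<close>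
  and the line of \<open>x\<close>, and the form is the coefficient of \<open>x\<close>.\<close>

lemma hyperplane:
  assumes U: "lin_subspace V U" and x: "x \<in> carrier V" "x \<notin> U"
  shows "\<exists>\<phi>. linear_form V \<phi> \<and> \<phi> x = 1 \<and> (\<forall>u\<in>U. \<phi> u = 0)"
proof -
  define S where "S = {W. lin_subspace V W \<and> U \<subseteq> W \<and> x \<notin> W}"
  have "\<exists>M\<in>S. \<forall>W\<in>S. M \<subseteq> W \<longrightarrow> W = M"
  proof (rule subset_Zorn_nonempty)
    show "S \<noteq> {}" using assms by (auto simp: S_def)
    fix \<C> assume C: "\<C> \<noteq> {}" "subset.chain S \<C>"
    have sub: "W \<in> \<C> \<Longrightarrow> lin_subspace V W \<and> U \<subseteq> W \<and> x \<notin> W" for W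
      using C by (auto simp: subset.chain_def S_def)
    have add: "a \<oplus> b \<in> \<Union>\<C>" if "a \<in> \<Union>\<C>" "b \<in> \<Union>\<C>" for a b
    proof -
      from that obtain W W' where W: "W \<in> \<C>" "W' \<in> \<C>" "a \<in> W" "b \<in> W'" by auto
      with C(2) have "W \<subseteq> W' \<or> W' \<subseteq> W" by (auto simp: subset.chain_def)
      with W sub show ?thesis by (meson UnionI lin_subspaceD(3) subset_iff)
    qed
    obtain W0 where W0: "W0 \<in> \<C>" using C(1) by auto
    have "lin_subspace V (\<Union>\<C>)"
      unfolding lin_subspace_def
    proof (intro conjI ballI allI)
      have "W \<subseteq> carrier V" if "W \<in> \<C>" for W using sub[OF that] by (simp add: lin_subspace_def)
      thus "\<Union>\<C> \<subseteq> carrier V" by (rule Union_least)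
      show "\<zero> \<in> \<Union>\<C>" using sub[OF W0] W0 by (auto simp: lin_subspace_def)
      show "c \<odot> a \<in> \<Union>\<C>" if "a \<in> \<Union>\<C>" for c a
      proof -
        from that obtain W where "W \<in> \<C>" "a \<in> W" by auto
        with sub[of W] have "c \<odot> a \<in> W" by (auto simp: lin_subspace_def)
        thus ?thesis using \<open>W \<in> \<C>\<close> by blast
      qed
    qed (rule add)
    thus "\<Union>\<C> \<in> S" using sub C(1) by (auto simp: S_def)
  qed
  then obtain M where M: "lin_subspace V M" "U \<subseteq> M" "x \<notin> M"
    and max: "\<And>W. lin_subspace V W \<Longrightarrow> U \<subseteq> W \<Longrightarrow> x \<notin> W \<Longrightarrow> M \<subseteq> W \<Longrightarrow> W = M"
    by (auto simp: S_def)
  have all: "y \<in> lspan V M [x]" if y: "y \<in> carrier V" for y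
  proof (cases "y \<in> M")
    case True thus ?thesis using lspan_base[OF M(1), of "[x]"] x by auto
  next
    case False
    have L: "lin_subspace V (lspan V M [y])" "M \<subseteq> lspan V M [y]" "y \<in> lspan V M [y]"
      using lspan_subspace[OF M(1), of "[y]"] lspan_base[OF M(1), of "[y]"]
        lspan_mem[OF M(1), of "[y]"] y by auto
    with False M(2) max[of "lspan V M [y]"] have "x \<in> lspan V M [y]" by blast
    then obtain m c where m: "m \<in> M" and xe: "x = m \<oplus> c \<odot> y" by auto
    have mc: "m \<in> carrier V" using m lin_subspaceD(1)[OF M(1)] by auto
    \<comment> \<open>Otherwise x = m would lie in \<open>M\<close>. So the relation x = m + c y can
      be solved for \<open>y\<close>.\<close>
    have "c \<noteq> 0" using xe m M(3) y mc by auto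
    have "x \<oplus> (-1) \<odot> m = c \<odot> y" using mc y xe minus_conv[OF mc]
      by (metis M.add.inv_solve_right' M.add.m_comm smult_closed' M.add.m_closed)
    hence "y = inverse c \<odot> (x \<oplus> (-1) \<odot> m)" using \<open>c \<noteq> 0\<close> y by (simp add: smult_simps)
    also have "\<dots> = (- inverse c) \<odot> m \<oplus> inverse c \<odot> x"
      using mc x by (simp add: smult_simps M.a_comm)
    finally show ?thesis using lin_subspaceD(4)[OF M(1) m] by auto
  qed
  have uniq: "c = d" if "m \<in> M" "m' \<in> M" "m \<oplus> c \<odot> x = m' \<oplus> d \<odot> x" for m m' c d
  proof (rule ccontr)
    assume "c \<noteq> d"
    have mc: "m \<in> carrier V" "m' \<in> carrier V" using that lin_subspaceD(1)[OF M(1)] by auto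
    have "(c - d) \<odot> x = c \<odot> x \<oplus> (-d) \<odot> x" using x smult_simps(1)[of x c "-d"] by simp
    also have "\<dots> = ((m \<oplus> c \<odot> x) \<ominus> m) \<oplus> (-d) \<odot> x"
      using mc x by (metis M.add.inv_solve_right M.add.m_comm a_minus_def smult_closed' M.add.m_closed)
    also have "\<dots> = ((m' \<oplus> d \<odot> x) \<ominus> m) \<oplus> (-d) \<odot> x" using that by simp
    also have "\<dots> = (m' \<ominus> m) \<oplus> (d \<odot> x \<oplus> (-d) \<odot> x)"
      using mc x by (simp add: a_minus_def M.a_ac)
    also have "d \<odot> x \<oplus> (-d) \<odot> x = \<zero>" using x smult_simps(1)[of x d "-d"] by simp
    finally have "(c - d) \<odot> x = m' \<ominus> m" using mc by simp
    hence "(c - d) \<odot> x \<in> M" using that M(1) subspace_diff by metis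
    thus False using subspace_smult_cancel[OF M(1), of "c - d" x] x M(3) \<open>c \<noteq> d\<close> by auto
  qed
  define \<phi> where "\<phi> y = (THE c. \<exists>m\<in>M. y = m \<oplus> c \<odot> x)" for y
  have val: "\<phi> (m \<oplus> c \<odot> x) = c" if "m \<in> M" for m c
    unfolding \<phi>_def using uniq that by (intro the_equality) auto
  have "linear_form V \<phi>"
    unfolding linear_form_def
  proof (intro conjI ballI allI)
    fix y z assume yz: "y \<in> carrier V" "z \<in> carrier V"
    then obtain m c m' d where mm: "m \<in> M" "m' \<in> M" "y = m \<oplus> c \<odot> x" "z = m' \<oplus> d \<odot> x"
      using all[of y] all[of z] by auto
    have "m \<in> carrier V" "m' \<in> carrier V" using mm lin_subspaceD(1)[OF M(1)] by auto
    hence "y \<oplus> z = (m \<oplus> m') \<oplus> (c + d) \<odot> x" unfolding mm using x by (simp add: smult_simps M.a_ac)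
    thus "\<phi> (y \<oplus> z) = \<phi> y + \<phi> z" using val mm lin_subspaceD(3)[OF M(1)] by simp
  next
    fix c y assume "y \<in> carrier V"
    then obtain m d where mm: "m \<in> M" "y = m \<oplus> d \<odot> x" using all[of y] by auto
    have "m \<in> carrier V" using mm lin_subspaceD(1)[OF M(1)] by auto
    hence "c \<odot> y = (c \<odot> m) \<oplus> (c * d) \<odot> x" unfolding mm using x by (simp add: smult_simps)
    thus "\<phi> (c \<odot> y) = c * \<phi> y" using val mm lin_subspaceD(4)[OF M(1)] by simp
  qed
  moreover have "\<phi> x = 1" using val[of \<zero> 1] lin_subspaceD(2)[OF M(1)] x by simp
  moreover have "\<phi> u = 0" if "u \<in> U" for u
    using val[of u 0] that M x lin_subspaceD(1)[OF U] by auto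
  ultimately show ?thesis by blast
qed

lemma forms_eqI:
  assumes "x \<in> carrier V" "y \<in> carrier V" "\<And>\<phi>. linear_form V \<phi> \<Longrightarrow> \<phi> x = \<phi> y"
  shows "x = y"
proof (rule ccontr)
  assume "x \<noteq> y"
  hence "x \<ominus> y \<notin> {\<zero>}" using assms by (metis M.minus_equality M.minus_minus a_minus_def M.add.inv_closed
     singletonD M.a_comm)
  then obtain \<phi> where "linear_form V \<phi>" "\<phi> (x \<ominus> y) = 1"
    using hyperplane[OF subspace_zero, of "x \<ominus> y"] assms by auto
  thus False using assms(3)[of \<phi>] assms(1,2) by (simp add: form_diff)
qed

text \<open>Scale a vector of \<open>U\<close> to \<open>x0\<close> with \<phi> x0 = 1. The wanted
  form is 1 at \<open>x0\<close> and kills \<open>K\<close>, the sum of \<open>W\<close> and the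
  kernel of \<phi> on \<open>U\<close>; the trivial intersection of \<open>U\<close> and
  \<open>W\<close> keeps \<open>x0\<close> out of \<open>K\<close>.\<close>

lemma form_extend:
  assumes U: "lin_subspace V U" and W: "lin_subspace V W" and UW: "U \<inter> W \<subseteq> {\<zero>}"
    and add: "\<And>x y. x \<in> U \<Longrightarrow> y \<in> U \<Longrightarrow> \<phi> (x \<oplus> y) = \<phi> x + \<phi> y"
    and smult: "\<And>c x. x \<in> U \<Longrightarrow> \<phi> (c \<odot> x) = c * \<phi> x"
  shows "\<exists>\<psi>. linear_form V \<psi> \<and> (\<forall>x\<in>U. \<psi> x = \<phi> x) \<and> (\<forall>x\<in>W. \<psi> x = 0)"
proof (cases "\<forall>x\<in>U. \<phi> x = 0")
  case True
  thus ?thesis by (intro exI[of _ "\<lambda>_. 0"]) (auto simp: linear_form_def)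
next
  case False
  then obtain x where x: "x \<in> U" "\<phi> x \<noteq> 0" by auto
  define x0 where "x0 = inverse (\<phi> x) \<odot> x"
  have x0: "x0 \<in> U" "\<phi> x0 = 1" using x smult U by (auto simp: x0_def lin_subspaceD)
  define K where "K = {a \<oplus> w | a w. a \<in> U \<and> \<phi> a = 0 \<and> w \<in> W}"
  note Uc = lin_subspaceD[OF U] and Wc = lin_subspaceD[OF W]
  have phi0: "\<phi> \<zero> = 0" using smult[OF Uc(2), of 0] Uc by simp
  have K: "lin_subspace V K"
    unfolding lin_subspace_def
  proof (intro conjI ballI allI)
    show "K \<subseteq> carrier V" using Uc Wc by (auto simp: K_def)
    show "\<zero> \<in> K" unfolding K_def using Uc(2) Wc(2) phi0 M.l_zero by (force intro: M.l_zero[symmetric])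
  next
    fix y z assume "y \<in> K" "z \<in> K"
    then obtain a w b v where *: "a \<in> U" "\<phi> a = 0" "w \<in> W" "b \<in> U" "\<phi> b = 0" "v \<in> W"
      "y = a \<oplus> w" "z = b \<oplus> v" by (auto simp: K_def)
    have "y \<oplus> z = (a \<oplus> b) \<oplus> (w \<oplus> v)" using * Uc(1) Wc(1) by (simp add: M.a_ac)
    moreover have "a \<oplus> b \<in> U" "\<phi> (a \<oplus> b) = 0" "w \<oplus> v \<in> W" using * Uc(3) Wc(3) add by auto
    ultimately show "y \<oplus> z \<in> K" unfolding K_def by blast
  next
    fix c y assume "y \<in> K"
    then obtain a w where *: "a \<in> U" "\<phi> a = 0" "w \<in> W" "y = a \<oplus> w" by (auto simp: K_def)
    have "c \<odot> y = c \<odot> a \<oplus> c \<odot> w" using * Uc(1) Wc(1) by (simp add: smult_simps)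
    moreover have "c \<odot> a \<in> U" "\<phi> (c \<odot> a) = 0" "c \<odot> w \<in> W" using * Uc(4) Wc(4) smult by auto
    ultimately show "c \<odot> y \<in> K" unfolding K_def by blast
  qed
  have "x0 \<notin> K"
  proof
    assume "x0 \<in> K"
    then obtain a w where *: "a \<in> U" "\<phi> a = 0" "w \<in> W" "x0 = a \<oplus> w" by (auto simp: K_def)
    hence c: "a \<in> carrier V" "w \<in> carrier V" using Uc Wc by auto
    have "w = x0 \<ominus> a" using c * by (metis M.add.inv_solve_right M.add.m_comm a_minus_def M.add.m_closed)
    hence "w \<in> U" using * U x0 subspace_diff by metis
    hence "w = \<zero>" using UW * by auto
    thus False using * x0 c by simp
  qed
  then obtain \<psi> where \<psi>: "linear_form V \<psi>" "\<psi> x0 = 1" "\<And>u. u \<in> K \<Longrightarrow> \<psi> u = 0"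
    using hyperplane[OF K, of x0] x0 Uc by auto
  have "\<psi> y = \<phi> y" if y: "y \<in> U" for y
  proof -
    have "y \<oplus> (- \<phi> y) \<odot> x0 \<in> U" "\<phi> (y \<oplus> (- \<phi> y) \<odot> x0) = 0"
      using y x0 Uc add smult by auto
    hence "y \<oplus> (- \<phi> y) \<odot> x0 \<in> K"
      unfolding K_def using Wc(2) M.r_zero[symmetric, OF Uc(1), of "y \<oplus> (- \<phi> y) \<odot> x0"] by blast
    from \<psi>(3)[OF this] show ?thesis using \<psi>(1,2) y x0 Uc by (simp add: fsimps)
  qed
  moreover have "\<psi> w = 0" if "w \<in> W" for w
  proof (rule \<psi>(3))
    show "w \<in> K" unfolding K_def using that Uc(2) phi0 Wc(1) by (force intro: M.l_zero[symmetric])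
  qed
  ultimately show ?thesis using \<psi>(1) by blast
qed

text \<open>Induction on the spanning list: besides a basis for the part of \<open>T\<close> in the
  smaller span at most one vector \<open>t\<close> is needed, since every element of
  \<open>T\<close> falls into the smaller span after subtracting a multiple of \<open>t\<close>.
  That the vectors come from \<open>T\<close> itself is what the applications use.\<close>

lemma finitely_spanned:
  assumes "lin_subspace V T" "lin_subspace V U" "set us \<subseteq> carrier V" "T \<subseteq> lspan V U us"
  shows "\<exists>vs. set vs \<subseteq> T \<and> T \<subseteq> lspan V U vs \<and> lindep V U vs"
  using assms
proof (induction us arbitrary: T)
  case Nil
  thus ?case by (intro exI[of _ "[]"]) auto
next
  case (Cons u us)
  let ?L = "lspan V U us"
  have L: "lin_subspace V ?L" and u: "u \<in> carrier V" using Cons by (auto intro: lspan_subspace)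
  obtain vs where vs: "set vs \<subseteq> T \<inter> ?L" "T \<inter> ?L \<subseteq> lspan V U vs" "lindep V U vs"
    using Cons.IH[of "T \<inter> ?L"] Cons.prems subspace_Int[OF Cons.prems(1) L] by auto
  note Tc = lin_subspaceD[OF Cons.prems(1)] and Lc = lin_subspaceD[OF L]
  show ?case
  proof (cases "T \<subseteq> ?L")
    case True thus ?thesis using vs by (intro exI[of _ vs]) auto
  next
    case False
    then obtain t where t: "t \<in> T" "t \<notin> ?L" by auto
    with Cons.prems obtain y c where yc: "y \<in> ?L" "t = y \<oplus> c \<odot> u" by auto
    have c0: "c \<noteq> 0" using yc t u Lc(1) by auto
    have sub: "lspan V U vs \<subseteq> ?L"
      using vs lspan_least[OF L, of U vs] lspan_base[OF Cons.prems(2), of us] Cons.prems by auto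
    have "T \<subseteq> lspan V U (t # vs)"
    proof
      fix z assume z: "z \<in> T"
      with Cons.prems obtain y' d where y': "y' \<in> ?L" "z = y' \<oplus> d \<odot> u" by auto
      \<comment> \<open>The multiple of \<open>t\<close> is chosen to cancel the coefficient
        \<open>d\<close> of \<open>u\<close> in \<open>z\<close>.\<close>
      define w where "w = z \<oplus> (- (d / c)) \<odot> t"
      have "w \<in> T" unfolding w_def using z t Tc by auto
      moreover have "w = y' \<oplus> (- (d / c)) \<odot> y"
        unfolding w_def y' yc(2) using y' yc u Lc(1) c0
        by (intro forms_eqI) (auto simp: fsimps field_simps)
      hence "w \<in> ?L" using y' yc Lc by auto
      ultimately have "w \<in> lspan V U vs" using vs by auto
      moreover have "z = w \<oplus> (d / c) \<odot> t"
        unfolding w_def using z t Tc(1) by (intro forms_eqI) (auto simp: fsimps field_simps)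
      ultimately show "z \<in> lspan V U (t # vs)" by auto
    qed
    moreover have "lindep V U (t # vs)" using vs t sub by auto
    ultimately show ?thesis using vs t by (intro exI[of _ "t # vs"]) auto
  qed
qed

lemma dual_forms:
  assumes U: "lin_subspace V U" and "set vs \<subseteq> carrier V" "lindep V U vs"
  shows "\<exists>\<phi>. \<forall>j<length vs. linear_form V (\<phi> j) \<and> (\<forall>u\<in>U. \<phi> j u = 0) \<and>
    (\<forall>i<length vs. \<phi> j (vs ! i) = (if i = j then 1 else 0))"
  using assms(2,3)
proof (induction vs)
  case (Cons v vs)
  then obtain \<phi> where \<phi>: "\<forall>j<length vs. linear_form V (\<phi> j) \<and> (\<forall>u\<in>U. \<phi> j u = 0) \<and>
    (\<forall>i<length vs. \<phi> j (vs ! i) = (if i = j then 1 else 0))" by auto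
  have L: "lin_subspace V (lspan V U vs)" "U \<subseteq> lspan V U vs" "set vs \<subseteq> lspan V U vs"
    using Cons.prems lspan_subspace[OF U] lspan_base[OF U] lspan_mem[OF U] by auto
  obtain \<theta> where \<theta>: "linear_form V \<theta>" "\<theta> v = 1" "\<And>u. u \<in> lspan V U vs \<Longrightarrow> \<theta> u = 0"
    using hyperplane[OF L(1), of v] Cons.prems by auto
  \<comment> \<open>The new form \<theta> kills the old vectors, but the old forms need not kill the
    new vector \<open>v\<close>. Subtracting \<open>\<phi> j v\<close> times \<theta> repairs this
    and changes no value on the old vectors.\<close>
  define \<psi> where "\<psi> j = (case j of 0 \<Rightarrow> \<theta> | Suc j \<Rightarrow> (\<lambda>x. \<phi> j x - \<phi> j v * \<theta> x))" for j
  show ?case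
  proof (intro exI[of _ \<psi>] allI impI)
    fix j assume j: "j < length (v # vs)"
    show "linear_form V (\<psi> j) \<and> (\<forall>u\<in>U. \<psi> j u = 0) \<and>
       (\<forall>i<length (v # vs). \<psi> j ((v # vs) ! i) = (if i = j then 1 else 0))"
    proof (cases j)
      case 0
      thus ?thesis using \<theta> L by (auto simp: \<psi>_def nth_Cons subset_iff split: nat.splits)
    next
      case (Suc m)
      with j have m: "m < length vs" by simp
      have "linear_form V (\<psi> j)" using Suc \<phi> m \<theta>(1)
        by (auto simp: \<psi>_def intro!: linear_form_combine)
      moreover have "\<theta> (vs ! i) = 0" if "i < length vs" for i using \<theta>(3)[of "vs ! i"] L(3) that by (auto simp: subset_iff)
      ultimately show ?thesis using Suc \<phi> m \<theta> L
        by (auto simp: \<psi>_def nth_Cons subset_iff split: nat.splits)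
    qed
  qed
qed simp

text \<open>The vectors with this property form a subspace that contains \<open>U\<close> and every
  \<open>vs ! i\<close>, hence the whole span.\<close>

lemma lspan_expand:
  assumes U: "lin_subspace V U" and vs: "set vs \<subseteq> carrier V"
    and \<phi>: "\<And>j. j < length vs \<Longrightarrow> linear_form V (\<phi> j) \<and> (\<forall>u\<in>U. \<phi> j u = 0) \<and>
    (\<forall>i<length vs. \<phi> j (vs ! i) = (if i = j then 1 else 0))"
    and x: "x \<in> lspan V U vs"
  shows "x \<ominus> list_sum V (map (\<lambda>j. \<phi> j x \<odot> vs ! j) [0..<length vs]) \<in> U"
proof -
  let ?S = "\<lambda>x. list_sum V (map (\<lambda>j. \<phi> j x \<odot> vs ! j) [0..<length vs])"
  have vsi: "vs ! j \<in> carrier V" if "j < length vs" for j using vs that by auto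
  have S: "?S x \<in> carrier V" if "x \<in> carrier V" for x
    using that vsi by (intro list_sum_closed) auto
  have fS: "\<psi> (?S x) = (\<Sum>j\<leftarrow>[0..<length vs]. \<phi> j x * \<psi> (vs ! j))"
    if "linear_form V \<psi>" "x \<in> carrier V" for \<psi> x
  proof -
    have "\<psi> (?S x) = sum_list (map (\<psi> \<circ> (\<lambda>j. \<phi> j x \<odot> vs ! j)) [0..<length vs])"
      using that vsi by (subst form_list_sum) auto
    also have "\<dots> = (\<Sum>j\<leftarrow>[0..<length vs]. \<phi> j x * \<psi> (vs ! j))" using that vs
      by (intro arg_cong[of _ _ sum_list] map_cong) (auto simp: fsimps subset_iff)
    finally show ?thesis .
  qed
  have sl: "(\<Sum>j\<leftarrow>[0..<length vs]. f j) = (\<Sum>j<length vs. f j)" for f :: "nat \<Rightarrow> 'k"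
    by (simp add: interv_sum_list_conv_sum_set_nat atLeast0LessThan)
  define D where "D = {x \<in> carrier V. x \<ominus> ?S x \<in> U}"
  note Uc = lin_subspaceD[OF U]
  have "lin_subspace V D"
    unfolding lin_subspace_def
  proof (intro conjI ballI allI)
    show "D \<subseteq> carrier V" by (auto simp: D_def)
    have "\<zero> \<ominus> ?S \<zero> = \<zero>"
      using S by (intro forms_eqI) (auto simp: fsimps fS sl \<phi>)
    thus "\<zero> \<in> D" using Uc by (auto simp: D_def)
  next
    fix y z assume yz: "y \<in> D" "z \<in> D"
    hence yz': "y \<in> carrier V" "z \<in> carrier V" by (auto simp: D_def)
    have "(y \<oplus> z) \<ominus> ?S (y \<oplus> z) = (y \<ominus> ?S y) \<oplus> (z \<ominus> ?S z)"
      using S yz' by (intro forms_eqI) (auto simp: fsimps fS sl \<phi> ring_distribs sum.distrib)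
    thus "y \<oplus> z \<in> D" using yz Uc(3) by (auto simp: D_def)
  next
    fix c y assume y: "y \<in> D"
    hence y': "y \<in> carrier V" by (auto simp: D_def)
    have "(c \<odot> y) \<ominus> ?S (c \<odot> y) = c \<odot> (y \<ominus> ?S y)"
      using S y' by (intro forms_eqI) (auto simp: fsimps fS sl \<phi> right_diff_distrib sum_distrib_left mult_ac)
    thus "c \<odot> y \<in> D" using y Uc(4) by (auto simp: D_def)
  qed
  moreover have "U \<subseteq> D"
  proof
    fix u assume u: "u \<in> U"
    have "u \<ominus> ?S u = u"
      using S u Uc(1) by (intro forms_eqI) (auto simp: fsimps fS sl \<phi>)
    thus "u \<in> D" using u Uc(1) by (auto simp: D_def)
  qed
  moreover have "set vs \<subseteq> D"
  proof
    fix v assume "v \<in> set vs"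
    then obtain i where i: "i < length vs" "v = vs ! i" by (metis in_set_conv_nth)
    have v: "v \<in> carrier V" using vs \<open>v \<in> set vs\<close> by auto
    have "(\<Sum>j<length vs. \<phi> j v * \<psi> (vs ! j)) = \<psi> v" if "linear_form V \<psi>" for \<psi>
    proof -
      have "(\<Sum>j<length vs. \<phi> j v * \<psi> (vs ! j)) = (\<Sum>j<length vs. if j = i then \<psi> v else 0)"
        using \<phi> i by (intro sum.cong) auto
      thus ?thesis using i by simp
    qed
    hence "v \<ominus> ?S v = \<zero>"
      using S v by (intro forms_eqI) (auto simp: fsimps fS sl)
    thus "v \<in> D" using v Uc by (auto simp: D_def)
  qed
  ultimately have "lspan V U vs \<subseteq> D" by (intro lspan_least) auto
  with x show ?thesis by (auto simp: D_def)
qed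

section \<open>Tensors and their contractions\<close>

lemma bilinear_simps:
  assumes "bilinear_form V \<beta>"
  shows "\<lbrakk>x \<in> carrier V; y \<in> carrier V; z \<in> carrier V\<rbrakk> \<Longrightarrow> \<beta> (x \<oplus> y) z = \<beta> x z + \<beta> y z"
   "\<lbrakk>x \<in> carrier V; y \<in> carrier V; z \<in> carrier V\<rbrakk> \<Longrightarrow> \<beta> z (x \<oplus> y) = \<beta> z x + \<beta> z y"
   "\<lbrakk>x \<in> carrier V; z \<in> carrier V\<rbrakk> \<Longrightarrow> \<beta> (c \<odot> x) z = c * \<beta> x z"
   "\<lbrakk>x \<in> carrier V; z \<in> carrier V\<rbrakk> \<Longrightarrow> \<beta> z (c \<odot> x) = c * \<beta> z x"
   "z \<in> carrier V \<Longrightarrow> \<beta> \<zero> z = 0"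
   "z \<in> carrier V \<Longrightarrow> \<beta> z \<zero> = 0"
  using assms form_zero[of "\<beta> z"] form_zero[of "\<lambda>x. \<beta> x z"]
  by (auto simp: bilinear_form_def linear_form_def)

text \<open>If \<open>v\<close> is a combination of the right factors of \<open>s\<close>, then u
  \<otimes> v can be distributed over the left factors of \<open>s\<close>. The tensor loses a
  summand, which drives the induction in \<open>tensor_left_subspace\<close>.\<close>

lemma absorb_tensor:
  assumes "set s \<subseteq> carrier V \<times> carrier V" "u \<in> carrier V" "v \<in> lspan V {\<zero>} (map snd s)"
  shows "\<exists>t. length t = length s \<and> set t \<subseteq> carrier V \<times> carrier V \<and> tensor_eq V ((u, v) # s) t"
  using assms
proof (induction s arbitrary: v)
  case Nil
  thus ?case by (auto simp: tensor_eq_def bilinear_simps)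
next
  case (Cons p s)
  obtain u1 v1 where p: "p = (u1, v1)" by force
  from Cons.prems p obtain x c where x: "x \<in> lspan V {\<zero>} (map snd s)" "v = x \<oplus> c \<odot> v1" by auto
  have xc: "x \<in> carrier V"

  proof -
    have "set (map snd s) \<subseteq> carrier V" using Cons.prems(1) by auto
    thus ?thesis using lin_subspaceD(1)[OF lspan_subspace[OF subspace_zero] x(1)] by blast
  qed
  obtain t where t: "length t = length s" "set t \<subseteq> carrier V \<times> carrier V" "tensor_eq V ((u, x) # s) t"
    using Cons.IH[of x] Cons.prems x by auto
  have "tensor_eq V ((u, v) # p # s) ((u1 \<oplus> c \<odot> u, v1) # t)"
    unfolding tensor_eq_def
  proof (intro allI impI)
    fix \<beta> assume b: "bilinear_form V \<beta>"
    have "\<beta> u x + (\<Sum>(x, y)\<leftarrow>s. \<beta> x y) = (\<Sum>(x, y)\<leftarrow>t. \<beta> x y)"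
      using t(3) b by (auto simp: tensor_eq_def)
    thus "(\<Sum>(x, y)\<leftarrow>(u, v) # p # s. \<beta> x y) = (\<Sum>(x, y)\<leftarrow>(u1 \<oplus> c \<odot> u, v1) # t. \<beta> x y)"
      using Cons.prems p xc x(2) by (simp add: bilinear_simps[OF b])
  qed
  thus ?case using t Cons.prems p by (intro exI[of _ "(u1 \<oplus> c \<odot> u, v1) # t"]) auto
qed

lemma ctr_cong:
  assumes "linear_form V \<psi>" "set s \<subseteq> carrier V \<times> carrier V" "set t \<subseteq> carrier V \<times> carrier V" "tensor_eq V s t"
  shows "ctr V \<psi> s = ctr V \<psi> t"
proof (rule forms_eqI)
  fix \<phi> assume f: "linear_form V \<phi>"
  have "bilinear_form V (\<lambda>x y. \<phi> x * \<psi> y)"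
    using f assms by (auto simp: bilinear_form_def linear_form_def algebra_simps)
  with assms(4) have "(\<Sum>(x, y)\<leftarrow>s. \<phi> x * \<psi> y) = (\<Sum>(x, y)\<leftarrow>t. \<phi> x * \<psi> y)"
    by (simp add: tensor_eq_def)
  thus "\<phi> (ctr V \<psi> s) = \<phi> (ctr V \<psi> t)" using f assms by (simp add: form_ctr)
qed (use assms in \<open>auto intro: ctr_closed\<close>)

text \<open>Induction on the number of summands. If the right factor \<open>v\<close> of the first
  summand depends on the other right factors, the summand is absorbed. Otherwise a form that is 1 at
  \<open>v\<close> and 0 at the others contracts the tensor to \<open>u\<close>; so \<open>u\<close>
  lies in \<open>U\<close>, and the summand is split off.\<close>

lemma tensor_left_subspace:
  assumes U: "lin_subspace V U"
  shows "set s \<subseteq> carrier V \<times> carrier V \<Longrightarrow> (\<And>\<psi>. linear_form V \<psi> \<Longrightarrow> ctr V \<psi> s \<in> U) \<Longrightarrow>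
   \<exists>t. set t \<subseteq> U \<times> carrier V \<and> tensor_eq V s t"
proof (induction s rule: length_induct)
  case (1 s)
  show ?case
  proof (cases s)
    case Nil
    thus ?thesis by (intro exI[of _ "[]"]) (auto simp: tensor_eq_def)
  next
    case (Cons p s')
    then obtain u v where s: "s = (u, v) # s'" by (cases p) auto
    have uv: "u \<in> carrier V" "v \<in> carrier V" "set s' \<subseteq> carrier V \<times> carrier V" using 1 s by auto
    let ?L = "lspan V {\<zero>} (map snd s')"
    have L: "lin_subspace V ?L" using uv by (intro lspan_subspace subspace_zero) auto
    show ?thesis
    proof (cases "v \<in> ?L")
      case True
      then obtain t where t: "length t = length s'" "set t \<subseteq> carrier V \<times> carrier V" "tensor_eq V s t"
        using absorb_tensor uv s by blast
      have "ctr V \<psi> t \<in> U" if "linear_form V \<psi>" for \<psi>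
        using ctr_cong[OF that 1(2) t(2,3)] 1(3)[OF that] by simp
      then obtain t' where "set t' \<subseteq> U \<times> carrier V" "tensor_eq V t t'"
        using 1(1)[rule_format, of t] t s by auto
      thus ?thesis using t by (auto simp: tensor_eq_def)
    next
      case False
      then obtain \<psi> where \<psi>: "linear_form V \<psi>" "\<psi> v = 1" "\<And>x. x \<in> ?L \<Longrightarrow> \<psi> x = 0"
        using hyperplane[OF L uv(2) False] by blast
      have "snd ` set s' \<subseteq> ?L"
      proof -
        have "set (map snd s') \<subseteq> carrier V" using uv(3) by auto
        from lspan_mem[OF subspace_zero this] show ?thesis by simp
      qed
      hence "\<forall>x\<in>snd ` set s'. \<psi> x = 0" using \<psi>(3) by blast
      hence "ctr V \<psi> s' = \<zero>" using uv(3) by (induction s') auto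
      hence "ctr V \<psi> s = u" using s \<psi> uv by simp
      hence u: "u \<in> U" using 1(3)[OF \<psi>(1)] by simp
      have "ctr V \<theta> s' \<in> U" if \<theta>: "linear_form V \<theta>" for \<theta>
      proof -
        have "ctr V \<theta> s' \<oplus> \<theta> v \<odot> u \<in> U" using 1(3)[OF \<theta>] s uv by (simp add: M.a_comm ctr_closed)
        thus ?thesis
          using subspace_add_cancel[OF U lin_subspaceD(4)[OF U u] ctr_closed[OF uv(3)]] by blast
      qed
      then obtain t where "set t \<subseteq> U \<times> carrier V" "tensor_eq V s' t"
        using 1(1)[rule_format, of s'] s uv(3) by auto
      thus ?thesis using u uv s by (intro exI[of _ "(u, v) # t"]) (auto simp: tensor_eq_def)
    qed
  qed
qed

text \<open>The case U = 0 of \<open>tensor_left_subspace\<close>, applied to the difference of the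
  two tensors: contractions of the right factor separate tensors.\<close>

lemma tensor_eqI:
  assumes "set s \<subseteq> carrier V \<times> carrier V" "set t \<subseteq> carrier V \<times> carrier V"
    and eq: "\<And>\<psi>. linear_form V \<psi> \<Longrightarrow> ctr V \<psi> s = ctr V \<psi> t"
  shows "tensor_eq V s t"
proof -
  define r where "r = s @ map (\<lambda>(u, v). ((-1) \<odot> u, v)) t"
  have r: "set r \<subseteq> carrier V \<times> carrier V" using assms by (auto simp: r_def)
  have "ctr V \<psi> r = \<zero>" if \<psi>: "linear_form V \<psi>" for \<psi>
  proof (rule forms_eqI)
    fix \<phi> assume \<phi>: "linear_form V \<phi>"
    have "(\<Sum>(u, v)\<leftarrow>map (\<lambda>(u, v). ((-1) \<odot> u, v)) t. \<phi> u * \<psi> v) = - (\<Sum>(u, v)\<leftarrow>t. \<phi> u * \<psi> v)"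
      using assms(2) by (induction t) (auto simp: fsimps \<phi>)
    moreover have "\<phi> (ctr V \<psi> s) = \<phi> (ctr V \<psi> t)" using eq \<psi> by simp
    ultimately show "\<phi> (ctr V \<psi> r) = \<phi> \<zero>"
      using \<phi> r assms by (simp add: form_ctr fsimps) (simp add: r_def)
  qed (use r in \<open>auto intro: ctr_closed\<close>)
  then obtain q where q: "set q \<subseteq> {\<zero>} \<times> carrier V" "tensor_eq V r q"
    using tensor_left_subspace[OF subspace_zero r] by auto
  show ?thesis unfolding tensor_eq_def
  proof (intro allI impI)
    fix \<beta> assume b: "bilinear_form V \<beta>"
    have "(\<Sum>(x, y)\<leftarrow>q. \<beta> x y) = 0" using q(1) by (induction q) (auto simp: bilinear_simps[OF b])
    hence "(\<Sum>(x, y)\<leftarrow>r. \<beta> x y) = 0" using q b by (simp add: tensor_eq_def)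
    moreover have "(\<Sum>(u, v)\<leftarrow>map (\<lambda>(u, v). ((-1) \<odot> u, v)) t. \<beta> u v) = - (\<Sum>(u, v)\<leftarrow>t. \<beta> u v)"
      using assms(2) by (induction t) (auto simp: bilinear_simps[OF b])
    ultimately show "(\<Sum>(x, y)\<leftarrow>s. \<beta> x y) = (\<Sum>(x, y)\<leftarrow>t. \<beta> x y)" by (simp add: r_def)
  qed
qed

end

section \<open>Hopf algebras, the coradical filtration and primitive elements\<close>

text \<open>The product of the algebra dual to the coalgebra \<open>A\<close>; its unit is the
  counit.\<close>

definition conv :: "('k::field, 'a) hopf \<Rightarrow> ('a \<Rightarrow> 'k) \<Rightarrow> ('a \<Rightarrow> 'k) \<Rightarrow> 'a \<Rightarrow> 'k" where
  "conv A \<phi> \<psi> x = (\<Sum>(u, v)\<leftarrow>comult A x. \<phi> u * \<psi> v)"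

text \<open>\<open>ract A \<psi> = (id \<otimes> \<psi>) \<circ> \<Delta>\<close> and \<open>lact A \<phi> = (\<phi> \<otimes> id) \<circ> \<Delta>\<close>; for points these are translations.\<close>

definition ract :: "('k::field, 'a) hopf \<Rightarrow> ('a \<Rightarrow> 'k) \<Rightarrow> 'a \<Rightarrow> 'a" where
  "ract A \<psi> x = ctr A \<psi> (comult A x)"

definition lact :: "('k::field, 'a) hopf \<Rightarrow> ('a \<Rightarrow> 'k) \<Rightarrow> 'a \<Rightarrow> 'a" where
  "lact A \<phi> x = ctr A \<phi> (map prod.swap (comult A x))"

definition aug_form :: "('k::field, 'a) hopf \<Rightarrow> ('a \<Rightarrow> 'k) \<Rightarrow> bool" where
  "aug_form A \<psi> \<longleftrightarrow> linear_form A \<psi> \<and> \<psi> \<one>\<^bsub>A\<^esub> = 0"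

text \<open>The coradical filtration of a conilpotent Hopf algebra, shifted by one.\<close>

fun filt :: "('k::field, 'a) hopf \<Rightarrow> nat \<Rightarrow> 'a set" where
  "filt A 0 = {\<zero>\<^bsub>A\<^esub>}"
| "filt A (Suc n) = {x \<in> carrier A. \<forall>\<psi>. aug_form A \<psi> \<longrightarrow> ract A \<psi> x \<in> filt A n}"

definition conilpotent :: "('k::field, 'a) hopf \<Rightarrow> bool" where
  "conilpotent A \<longleftrightarrow> carrier A \<subseteq> (\<Union>n. filt A n)"

text \<open>The equation \<Delta>(p) = p \<otimes> 1 + 1 \<otimes> p, contracted in the right factor
  by every form; \<open>prim_comult\<close> recovers the identity of tensors.\<close>

definition prim :: "('k::field, 'a) hopf \<Rightarrow> 'a set" where
  "prim A = {p \<in> carrier A. \<forall>\<psi>. linear_form A \<psi> \<longrightarrow>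
     ract A \<psi> p = \<psi> \<one>\<^bsub>A\<^esub> \<odot>\<^bsub>A\<^esub> p \<oplus>\<^bsub>A\<^esub> \<psi> p \<odot>\<^bsub>A\<^esub> \<one>\<^bsub>A\<^esub>}"

lemma sum_list_concat_map:
  "(\<Sum>z\<leftarrow>concat (map f xs). g z) = (\<Sum>x\<leftarrow>xs. \<Sum>z\<leftarrow>f x. g z)"
  by (induction xs) auto

lemma bilinear_prod: "linear_form A \<phi> \<Longrightarrow> linear_form A \<psi> \<Longrightarrow> bilinear_form A (\<lambda>x y. \<phi> x * \<psi> y)"
  by (auto simp: bilinear_form_def linear_form_def algebra_simps)

section \<open>Convolution and the action of linear forms\<close>

context hopf_algebra
begin

sublocale vspace A ..

lemma smult_mult [simp]:
  assumes "x \<in> carrier A" "y \<in> carrier A"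
  shows "(c \<odot> x) \<otimes> y = c \<odot> (x \<otimes> y)" "x \<otimes> (c \<odot> y) = c \<odot> (x \<otimes> y)"
proof -
  have *: "(c \<odot> x) \<otimes> y = c \<odot> (x \<otimes> y)" if "x \<in> carrier A" "y \<in> carrier A" for x y
    using smult_assoc2[of c x y] that by simp
  show "(c \<odot> x) \<otimes> y = c \<odot> (x \<otimes> y)" using * assms by simp
  show "x \<otimes> (c \<odot> y) = c \<odot> (x \<otimes> y)" using *[of y x] assms by (simp add: m_comm)
qed

lemma form_mult:
  assumes "linear_form A \<phi>" "a \<in> carrier A"
  shows "linear_form A (\<lambda>x. \<phi> (x \<otimes> a))" "linear_form A (\<lambda>x. \<phi> (a \<otimes> x))"
  using assms by (auto simp: linear_form_def l_distr r_distr)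

lemma comultD: "x \<in> carrier A \<Longrightarrow> (u, v) \<in> set (comult A x) \<Longrightarrow> u \<in> carrier A \<and> v \<in> carrier A"
  using comult_closed by blast

lemma comult_sum_cong:
  assumes "x \<in> carrier A" "\<And>u v. u \<in> carrier A \<Longrightarrow> v \<in> carrier A \<Longrightarrow> f u v = g u v"
  shows "(\<Sum>(u, v)\<leftarrow>comult A x. f u v) = (\<Sum>(u, v)\<leftarrow>comult A x. g u v)"
  using assms by (intro arg_cong[of _ _ sum_list] map_cong) (auto dest: comultD)

lemma comult_map_closed:
  assumes "x \<in> carrier A" "\<And>u v. u \<in> carrier A \<Longrightarrow> v \<in> carrier A \<Longrightarrow> f u v \<in> S"
  shows "set [f u v. (u, v) \<leftarrow> comult A x] \<subseteq> S"
  using assms by (auto dest: comultD)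

lemma counit_form: "linear_form A (counit A)"
  using counit_hom by (simp add: algebra_hom_def)

lemma counit_simps:
  "counit A \<one> = 1"
  "x \<in> carrier A \<Longrightarrow> y \<in> carrier A \<Longrightarrow> counit A (x \<otimes> y) = counit A x * counit A y"
  using counit_hom by (auto simp: algebra_hom_def ring_hom_def)

lemma comult_bilinear:
  assumes "bilinear_form A \<beta>"
  shows "\<lbrakk>x \<in> carrier A; y \<in> carrier A\<rbrakk> \<Longrightarrow> (\<Sum>(u, v)\<leftarrow>comult A (x \<oplus> y). \<beta> u v) =
     (\<Sum>(u, v)\<leftarrow>comult A x. \<beta> u v) + (\<Sum>(u, v)\<leftarrow>comult A y. \<beta> u v)"
    and "x \<in> carrier A \<Longrightarrow> (\<Sum>(u, v)\<leftarrow>comult A (c \<odot> x). \<beta> u v) = c * (\<Sum>(u, v)\<leftarrow>comult A x. \<beta> u v)"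
    and "\<lbrakk>x \<in> carrier A; y \<in> carrier A\<rbrakk> \<Longrightarrow> (\<Sum>(u, v)\<leftarrow>comult A (x \<otimes> y). \<beta> u v) =
     (\<Sum>(u, v)\<leftarrow>comult A x. \<Sum>(u', v')\<leftarrow>comult A y. \<beta> (u \<otimes> u') (v \<otimes> v'))"
    and "(\<Sum>(u, v)\<leftarrow>comult A \<one>. \<beta> u v) = \<beta> \<one> \<one>"
proof -
  assume "x \<in> carrier A" "y \<in> carrier A"
  thus "(\<Sum>(u, v)\<leftarrow>comult A (x \<oplus> y). \<beta> u v) =
     (\<Sum>(u, v)\<leftarrow>comult A x. \<beta> u v) + (\<Sum>(u, v)\<leftarrow>comult A y. \<beta> u v)"
    using comult_add assms by (simp add: tensor_eq_def)
next
  assume x: "x \<in> carrier A"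
  have *: "(\<Sum>(u, v)\<leftarrow>[(c \<odot> u, v). (u, v) \<leftarrow> s]. \<beta> u v) = c * (\<Sum>(u, v)\<leftarrow>s. \<beta> u v)"
    if "set s \<subseteq> carrier A \<times> carrier A" for s
    using that by (induction s) (auto simp: bilinear_simps[OF assms] algebra_simps)
  show "(\<Sum>(u, v)\<leftarrow>comult A (c \<odot> x). \<beta> u v) = c * (\<Sum>(u, v)\<leftarrow>comult A x. \<beta> u v)"
    using comult_smult[OF x, of c] assms *[OF comult_closed[OF x]] by (simp add: tensor_eq_def)
next
  assume "x \<in> carrier A" "y \<in> carrier A"
  thus "(\<Sum>(u, v)\<leftarrow>comult A (x \<otimes> y). \<beta> u v) =
     (\<Sum>(u, v)\<leftarrow>comult A x. \<Sum>(u', v')\<leftarrow>comult A y. \<beta> (u \<otimes> u') (v \<otimes> v'))"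
    using comult_mult[of x y] assms
    by (simp add: tensor_eq_def sum_list_concat_map case_prod_unfold o_def)
next
  show "(\<Sum>(u, v)\<leftarrow>comult A \<one>. \<beta> u v) = \<beta> \<one> \<one>"
    using comult_one assms by (simp add: tensor_eq_def)
qed

lemma conv_form [intro]:
  "linear_form A \<phi> \<Longrightarrow> linear_form A \<psi> \<Longrightarrow> linear_form A (conv A \<phi> \<psi>)"
  unfolding linear_form_def[of _ "conv A \<phi> \<psi>"]
  by (auto simp: conv_def comult_bilinear[OF bilinear_prod])

lemma conv_one: "linear_form A \<phi> \<Longrightarrow> linear_form A \<psi> \<Longrightarrow> conv A \<phi> \<psi> \<one> = \<phi> \<one> * \<psi> \<one>"
  by (auto simp: conv_def comult_bilinear[OF bilinear_prod])

lemma swap_closed: "x \<in> carrier A \<Longrightarrow> set (map prod.swap (comult A x)) \<subseteq> carrier A \<times> carrier A"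
  by (auto dest: comultD)

lemma ract_closed [simp, intro]: "x \<in> carrier A \<Longrightarrow> ract A \<psi> x \<in> carrier A"
  by (simp add: ract_def ctr_closed comult_closed)

lemma lact_closed [simp, intro]: "x \<in> carrier A \<Longrightarrow> lact A \<psi> x \<in> carrier A"
  unfolding lact_def using swap_closed by (rule ctr_closed)

lemma form_ract: "linear_form A \<phi> \<Longrightarrow> x \<in> carrier A \<Longrightarrow> \<phi> (ract A \<psi> x) = conv A \<phi> \<psi> x"
  by (simp add: ract_def form_ctr comult_closed conv_def)

lemma form_lact: "linear_form A \<psi> \<Longrightarrow> x \<in> carrier A \<Longrightarrow> \<psi> (lact A \<phi> x) = conv A \<phi> \<psi> x"
  unfolding lact_def
  by (subst form_ctr[OF _ swap_closed]) (simp_all add: conv_def o_def case_prod_unfold mult.commute)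

lemma ract_linear:
  assumes "linear_form A \<psi>"
  shows "x \<in> carrier A \<Longrightarrow> y \<in> carrier A \<Longrightarrow> ract A \<psi> (x \<oplus> y) = ract A \<psi> x \<oplus> ract A \<psi> y"
    "x \<in> carrier A \<Longrightarrow> ract A \<psi> (c \<odot> x) = c \<odot> ract A \<psi> x"
    "ract A \<psi> \<zero> = \<zero>"
    "ract A \<psi> \<one> = \<psi> \<one> \<odot> \<one>"
proof -
  fix x y assume xy: "x \<in> carrier A" "y \<in> carrier A"
  show "ract A \<psi> (x \<oplus> y) = ract A \<psi> x \<oplus> ract A \<psi> y"
    using xy assms by (intro forms_eqI) (auto simp: fsimps form_ract fsimps[OF conv_form])
next
  show c: "ract A \<psi> (c \<odot> x) = c \<odot> ract A \<psi> x" if "x \<in> carrier A" for c x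
    using that assms by (intro forms_eqI) (auto simp: fsimps form_ract fsimps[OF conv_form])
  show "ract A \<psi> \<zero> = \<zero>" using c[of \<zero> 0] by simp
  show "ract A \<psi> \<one> = \<psi> \<one> \<odot> \<one>"
    using assms by (intro forms_eqI) (auto simp: fsimps form_ract conv_one)
qed

lemma ract_diff:
  assumes "linear_form A \<psi>" "x \<in> carrier A" "y \<in> carrier A"
  shows "ract A \<psi> (x \<ominus> y) = ract A \<psi> x \<ominus> ract A \<psi> y"
  using assms by (intro forms_eqI) (auto simp: fsimps form_ract fsimps[OF conv_form])

lemma conv_assoc:
  assumes "linear_form A \<phi>" "linear_form A \<psi>" "linear_form A \<theta>" "x \<in> carrier A"
  shows "conv A (conv A \<phi> \<psi>) \<theta> x = conv A \<phi> (conv A \<psi> \<theta>) x"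
proof -
  have t: "trilinear_form A (\<lambda>x y z. \<phi> x * \<psi> y * \<theta> z)"
    using assms by (auto simp: trilinear_form_def linear_form_def algebra_simps)
  show ?thesis
    using coassoc[OF assms(4), unfolded tensor_eq3_def, rule_format, OF t]
    by (simp add: conv_def sum_list_concat_map case_prod_unfold o_def
        mult.assoc flip: sum_list_const_mult sum_list_mult_const)
qed

lemma ract_counit: "x \<in> carrier A \<Longrightarrow> ract A (counit A) x = x"
  using counit_right by (simp add: ract_def ctr_def)

lemma lact_counit: "x \<in> carrier A \<Longrightarrow> lact A (counit A) x = x"
  using counit_left by (simp add: lact_def ctr_def o_def case_prod_unfold)

lemma conv_counit:
  assumes "linear_form A \<phi>" "x \<in> carrier A"
  shows "conv A \<phi> (counit A) x = \<phi> x" "conv A (counit A) \<phi> x = \<phi> x"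
  using form_ract[OF assms, of "counit A"] form_lact[OF assms, of "counit A"] assms
  by (simp_all add: ract_counit lact_counit)

lemma counit_ract: "linear_form A \<psi> \<Longrightarrow> x \<in> carrier A \<Longrightarrow> counit A (ract A \<psi> x) = \<psi> x"
  by (simp add: form_ract counit_form conv_counit)

lemma ract_ract:
  assumes "linear_form A \<phi>" "linear_form A \<psi>" "x \<in> carrier A"
  shows "ract A \<phi> (ract A \<psi> x) = ract A (conv A \<phi> \<psi>) x"
  using assms by (intro forms_eqI) (auto simp: form_ract conv_assoc conv_form)

lemma ract_lact:
  assumes "linear_form A \<phi>" "linear_form A \<psi>" "x \<in> carrier A"
  shows "ract A \<phi> (lact A \<psi> x) = lact A \<psi> (ract A \<phi> x)"
  using assms by (intro forms_eqI) (auto simp: form_ract form_lact conv_assoc conv_form)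

lemma conv_combine:
  "conv A \<phi> (\<lambda>x. \<psi> x - c * \<theta> x) x = conv A \<phi> \<psi> x - c * conv A \<phi> \<theta> x"
  "conv A (\<lambda>x. \<psi> x - c * \<theta> x) \<phi> x = conv A \<psi> \<phi> x - c * conv A \<theta> \<phi> x"
proof -
  have "(\<Sum>(u, v)\<leftarrow>s. \<phi> u * (\<psi> v - c * \<theta> v)) = (\<Sum>(u, v)\<leftarrow>s. \<phi> u * \<psi> v) - c * (\<Sum>(u, v)\<leftarrow>s. \<phi> u * \<theta> v)"
    for s by (induction s) (auto simp: algebra_simps)
  thus "conv A \<phi> (\<lambda>x. \<psi> x - c * \<theta> x) x = conv A \<phi> \<psi> x - c * conv A \<phi> \<theta> x"
    by (simp add: conv_def)
  have "(\<Sum>(u, v)\<leftarrow>s. (\<psi> u - c * \<theta> u) * \<phi> v) = (\<Sum>(u, v)\<leftarrow>s. \<psi> u * \<phi> v) - c * (\<Sum>(u, v)\<leftarrow>s. \<theta> u * \<phi> v)"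
    for s by (induction s) (auto simp: algebra_simps)
  thus "conv A (\<lambda>x. \<psi> x - c * \<theta> x) \<phi> x = conv A \<psi> \<phi> x - c * conv A \<theta> \<phi> x"
    by (simp add: conv_def)
qed

text \<open>Every form is \<psi>(1) times the counit plus a form that kills 1. The counit acts as
  the identity, so statements on the action of all forms reduce to the augmentation forms, which
  measure the failure of invariance.\<close>

lemma aug_part: "linear_form A \<psi> \<Longrightarrow> aug_form A (\<lambda>x. \<psi> x - \<psi> \<one> * counit A x)"
  by (auto simp: aug_form_def counit_simps intro!: linear_form_combine counit_form)

lemma ract_aug_part:
  assumes "linear_form A \<psi>" "x \<in> carrier A"
  shows "ract A \<psi> x = ract A (\<lambda>x. \<psi> x - \<psi> \<one> * counit A x) x \<oplus> \<psi> \<one> \<odot> x"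
  using assms by (intro forms_eqI) (auto simp: fsimps form_ract conv_combine conv_counit)

lemma aug_formD: "aug_form A \<psi> \<Longrightarrow> linear_form A \<psi>" "aug_form A \<psi> \<Longrightarrow> \<psi> \<one> = 0"
  by (auto simp: aug_form_def)

lemma aug_form_combine: "aug_form A \<phi> \<Longrightarrow> aug_form A \<psi> \<Longrightarrow> aug_form A (\<lambda>x. \<phi> x + \<psi> x)"
  "aug_form A \<phi> \<Longrightarrow> aug_form A (\<lambda>x. c * \<phi> x)"
  by (auto simp: aug_form_def linear_form_def algebra_simps)

section \<open>The filtration by iterated contraction with augmentation forms\<close>

lemma filt_subspace: "lin_subspace A (filt A n)"
proof (induction n)
  case 0 show ?case using subspace_zero by simp
next
  case (Suc n)
  thus ?case by (auto simp: lin_subspace_def ract_linear aug_formD)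
qed

lemma filt_Suc: "x \<in> filt A n \<Longrightarrow> x \<in> filt A (Suc n)"
proof (induction n arbitrary: x)
  case 0 thus ?case by (auto simp: ract_linear aug_formD)
qed auto

lemma filt_mono: "m \<le> n \<Longrightarrow> filt A m \<subseteq> filt A n"
  by (induction rule: dec_induct) (use filt_Suc in blast)+

lemma filt_ract:
  assumes "linear_form A \<psi>" "x \<in> filt A n"
  shows "ract A \<psi> x \<in> filt A n"
proof -
  note F = lin_subspaceD[OF filt_subspace]
  have x: "x \<in> carrier A" using assms F(1) by blast
  have "x \<in> filt A (Suc n)" using assms filt_Suc by blast
  thus ?thesis using aug_part[OF assms(1)] F(3,4) assms(2)
    by (subst ract_aug_part[OF assms(1) x]) auto
qed

lemma one_filt: "\<one> \<in> filt A (Suc 0)"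
  by (auto simp: ract_linear aug_formD)

text \<open>By \<open>ract_aug_part\<close> every form \<phi> acts on \<open>x\<close> as
  multiplication by \<phi>(1). Applying the counit gives \<phi>(x) = \<phi>(1)
  \<epsilon>(x).\<close>

lemma invariant_scalar:
  assumes "x \<in> carrier A" "\<And>\<psi>. aug_form A \<psi> \<Longrightarrow> ract A \<psi> x = \<zero>"
  shows "x = counit A x \<odot> \<one>"
proof (rule forms_eqI)
  fix \<phi> assume \<phi>: "linear_form A \<phi>"
  have "ract A \<phi> x = \<phi> \<one> \<odot> x" using ract_aug_part[OF \<phi> assms(1)] assms(2)[OF aug_part[OF \<phi>]] assms(1) by simp
  hence "counit A (ract A \<phi> x) = \<phi> \<one> * counit A x" using assms(1) by (simp add: fsimps[OF counit_form])
  thus "\<phi> x = \<phi> (counit A x \<odot> \<one>)" using \<phi> assms(1) by (simp add: counit_ract fsimps)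
qed (use assms in auto)

text \<open>The filtration is defined by contractions of the right factor. Those of the left factor
  lower it as well, because the two kinds commute and \<open>filt A 1\<close> consists of the
  scalars.\<close>

lemma filt_lact: "x \<in> filt A (Suc n) \<Longrightarrow> aug_form A \<psi> \<Longrightarrow> lact A \<psi> x \<in> filt A n"
proof (induction n arbitrary: x)
  case 0
  hence x: "x \<in> carrier A" "x = counit A x \<odot> \<one>" using invariant_scalar[of x] by auto
  have "lact A \<psi> x = \<zero>"
  proof (rule forms_eqI)
    fix \<phi> assume \<phi>: "linear_form A \<phi>"
    have "\<phi> (lact A \<psi> x) = conv A \<psi> \<phi> (counit A x \<odot> \<one>)"
      using \<phi> x by (metis form_lact)
    also have "\<dots> = 0" using \<phi> 0(2) conv_form[of \<psi> \<phi>] by (simp add: fsimps conv_one aug_formD)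
    finally show "\<phi> (lact A \<psi> x) = \<phi> \<zero>" using \<phi> by (simp add: fsimps)
  qed (use x in auto)
  thus ?case by simp
next
  case (Suc n)
  have x: "x \<in> carrier A" using Suc.prems by simp
  have "ract A \<phi> (lact A \<psi> x) \<in> filt A n" if \<phi>: "aug_form A \<phi>" for \<phi>
  proof -
    have "ract A \<phi> x \<in> filt A (Suc n)" using Suc.prems(1) \<phi> by (subst (asm) filt.simps) auto
    thus ?thesis using Suc.IH Suc.prems(2) x \<phi> by (subst ract_lact) (auto simp: aug_formD)
  qed
  thus ?case using x by auto
qed

section \<open>Primitive elements and the ideals they generate\<close>

lemma prim_subspace: "lin_subspace A (prim A)"
  unfolding lin_subspace_def
proof (intro conjI ballI allI)
  show "prim A \<subseteq> carrier A" by (auto simp: prim_def)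
  show "\<zero> \<in> prim A" by (auto simp: prim_def ract_linear fsimps)
next
  fix x y assume "x \<in> prim A" "y \<in> prim A"
  thus "x \<oplus> y \<in> prim A"
    by (auto simp: prim_def ract_linear fsimps smult_simps M.a_ac)
next
  fix c x assume "x \<in> prim A"
  thus "c \<odot> x \<in> prim A"
    by (auto simp: prim_def ract_linear fsimps smult_simps mult.commute)
qed

lemma prim_counit: "p \<in> prim A \<Longrightarrow> counit A p = 0"
proof -
  assume p: "p \<in> prim A"
  hence pc: "p \<in> carrier A" by (auto simp: prim_def)
  have "p = p \<oplus> counit A p \<odot> \<one>"
    using p counit_form pc ract_counit[OF pc] by (auto simp: prim_def counit_simps)
  hence "counit A p = counit A (p \<oplus> counit A p \<odot> \<one>)" by simp
  hence "counit A p = counit A p + counit A p" using pc by (simp only: fsimps[OF counit_form]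
    counit_simps one_closed smult_closed' mult_1_right)
  thus ?thesis by (metis add_cancel_right_right)
qed

lemma prim_comult:
  assumes "p \<in> prim A"
  shows "tensor_eq A (comult A p) [(p, \<one>), (\<one>, p)]"
proof (rule tensor_eqI)
  have "p \<in> carrier A" using assms by (auto simp: prim_def)
  thus "set (comult A p) \<subseteq> carrier A \<times> carrier A" "set [(p, \<one>), (\<one>, p)] \<subseteq> carrier A \<times> carrier A"
    by (auto dest: comultD)
  fix \<psi> assume "linear_form A \<psi>"
  thus "ctr A \<psi> (comult A p) = ctr A \<psi> [(p, \<one>), (\<one>, p)]"
    using assms by (auto simp: prim_def ract_def)
qed

text \<open>Replacing \<phi> and \<psi> by their augmentation parts turns the hypothesis into a
  formula for \<open>conv A \<phi> \<psi> x\<close>: the mixed counit terms are the two summands of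
  a primitive comultiplication, and the remaining one vanishes with
  \<open>counit A x\<close>.\<close>

lemma primI:
  assumes x: "x \<in> carrier A" "counit A x = 0"
    and c: "\<And>\<phi> \<psi>. aug_form A \<phi> \<Longrightarrow> aug_form A \<psi> \<Longrightarrow> conv A \<phi> \<psi> x = 0"
  shows "x \<in> prim A"
  unfolding prim_def
proof (intro CollectI conjI allI impI)
  fix \<psi> assume \<psi>: "linear_form A \<psi>"
  show "ract A \<psi> x = \<psi> \<one> \<odot> x \<oplus> \<psi> x \<odot> \<one>"
  proof (rule forms_eqI)
    fix \<phi> assume \<phi>: "linear_form A \<phi>"
    note eps = counit_form
    have "0 = conv A (\<lambda>x. \<phi> x - \<phi> \<one> * counit A x) (\<lambda>x. \<psi> x - \<psi> \<one> * counit A x) x"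
      using c[OF aug_part[OF \<phi>] aug_part[OF \<psi>]] by simp
    also have "\<dots> = conv A \<phi> \<psi> x - \<psi> \<one> * \<phi> x - \<phi> \<one> * \<psi> x"
      using x \<phi> \<psi> by (simp add: conv_combine conv_counit eps)
    finally show "\<phi> (ract A \<psi> x) = \<phi> (\<psi> \<one> \<odot> x \<oplus> \<psi> x \<odot> \<one>)"
      using x \<phi> \<psi> by (simp add: form_ract fsimps algebra_simps)
  qed (use x in auto)
qed (use x in auto)

text \<open>Uniqueness of convolution inverses, applied to the identity and the antipode.\<close>

lemma conv_id_cancel:
  assumes T: "linear_map A A T"
    and z: "\<And>a. a \<in> carrier A \<Longrightarrow> list_sum A [T u \<otimes> v. (u, v) \<leftarrow> comult A a] = \<zero>"
    and a: "a \<in> carrier A"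
  shows "T a = \<zero>"
proof (rule forms_eqI)
  fix \<phi> assume \<phi>: "linear_form A \<phi>"
  note Tl = linear_mapD[OF T] and Sl = linear_mapD[OF antipode_linear]
  \<comment> \<open>This form evaluates the convolution of \<open>T\<close>, the identity and the
    antipode. Bracketed one way it gives \<open>T\<close>, since the identity and the antipode
    convolve to the counit; bracketed the other way it is zero by \<open>z\<close>.\<close>
  have tri: "trilinear_form A (\<lambda>x y z. \<phi> (T x \<otimes> y \<otimes> antipode A z))"
    using \<phi> by (auto simp: trilinear_form_def linear_form_def Tl Sl l_distr r_distr)
  have phiT: "linear_form A (\<lambda>x. \<phi> (T x))" using linear_form_comp[OF T \<phi>] by (simp add: o_def)
  have inner: "\<phi> (T u) * counit A v = (\<Sum>(v', v'')\<leftarrow>comult A v. \<phi> (T u \<otimes> v' \<otimes> antipode A v''))"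
    if "u \<in> carrier A" "v \<in> carrier A" for u v
  proof -
    have f: "linear_form A (\<lambda>x. \<phi> (T u \<otimes> x))" using form_mult \<phi> Tl that by auto
    have s: "set [x \<otimes> antipode A y. (x, y) \<leftarrow> comult A v] \<subseteq> carrier A"
      using that by (intro comult_map_closed) (auto simp: Sl)
    have "\<phi> (T u) * counit A v = \<phi> (T u \<otimes> (counit A v \<odot> \<one>))"
      using that Tl(1) \<phi> by (simp add: fsimps)
    also have "\<dots> = \<phi> (T u \<otimes> list_sum A [x \<otimes> antipode A y. (x, y) \<leftarrow> comult A v])"
      using antipode_right that by simp
    also have "\<dots> = (\<Sum>(x, y)\<leftarrow>comult A v. \<phi> (T u \<otimes> (x \<otimes> antipode A y)))"
      by (subst form_list_sum[OF f s]) (simp add: o_def case_prod_unfold)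
    also have "\<dots> = (\<Sum>(x, y)\<leftarrow>comult A v. \<phi> (T u \<otimes> x \<otimes> antipode A y))"
      using that by (intro comult_sum_cong) (auto simp: m_assoc Tl Sl)
    finally show ?thesis .
  qed
  have inner2: "(\<Sum>(u', u'')\<leftarrow>comult A u. \<phi> (T u' \<otimes> u'' \<otimes> antipode A v)) = 0"
    if "u \<in> carrier A" "v \<in> carrier A" for u v
  proof -
    have f: "linear_form A (\<lambda>x. \<phi> (x \<otimes> antipode A v))" using form_mult \<phi> Sl that by auto
    have s: "set [T x \<otimes> y. (x, y) \<leftarrow> comult A u] \<subseteq> carrier A"
      using that by (intro comult_map_closed) (auto simp: Tl)
    have "(\<Sum>(u', u'')\<leftarrow>comult A u. \<phi> (T u' \<otimes> u'' \<otimes> antipode A v)) =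
        \<phi> (list_sum A [T x \<otimes> y. (x, y) \<leftarrow> comult A u] \<otimes> antipode A v)"
      by (subst form_list_sum[OF f s]) (simp add: o_def case_prod_unfold)
    also have "\<dots> = \<phi> \<zero>" using z[OF that(1)] Sl(1)[OF that(2)] by simp
    finally show ?thesis using \<phi> by (simp add: fsimps)
  qed
  have "\<phi> (T a) = conv A (\<lambda>x. \<phi> (T x)) (counit A) a" using conv_counit[OF phiT a] by simp
  also have "\<dots> = (\<Sum>(u, v)\<leftarrow>comult A a. \<Sum>(v', v'')\<leftarrow>comult A v. \<phi> (T u \<otimes> v' \<otimes> antipode A v''))"
    unfolding conv_def using inner a
    by (intro comult_sum_cong) auto
  also have "\<dots> = (\<Sum>(u, v)\<leftarrow>comult A a. \<Sum>(u', u'')\<leftarrow>comult A u. \<phi> (T u' \<otimes> u'' \<otimes> antipode A v))"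
    using coassoc[OF a, unfolded tensor_eq3_def, rule_format, OF tri]
    by (simp add: sum_list_concat_map case_prod_unfold o_def)
  also have "\<dots> = (\<Sum>(u, v)\<leftarrow>comult A a. 0)"
    using inner2 a by (intro comult_sum_cong) auto
  also have "\<dots> = \<phi> \<zero>" using \<phi> by (simp add: fsimps case_prod_unfold)
  finally show "\<phi> (T a) = \<phi> \<zero>" .
qed (use linear_mapD(1)[OF T] a in auto)

lemma comult_mult_prim:
  assumes p: "p \<in> prim A" and a: "a \<in> carrier A" and b: "bilinear_form A \<beta>"
  shows "(\<Sum>(u, v)\<leftarrow>comult A (a \<otimes> p). \<beta> u v) =
    (\<Sum>(u, v)\<leftarrow>comult A a. \<beta> (u \<otimes> p) v + \<beta> u (v \<otimes> p))"
proof -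
  have pc: "p \<in> carrier A" using p by (auto simp: prim_def)
  have "(\<Sum>(u', v')\<leftarrow>comult A p. \<beta> (u \<otimes> u') (v \<otimes> v')) = \<beta> (u \<otimes> p) v + \<beta> u (v \<otimes> p)"
    if "u \<in> carrier A" "v \<in> carrier A" for u v
  proof -
    have "bilinear_form A (\<lambda>x y. \<beta> (u \<otimes> x) (v \<otimes> y))"
      using b that by (auto simp: bilinear_form_def linear_form_def r_distr)
    with prim_comult[OF p] show ?thesis using that pc by (simp add: tensor_eq_def)
  qed
  thus ?thesis using a pc b
    by (simp add: comult_bilinear) (intro comult_sum_cong; auto)
qed

text \<open>Antimultiplicativity of the antipode S is not among the axioms, so the case needed for
  ideals is derived. The map sending \<open>a\<close> to S(a p) + S(a) p, convolved with the
  identity, gives the left side of the antipode axiom at a p, hence \<epsilon>(a p) = 0. So the map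
  vanishes by \<open>conv_id_cancel\<close>.\<close>

lemma antipode_mult_prim:
  assumes p: "p \<in> prim A" and a: "a \<in> carrier A"
  shows "antipode A (a \<otimes> p) = \<ominus> (antipode A a \<otimes> p)"
proof -
  let ?T = "\<lambda>a. antipode A (a \<otimes> p) \<oplus> antipode A a \<otimes> p"
  note Sl = linear_mapD[OF antipode_linear]
  have pc: "p \<in> carrier A" using p by (auto simp: prim_def)
  have T: "linear_map A A ?T"
    using pc by (auto simp: linear_map_def Sl l_distr smult_simps M.a_ac)
  have "list_sum A [?T u \<otimes> v. (u, v) \<leftarrow> comult A a] = \<zero>" if a: "a \<in> carrier A" for a
  proof (rule forms_eqI)
    show "list_sum A [?T u \<otimes> v. (u, v) \<leftarrow> comult A a] \<in> carrier A"
      using a pc by (intro list_sum_closed comult_map_closed) (auto simp: Sl)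
    fix \<phi> assume \<phi>: "linear_form A \<phi>"
    let ?\<beta> = "\<lambda>x y. \<phi> (antipode A x \<otimes> y)"
    have b: "bilinear_form A ?\<beta>"
      using \<phi> by (auto simp: bilinear_form_def linear_form_def Sl l_distr r_distr)
    have apc: "a \<otimes> p \<in> carrier A" using a pc by simp
    have "\<phi> (list_sum A [?T u \<otimes> v. (u, v) \<leftarrow> comult A a]) = (\<Sum>(u, v)\<leftarrow>comult A a. \<phi> (?T u \<otimes> v))"
      by (subst form_list_sum[OF \<phi> comult_map_closed[OF a]]) (use pc in \<open>auto simp: o_def case_prod_unfold Sl\<close>)
    also have "\<dots> = (\<Sum>(u, v)\<leftarrow>comult A a. ?\<beta> (u \<otimes> p) v + ?\<beta> u (v \<otimes> p))"
      using a pc \<phi> by (intro comult_sum_cong) (auto simp: l_distr fsimps Sl m_assoc m_comm[of p])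
    also have "\<dots> = (\<Sum>(u, v)\<leftarrow>comult A (a \<otimes> p). ?\<beta> u v)"
      using comult_mult_prim[OF p a b] by simp
    also have "\<dots> = \<phi> (list_sum A [antipode A u \<otimes> v. (u, v) \<leftarrow> comult A (a \<otimes> p)])"
      by (subst form_list_sum[OF \<phi> comult_map_closed[OF apc]]) (auto simp: o_def case_prod_unfold Sl)
    also have "\<dots> = \<phi> \<zero>"
      using antipode_left[OF apc] a pc prim_counit[OF p] by (simp add: counit_simps)
    finally show "\<phi> (list_sum A [?T u \<otimes> v. (u, v) \<leftarrow> comult A a]) = \<phi> \<zero>" .
  qed auto
  from conv_id_cancel[OF T this a] have "?T a = \<zero>" .
  thus ?thesis using a pc Sl(1) by (metis M.minus_equality m_closed)
qed

text \<open>The comultiplication of a p is \<Delta>(a) (p \<otimes> 1 + 1 \<otimes> p), and each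
  half of this product has a factor in the ideal.\<close>

lemma prim_hopf_ideal:
  assumes p: "p \<in> prim A"
  shows "hopf_ideal A (PIdl p)"
proof -
  have pc: "p \<in> carrier A" using p by (auto simp: prim_def)
  note Sl = linear_mapD[OF antipode_linear]
  have "\<exists>s. set s \<subseteq> (PIdl p) \<times> carrier A \<union> carrier A \<times> (PIdl p) \<and> tensor_eq A (comult A (a \<otimes> p)) s"
    if a: "a \<in> carrier A" for a
  proof (intro exI[of _ "[(u \<otimes> p, v). (u, v) \<leftarrow> comult A a] @ [(u, v \<otimes> p). (u, v) \<leftarrow> comult A a]"] conjI)
    show "tensor_eq A (comult A (a \<otimes> p))
       ([(u \<otimes> p, v). (u, v) \<leftarrow> comult A a] @ [(u, v \<otimes> p). (u, v) \<leftarrow> comult A a])"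
      unfolding tensor_eq_def using comult_mult_prim[OF p a]
      by (simp add: case_prod_unfold o_def sum_list_addf)
    have "set [(u \<otimes> p, v). (u, v) \<leftarrow> comult A a] \<subseteq> (PIdl p) \<times> carrier A"
      by (intro comult_map_closed a) (auto simp: cgenideal_def)
    moreover have "set [(u, v \<otimes> p). (u, v) \<leftarrow> comult A a] \<subseteq> carrier A \<times> (PIdl p)"
      by (intro comult_map_closed a) (auto simp: cgenideal_def)
    ultimately show "set ([(u \<otimes> p, v). (u, v) \<leftarrow> comult A a] @ [(u, v \<otimes> p). (u, v) \<leftarrow> comult A a]) \<subseteq>
        (PIdl p) \<times> carrier A \<union> carrier A \<times> (PIdl p)" by auto
  qed
  moreover have "antipode A (a \<otimes> p) \<in> PIdl p" if a: "a \<in> carrier A" for a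
  proof -
    have "antipode A (a \<otimes> p) = (\<ominus> antipode A a) \<otimes> p"
      using antipode_mult_prim[OF p a] a pc Sl(1)[OF a] by (simp add: l_minus)
    thus ?thesis using Sl(1)[OF a] unfolding cgenideal_def by blast
  qed
  moreover have "counit A (a \<otimes> p) = 0" if "a \<in> carrier A" for a
    using that pc prim_counit[OF p] by (simp add: counit_simps)
  moreover have "ideal (PIdl p) A" using pc by (rule cgenideal_ideal)
  ultimately show ?thesis
    by (auto simp: hopf_ideal_def cgenideal_def)
qed

section \<open>Generating systems and primitive elements\<close>

lemma points_simps:
  assumes "g \<in> points A"
  shows "linear_form A g" "g \<one> = 1" "x \<in> carrier A \<Longrightarrow> y \<in> carrier A \<Longrightarrow> g (x \<otimes> y) = g x * g y"
  using assms by (auto simp: points_def algebra_hom_def ring_hom_def)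

text \<open>Points that kill \<open>p\<close> lie in the closed subgroup cut out by the ideal of
  \<open>p\<close>, which is proper unless \<open>p\<close> is zero.\<close>

lemma generating_prim:
  assumes g: "generating_system A n g" and p: "p \<in> prim A" "\<And>i. i \<in> {1..n} \<Longrightarrow> g i p = 0"
  shows "p = \<zero>"
proof (rule ccontr)
  assume "p \<noteq> \<zero>"
  have pc: "p \<in> carrier A" using p by (auto simp: prim_def)
  have "p \<in> PIdl p" using pc by (rule cgenideal_self)
  hence "PIdl p \<noteq> {\<zero>}" using \<open>p \<noteq> \<zero>\<close> by auto
  moreover have "g i \<in> subgroup_points A (PIdl p)" if i: "i \<in> {1..n}" for i
  proof -
    have "g i \<in> points A" using g i by (auto simp: generating_system_def)
    thus ?thesis using points_simps(3)[of "g i"] p(2)[OF i] pc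
      by (auto simp: subgroup_points_def cgenideal_def)
  qed
  ultimately show False using prim_hopf_ideal[OF p(1)] g by (auto simp: generating_system_def)
qed

lemma ideal_subspace:
  assumes "ideal J A" shows "lin_subspace A J"
proof -
  interpret J: ideal J A by fact
  have "c \<odot> x \<in> J" if "x \<in> J" for c x
  proof -
    have x: "x \<in> carrier A" using that J.a_subset by auto
    have "c \<odot> x = (c \<odot> \<one>) \<otimes> x" using x by simp
    thus ?thesis using J.I_l_closed[OF that, of "c \<odot> \<one>"] by simp
  qed
  thus ?thesis using J.a_subset J.zero_closed J.a_closed by (auto simp: lin_subspace_def)
qed

text \<open>Take a nonzero \<open>x\<close> in \<open>J\<close> of least filtration degree. The
  lower steps meet \<open>J\<close> trivially, so forms can be altered to vanish on \<open>J\<close>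
  without changing them on those steps. The altered forms annihilate \<Delta>(x), and
  \<open>primI\<close> applies.\<close>

lemma hopf_ideal_prim:
  assumes con: "conilpotent A" and J: "hopf_ideal A J" "J \<noteq> {\<zero>}"
  shows "\<exists>p\<in>J \<inter> prim A. p \<noteq> \<zero>"
proof -
  have Js: "lin_subspace A J" using J ideal_subspace by (auto simp: hopf_ideal_def)
  note Jc = lin_subspaceD[OF Js] and Fc = lin_subspaceD[OF filt_subspace]
  define P where "P n \<longleftrightarrow> (\<exists>x\<in>J \<inter> filt A n. x \<noteq> \<zero>)" for n
  obtain y where y: "y \<in> J" "y \<noteq> \<zero>" using J(2) Jc(2) by auto
  hence "\<exists>n. P n" using con Jc(1) by (fastforce simp: conilpotent_def P_def)
  define n where "n = (LEAST n. P n)"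
  have "P n" unfolding n_def using \<open>\<exists>n. P n\<close> by (rule LeastI_ex)
  then obtain x where x: "x \<in> J" "x \<in> filt A n" "x \<noteq> \<zero>" by (auto simp: P_def)
  have xc: "x \<in> carrier A" using x Jc by auto
  have eps: "counit A x = 0" using x J by (auto simp: hopf_ideal_def)
  \<comment> \<open>The degree is at least 2: \<open>filt A 1\<close> consists of scalars, and a
    scalar in \<open>J\<close> is zero because the counit kills \<open>J\<close>.\<close>
  have "n \<noteq> 0" using x by (cases n) auto
  moreover have "n \<noteq> Suc 0"
  proof
    assume "n = Suc 0"
    hence "x = counit A x \<odot> \<one>" using x by (intro invariant_scalar) auto
    thus False using eps x(3) by simp
  qed
  ultimately obtain m where m: "n = Suc (Suc m)" by (metis not0_implies_Suc)
  have "\<not> P (Suc m)" using not_less_Least[of "Suc m" P] m by (simp add: n_def)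
  hence disj: "filt A (Suc m) \<inter> J \<subseteq> {\<zero>}" by (auto simp: P_def)
  have ext: "\<exists>\<phi>'. linear_form A \<phi>' \<and> (\<forall>x\<in>filt A (Suc m). \<phi>' x = \<phi> x) \<and> (\<forall>x\<in>J. \<phi>' x = 0)"
    if "linear_form A \<phi>" for \<phi>
    by (rule form_extend[OF filt_subspace Js disj])
      (use that Fc(1) in \<open>auto simp: fsimps simp del: filt.simps\<close>)
  have "conv A \<phi> \<psi> x = 0" if \<phi>: "aug_form A \<phi>" and \<psi>: "aug_form A \<psi>" for \<phi> \<psi>
  proof -
    obtain \<phi>' where \<phi>': "linear_form A \<phi>'" "\<And>x. x \<in> filt A (Suc m) \<Longrightarrow> \<phi>' x = \<phi> x" "\<And>x. x \<in> J \<Longrightarrow> \<phi>' x = 0"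
      using ext[OF aug_formD(1)[OF \<phi>]] by auto
    obtain \<psi>' where \<psi>': "linear_form A \<psi>'" "\<And>x. x \<in> filt A (Suc m) \<Longrightarrow> \<psi>' x = \<psi> x" "\<And>x. x \<in> J \<Longrightarrow> \<psi>' x = 0"
      using ext[OF aug_formD(1)[OF \<psi>]] by auto
    have one: "\<one> \<in> filt A (Suc m)" using one_filt filt_mono[of "Suc 0" "Suc m"] by blast
    have a': "aug_form A \<phi>'" using \<phi>' \<phi> one by (simp add: aug_form_def)
    have r: "ract A \<psi> x \<in> filt A (Suc m)" using x(2) \<psi> unfolding m by (subst (asm) filt.simps) auto
    have l: "lact A \<phi>' x \<in> filt A (Suc m)" using filt_lact[of x "Suc m"] x(2) m a' by simp
    \<comment> \<open>The forms are exchanged one after the other. The right contraction lies in the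
      lower step, where \<phi> and \<phi>' agree; then so does the left contraction by \<phi>',
      which kills 1 because 1 lies in that step too.\<close>
    have "conv A \<phi> \<psi> x = \<phi> (ract A \<psi> x)" using \<phi> xc by (simp add: form_ract aug_formD)
    also have "\<dots> = \<phi>' (ract A \<psi> x)" using \<phi>'(2) r by simp
    also have "\<dots> = \<psi> (lact A \<phi>' x)" using xc \<phi>' \<psi> by (simp add: form_ract form_lact aug_formD)
    also have "\<dots> = \<psi>' (lact A \<phi>' x)" using \<psi>'(2) l by simp
    also have "\<dots> = conv A \<phi>' \<psi>' x" using xc \<psi>' by (simp add: form_lact)
    also have "\<dots> = 0"
    proof -
      obtain s where s: "set s \<subseteq> J \<times> carrier A \<union> carrier A \<times> J" "tensor_eq A (comult A x) s"
        using J(1) x(1) unfolding hopf_ideal_def by blast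
      have "conv A \<phi>' \<psi>' x = (\<Sum>(u, v)\<leftarrow>s. \<phi>' u * \<psi>' v)"
        using s(2) bilinear_prod[OF \<phi>'(1) \<psi>'(1)] by (simp add: tensor_eq_def conv_def)
      also have "\<dots> = 0" using s(1) \<phi>'(3) \<psi>'(3) by (induction s) auto
      finally show ?thesis .
    qed
    finally show ?thesis .
  qed
  hence "x \<in> prim A" using primI[OF xc eps] by blast
  thus ?thesis using x by auto
qed

lemma generating_systemI:
  assumes con: "conilpotent A" and g: "g ` {1..n} \<subseteq> points A"
    and inj: "\<And>p. p \<in> prim A \<Longrightarrow> (\<And>i. i \<in> {1..n} \<Longrightarrow> g i p = 0) \<Longrightarrow> p = \<zero>"
  shows "generating_system A n g"
  unfolding generating_system_def
proof (intro conjI notI g)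
  assume "\<exists>J. hopf_ideal A J \<and> J \<noteq> {\<zero>} \<and> g ` {1..n} \<subseteq> subgroup_points A J"
  then obtain J where J: "hopf_ideal A J" "J \<noteq> {\<zero>}" "g ` {1..n} \<subseteq> subgroup_points A J" by auto
  then obtain p where "p \<in> J" "p \<in> prim A" "p \<noteq> \<zero>" using hopf_ideal_prim[OF con J(1,2)] by auto
  moreover have "g i p = 0" if "i \<in> {1..n}" for i
  proof -
    have "g i \<in> subgroup_points A J" using J(3) that by blast
    thus ?thesis using \<open>p \<in> J\<close> by (auto simp: subgroup_points_def)
  qed
  ultimately show False using inj[of p] by blast
qed

end

section \<open>Prounipotent groups are conilpotent\<close>

lemma algebra_homD:
  assumes "algebra_hom A B f"
  shows "linear_map A B f" "f \<one>\<^bsub>A\<^esub> = \<one>\<^bsub>B\<^esub>"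
    "x \<in> carrier A \<Longrightarrow> y \<in> carrier A \<Longrightarrow> f (x \<otimes>\<^bsub>A\<^esub> y) = f x \<otimes>\<^bsub>B\<^esub> f y"
  using assms by (auto simp: algebra_hom_def ring_hom_def)

lemma hopf_homD:
  assumes "hopf_hom A B f"
  shows "algebra_hom A B f" "linear_map A B f"
    "x \<in> carrier A \<Longrightarrow> tensor_eq B (comult B (f x)) [(f u, f v). (u, v) \<leftarrow> comult A x]"
  using assms by (auto simp: hopf_hom_def algebra_hom_def)

lemma hopf_hom_ract:
  assumes "hopf_algebra A" "hopf_algebra B" "hopf_hom A B f" "linear_form B \<psi>" "x \<in> carrier A"
  shows "ract B \<psi> (f x) = f (ract A (\<psi> \<circ> f) x)"
proof -
  interpret A: hopf_algebra A by fact
  interpret B: hopf_algebra B by fact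
  note f = linear_mapD[OF hopf_homD(2)[OF assms(3)]]
  note comp = linear_form_comp[OF hopf_homD(2)[OF assms(3)]]
  show ?thesis
  proof (rule B.forms_eqI)
    fix \<phi> assume \<phi>: "linear_form B \<phi>"
    have "\<phi> (ract B \<psi> (f x)) = conv B \<phi> \<psi> (f x)" using \<phi> f assms by (simp add: B.form_ract)
    also have "\<dots> = conv A (\<phi> \<circ> f) (\<psi> \<circ> f) x"
      using hopf_homD(3)[OF assms(3,5), unfolded tensor_eq_def, rule_format, OF bilinear_prod[OF \<phi> assms(4)]]
      by (simp add: conv_def o_def case_prod_unfold)
    also have "\<dots> = \<phi> (f (ract A (\<psi> \<circ> f) x))"
      using A.form_ract[OF comp[OF \<phi>] assms(5)] by simp
    finally show "\<phi> (ract B \<psi> (f x)) = \<phi> (f (ract A (\<psi> \<circ> f) x))" .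
  qed (use f assms in auto)
qed

lemma hopf_hom_filt:
  assumes "hopf_algebra A" "hopf_algebra B" "hopf_hom A B f"
  shows "x \<in> filt A n \<Longrightarrow> f x \<in> filt B n"
proof (induction n arbitrary: x)
  case 0
  interpret A: hopf_algebra A by fact
  interpret B: hopf_algebra B by fact
  note f = linear_mapD[OF hopf_homD(2)[OF assms(3)]]
  have "f (0 \<odot>\<^bsub>A\<^esub> \<zero>\<^bsub>A\<^esub>) = 0 \<odot>\<^bsub>B\<^esub> f \<zero>\<^bsub>A\<^esub>" by (rule f) simp
  hence "f \<zero>\<^bsub>A\<^esub> = \<zero>\<^bsub>B\<^esub>" using f(1)[of "\<zero>\<^bsub>A\<^esub>"] by simp
  thus ?case using 0 by simp
next
  case (Suc n)
  have x: "x \<in> carrier A" using Suc.prems by simp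
  have "ract B \<psi> (f x) \<in> filt B n" if "aug_form B \<psi>" for \<psi>
  proof -
    have \<psi>: "linear_form B \<psi>" using that by (simp add: aug_form_def)
    have "aug_form A (\<psi> \<circ> f)"
      using that linear_form_comp[OF hopf_homD(2)[OF assms(3)] \<psi>] algebra_homD(2)[OF hopf_homD(1)[OF assms(3)]]
      by (simp add: aug_form_def)
    hence "ract A (\<psi> \<circ> f) x \<in> filt A n" using Suc.prems by simp
    thus ?thesis using Suc.IH hopf_hom_ract[OF assms \<psi> x] by simp
  qed
  thus ?case using linear_mapD(1)[OF hopf_homD(2)[OF assms(3)] x] by simp
qed

lemma conilpotent_cover:
  assumes "hopf_algebra A"
    and "\<And>i. i \<in> I \<Longrightarrow> hopf_algebra (B i) \<and> hopf_hom (B i) A (u i) \<and> conilpotent (B i)"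
    and "carrier A = (\<Union>i\<in>I. u i ` carrier (B i))"
  shows "conilpotent A"
  unfolding conilpotent_def
proof
  fix x assume "x \<in> carrier A"
  then obtain i y where i: "i \<in> I" "y \<in> carrier (B i)" "x = u i y" using assms(3) by auto
  then obtain n where "y \<in> filt (B i) n" using assms(2)[OF i(1)] by (auto simp: conilpotent_def)
  hence "u i y \<in> filt A n" using hopf_hom_filt[OF _ assms(1), of "B i" "u i"] assms(2)[OF i(1)] by simp
  thus "x \<in> (\<Union>n. filt A n)" using i(3) by blast
qed

text \<open>A right subcomodule: the condition amounts to \<Delta>(F) lying in F \<otimes>
  A.\<close>

definition stable_subspace :: "('k::field, 'a) hopf \<Rightarrow> 'a set \<Rightarrow> bool" where
  "stable_subspace A F \<longleftrightarrow> lin_subspace A F \<and> (\<forall>\<psi>. \<forall>x\<in>F. linear_form A \<psi> \<longrightarrow> ract A \<psi> x \<in> F)"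

section \<open>Conilpotence from fixed vectors\<close>

context hopf_algebra
begin

lemma ract_add:
  assumes "linear_form A \<phi>" "linear_form A \<psi>" "x \<in> carrier A"
  shows "ract A (\<lambda>x. \<phi> x + \<psi> x) x = ract A \<phi> x \<oplus> ract A \<psi> x"
    "ract A (\<lambda>x. c * \<phi> x) x = c \<odot> ract A \<phi> x" "ract A (\<lambda>x. 0) x = \<zero>"
proof -
  have *: "conv A \<theta> (\<lambda>x. \<phi> x + \<psi> x) x = conv A \<theta> \<phi> x + conv A \<theta> \<psi> x"
     "conv A \<theta> (\<lambda>x. c * \<phi> x) x = c * conv A \<theta> \<phi> x" for \<theta>
    by (simp_all add: conv_def case_prod_unfold ring_distribs sum_list_addf mult_ac
        flip: sum_list_const_mult)
  show "ract A (\<lambda>x. \<phi> x + \<psi> x) x = ract A \<phi> x \<oplus> ract A \<psi> x"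
    using assms * by (intro forms_eqI) (auto simp: form_ract fsimps)
  show "ract A (\<lambda>x. c * \<phi> x) x = c \<odot> ract A \<phi> x"
    using assms * by (intro forms_eqI) (auto simp: form_ract fsimps)
  show "ract A (\<lambda>x. 0) x = \<zero>"
    using assms by (intro forms_eqI) (auto simp: form_ract fsimps conv_def case_prod_unfold)
qed

lemma ctr_lspan: "set s \<subseteq> carrier A \<times> carrier A \<Longrightarrow> ctr A \<psi> s \<in> lspan A {\<zero>} (map fst s)"
proof (induction s)
  case (Cons p s)
  obtain u v where p: "p = (u, v)" by force
  have "ctr A \<psi> s \<in> lspan A {\<zero>} (map fst s)" "ctr A \<psi> s \<in> carrier A" "u \<in> carrier A"
    using Cons p by (auto simp: ctr_closed)
  thus ?case using p by (auto simp: M.a_comm)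
qed simp

lemma ract_lspan: "x \<in> carrier A \<Longrightarrow> ract A \<psi> x \<in> lspan A {\<zero>} (map fst (comult A x))"
  unfolding ract_def by (rule ctr_lspan[OF comult_closed])

lemma comult_fst_closed: "x \<in> carrier A \<Longrightarrow> set (map fst (comult A x)) \<subseteq> carrier A"
  using comult_closed by (auto dest: comultD)

text \<open>The subspace of all contractions of a single comultiplication is finite-dimensional, so it
  is contained in a single step of the filtration as soon as it is contained in the union.\<close>

lemma conilpotentI:
  assumes fix_ex: "\<And>F. stable_subspace A F \<Longrightarrow> F \<noteq> carrier A \<Longrightarrow>
    \<exists>v\<in>carrier A - F. \<forall>\<psi>. aug_form A \<psi> \<longrightarrow> ract A \<psi> v \<in> F"
  shows "conilpotent A"
proof (rule ccontr)
  assume con: "\<not> conilpotent A"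
  define F where "F = (\<Union>n. filt A n)"
  note Fc = lin_subspaceD[OF filt_subspace]
  have "lin_subspace A F"
    unfolding lin_subspace_def
  proof (intro conjI ballI allI)
    show "F \<subseteq> carrier A" using Fc(1) by (auto simp: F_def)
    show "\<zero> \<in> F" using Fc(2) by (auto simp: F_def)
    show "c \<odot> x \<in> F" if "x \<in> F" for c x using Fc(4) that by (auto simp: F_def)
    show "x \<oplus> y \<in> F" if xy: "x \<in> F" "y \<in> F" for x y
    proof -
      obtain m n where "x \<in> filt A m" "y \<in> filt A n" using xy by (auto simp: F_def)
      hence "x \<in> filt A (max m n)" "y \<in> filt A (max m n)"
        using filt_mono[of m "max m n"] filt_mono[of n "max m n"] by auto
      thus ?thesis using Fc(3) by (auto simp: F_def)
    qed
  qed
  hence "stable_subspace A F" using filt_ract by (auto simp: stable_subspace_def F_def)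
  moreover have "F \<noteq> carrier A" using con by (auto simp: conilpotent_def F_def)
  ultimately obtain v where v: "v \<in> carrier A" "v \<notin> F" "\<And>\<psi>. aug_form A \<psi> \<Longrightarrow> ract A \<psi> v \<in> F"
    using fix_ex by blast
  \<comment> \<open>The vector \<open>v\<close> is fixed modulo \<open>F\<close>. Once all of
    \<open>T\<close> lies in a single step \<open>filt A N\<close>, the next step contains
    \<open>v\<close>, although \<open>v\<close> is not in \<open>F\<close>.\<close>
  define T where "T = {ract A \<psi> v | \<psi>. aug_form A \<psi>}"
  have "lin_subspace A T"
    unfolding lin_subspace_def
  proof (intro conjI ballI allI)
    show "T \<subseteq> carrier A" using v by (auto simp: T_def)
    have "aug_form A (\<lambda>x. 0)" by (simp add: aug_form_def linear_form_def)
    moreover have "ract A (\<lambda>x. 0) v = \<zero>" using ract_add(3)[OF counit_form counit_form v(1)] .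
    ultimately show "\<zero> \<in> T" unfolding T_def by force
    show "x \<oplus> y \<in> T" if "x \<in> T" "y \<in> T" for x y
    proof -
      from that obtain \<phi> \<psi> where *: "aug_form A \<phi>" "aug_form A \<psi>" "x = ract A \<phi> v" "y = ract A \<psi> v"
        by (auto simp: T_def)
      hence "x \<oplus> y = ract A (\<lambda>x. \<phi> x + \<psi> x) v" using v by (simp add: ract_add aug_formD)
      thus ?thesis unfolding T_def using aug_form_combine * by blast
    qed
    show "c \<odot> x \<in> T" if "x \<in> T" for c x
    proof -
      from that obtain \<phi> where *: "aug_form A \<phi>" "x = ract A \<phi> v" by (auto simp: T_def)
      hence "c \<odot> x = ract A (\<lambda>x. c * \<phi> x) v" using v ract_add(2)[of \<phi> \<phi>] by (simp add: aug_formD)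
      thus ?thesis unfolding T_def using aug_form_combine * by blast
    qed
  qed
  moreover have "T \<subseteq> lspan A {\<zero>} (map fst (comult A v))" using ract_lspan v by (auto simp: T_def)
  ultimately obtain vs where vs: "set vs \<subseteq> T" "T \<subseteq> lspan A {\<zero>} vs"
    using finitely_spanned[OF _ subspace_zero comult_fst_closed[OF v(1)], of T] by blast
  have "T \<subseteq> F" using v by (auto simp: T_def)
  hence "\<exists>N. set vs \<subseteq> filt A N" using vs(1)
  proof (induction vs)
    case (Cons w ws)
    then obtain N n where "set ws \<subseteq> filt A N" "w \<in> filt A n" by (auto simp: F_def)
    hence "set (w # ws) \<subseteq> filt A (max N n)"
      using filt_mono[of N "max N n"] filt_mono[of n "max N n"] by auto
    thus ?case by blast
  qed simp
  then obtain N where "set vs \<subseteq> filt A N" by blast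
  hence "T \<subseteq> filt A N"
    using vs(2) lspan_least[OF filt_subspace, of "{\<zero>}" N vs] Fc(2) by auto
  hence "v \<in> filt A (Suc N)" using v by (auto simp: T_def)
  thus False using v(2) by (auto simp: F_def simp del: filt.simps)
qed

lemma form_finsum:
  assumes "linear_form A \<phi>" "finite J" "\<And>i. i \<in> J \<Longrightarrow> f i \<in> carrier A"
  shows "\<phi> (\<Oplus>i\<in>J. f i) = (\<Sum>i\<in>J. \<phi> (f i))"
  using assms(2,3)
proof (induction J rule: finite_induct)
  case empty thus ?case using assms(1) by (simp add: fsimps)
next
  case (insert x J)
  hence "(\<Oplus>i\<in>insert x J. f i) = f x \<oplus> (\<Oplus>i\<in>J. f i)"
    by (intro M.finsum_insert) auto
  thus ?case using insert assms(1) by (simp add: fsimps)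
qed

text \<open>Local finiteness of comodules: all contractions of \<open>x\<close> lie in the span of
  the left factors of one representative of \<Delta>(x). They form the subcomodule generated by
  \<open>x\<close>, which contains \<open>x\<close> because the counit acts as the identity.\<close>

lemma ract_stable_finite:
  assumes x: "x \<in> carrier A"
  defines "W \<equiv> {ract A \<psi> x | \<psi>. linear_form A \<psi>}"
  shows "stable_subspace A W" "x \<in> W" "W \<subseteq> lspan A {\<zero>} (map fst (comult A x))"
proof -
  have "lin_subspace A W"
    unfolding lin_subspace_def
  proof (intro conjI ballI allI)
    show "W \<subseteq> carrier A" using x by (auto simp: W_def)
    have "linear_form A (\<lambda>x. 0)" by (simp add: linear_form_def)
    moreover have "ract A (\<lambda>x. 0) x = \<zero>" using ract_add(3)[OF counit_form counit_form x] .
    ultimately show "\<zero> \<in> W" unfolding W_def by force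
    show "y \<oplus> z \<in> W" if "y \<in> W" "z \<in> W" for y z
    proof -
      from that obtain \<phi> \<psi> where *: "linear_form A \<phi>" "linear_form A \<psi>" "y = ract A \<phi> x" "z = ract A \<psi> x"
        by (auto simp: W_def)
      hence "y \<oplus> z = ract A (\<lambda>x. \<phi> x + \<psi> x) x" using x by (simp add: ract_add)
      thus ?thesis unfolding W_def using linear_form_combine(1) * by blast
    qed
    show "c \<odot> y \<in> W" if "y \<in> W" for c y
    proof -
      from that obtain \<phi> where *: "linear_form A \<phi>" "y = ract A \<phi> x" by (auto simp: W_def)
      hence "c \<odot> y = ract A (\<lambda>x. c * \<phi> x) x" using x ract_add(2)[of \<phi> \<phi>] by simp
      thus ?thesis unfolding W_def using linear_form_combine(3)[OF *(1) *(1)] by blast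
    qed
  qed
  moreover have "ract A \<psi> y \<in> W" if "linear_form A \<psi>" "y \<in> W" for \<psi> y
    using that x ract_ract conv_form unfolding W_def by blast
  ultimately show "stable_subspace A W" by (auto simp: stable_subspace_def)
  show "x \<in> W" using ract_counit[OF x] counit_form unfolding W_def by force
  show "W \<subseteq> lspan A {\<zero>} (map fst (comult A x))" using ract_lspan x by (auto simp: W_def)
qed

lemma sum_list_upt: "(\<Sum>j\<leftarrow>[0..<n]. f j) = (\<Sum>j<n. (f j :: 'k))"
  by (simp add: interv_sum_list_conv_sum_set_nat atLeast0LessThan)

text \<open>The representation on the quotient of a finite-dimensional stable subspace by its
  intersection with \<open>F\<close> has the matrix coefficients \<open>lact A (\<phi> i) (vs ! j)\<close>, where
  \<open>vs\<close> is a basis and \<open>\<phi>\<close> the dual basis.\<close>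

lemma conilpotent_if_fixed_vectors:
  assumes fv: "\<And>n a. n > 0 \<Longrightarrow> linear_representation A n a \<Longrightarrow>
     \<exists>c. (\<exists>i<n. c i \<noteq> 0) \<and> fixed_vector A n a c"
  shows "conilpotent A"
proof (rule conilpotentI)
  fix F assume F: "stable_subspace A F" "F \<noteq> carrier A"
  have Fs: "lin_subspace A F" and Fst: "\<And>\<psi> x. linear_form A \<psi> \<Longrightarrow> x \<in> F \<Longrightarrow> ract A \<psi> x \<in> F"
    using F by (auto simp: stable_subspace_def)
  obtain x0 where x0: "x0 \<in> carrier A" "x0 \<notin> F" using F(2) lin_subspaceD(1)[OF Fs] by blast
  define W where "W = {ract A \<psi> x0 | \<psi>. linear_form A \<psi>}"
  have W: "stable_subspace A W" "x0 \<in> W" "W \<subseteq> lspan A {\<zero>} (map fst (comult A x0))"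
    using ract_stable_finite[OF x0(1)] by (simp_all add: W_def)
  have Ws: "lin_subspace A W" and Wst: "\<And>\<psi> x. linear_form A \<psi> \<Longrightarrow> x \<in> W \<Longrightarrow> ract A \<psi> x \<in> W"
    using W(1) by (auto simp: stable_subspace_def)
  have us: "set (map fst (comult A x0)) \<subseteq> carrier A" using comult_fst_closed x0 by blast
  have "lspan A {\<zero>} (map fst (comult A x0)) \<subseteq> lspan A F (map fst (comult A x0))"
    using lspan_subspace[OF Fs us] lspan_mem[OF Fs us]
    by (intro lspan_least) (auto simp: lin_subspaceD)
  then obtain vs where vs: "set vs \<subseteq> W" "W \<subseteq> lspan A F vs" "lindep A F vs"
    using finitely_spanned[OF Ws Fs us] W(3) by blast
  note Wc = lin_subspaceD[OF Ws]
  have vsc: "set vs \<subseteq> carrier A" using vs Wc by auto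
  obtain \<phi> where \<phi>: "\<And>j. j < length vs \<Longrightarrow> linear_form A (\<phi> j) \<and> (\<forall>u\<in>F. \<phi> j u = 0) \<and>
    (\<forall>i<length vs. \<phi> j (vs ! i) = (if i = j then 1 else 0))"
    using dual_forms[OF Fs vsc vs(3)] by blast
  define n where "n = length vs"
  have vi: "vs ! i \<in> carrier A" "vs ! i \<in> W" if "i < n" for i
    using that vsc vs(1) by (auto simp: n_def)
  define S where "S w = list_sum A (map (\<lambda>j. \<phi> j w \<odot> vs ! j) [0..<n])" for w
  have Sc: "S w \<in> carrier A" for w unfolding S_def using vi by (intro list_sum_closed) auto
  have fS: "\<theta> (S w) = (\<Sum>j<n. \<phi> j w * \<theta> (vs ! j))" if "linear_form A \<theta>" for \<theta> w
  proof -
    have "\<theta> (S w) = sum_list (map \<theta> (map (\<lambda>j. \<phi> j w \<odot> vs ! j) [0..<n]))"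
      unfolding S_def using that vi by (intro form_list_sum) auto
    also have "\<dots> = (\<Sum>j\<leftarrow>[0..<n]. \<phi> j w * \<theta> (vs ! j))"
      using that vi by (intro arg_cong[of _ _ sum_list]) (auto simp: fsimps)
    finally show ?thesis by (simp add: sum_list_upt)
  qed
  have exp: "w \<ominus> S w \<in> F" if "w \<in> W" for w
    unfolding S_def n_def using lspan_expand[OF Fs vsc \<phi>] that vs(2) by blast
  \<comment> \<open>A form that kills \<open>F\<close> factors through the quotient of
    \<open>W\<close> by its intersection with \<open>F\<close>, where the \<open>vs ! j\<close> are
    a basis with dual basis \<phi>.\<close>
  have expf: "\<theta> w = (\<Sum>j<n. \<phi> j w * \<theta> (vs ! j))"
    if "linear_form A \<theta>" "\<And>y. y \<in> F \<Longrightarrow> \<theta> y = 0" "w \<in> W" for \<theta> w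
  proof -
    have "\<theta> (w \<ominus> S w) = 0" using exp that by blast
    thus ?thesis using that Sc Wc by (simp add: fsimps fS)
  qed
  define a where "a i j = lact A (\<phi> i) (vs ! j)" for i j
  have ac: "a i j \<in> carrier A" if "j < n" for i j using vi that by (simp add: a_def)
  have rep: "linear_representation A n a"
    unfolding linear_representation_def
  proof (intro allI impI conjI)
    fix i j assume ij: "i < n" "j < n"
    note \<phi>i = \<phi>[of i, folded n_def, OF ij(1)]
    show "a i j \<in> carrier A" using ac ij by auto
    show "counit A (a i j) = (if i = j then 1 else 0)"
      using \<phi>i vi ij counit_form by (auto simp: a_def form_lact conv_counit)
    show "tensor_eq A (comult A (a i j)) [(a i l, a l j). l \<leftarrow> [0..<n]]"
    proof (rule tensor_eqI)
      show "set (comult A (a i j)) \<subseteq> carrier A \<times> carrier A" using ac ij by (simp add: comult_closed)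
      show sc: "set [(a i l, a l j). l \<leftarrow> [0..<n]] \<subseteq> carrier A \<times> carrier A" using ac ij by auto
      fix \<psi> assume \<psi>: "linear_form A \<psi>"
      show "ctr A \<psi> (comult A (a i j)) = ctr A \<psi> [(a i l, a l j). l \<leftarrow> [0..<n]]"
      proof (rule forms_eqI)
        show "ctr A \<psi> (comult A (a i j)) \<in> carrier A" "ctr A \<psi> [(a i l, a l j). l \<leftarrow> [0..<n]] \<in> carrier A"
          using ac ij sc by (auto intro!: ctr_closed comult_closed)
        fix \<theta> assume \<theta>: "linear_form A \<theta>"
        let ?w = "ract A \<psi> (vs ! j)"
        have w: "?w \<in> W" using Wst \<psi> vi ij by blast
        have \<phi>w: "\<phi> l ?w = \<psi> (a l j)" if "l < n" for l
          using \<phi>[of l, folded n_def, OF that] vi ij \<psi> by (simp add: a_def form_ract form_lact)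
        \<comment> \<open>Since \<open>F\<close> is stable, the convolution of
          \<open>\<phi> i\<close> with any \<theta> kills \<open>F\<close> as well. So
          \<open>expf\<close> applies to it and produces the inner sum of the matrix
          identity.\<close>
        have z: "conv A (\<phi> i) \<theta> y = 0" if "y \<in> F" for y
          using \<phi>i Fst[OF \<theta> that] lin_subspaceD(1)[OF Fs that] by (simp flip: form_ract)
        have "\<theta> (ctr A \<psi> (comult A (a i j))) = conv A \<theta> \<psi> (a i j)"
          using \<theta> ac ij by (simp flip: ract_def add: form_ract)
        also have "\<dots> = conv A (\<phi> i) (conv A \<theta> \<psi>) (vs ! j)"
          unfolding a_def using \<theta> \<psi> vi ij by (intro form_lact conv_form) auto
        also have "\<dots> = conv A (conv A (\<phi> i) \<theta>) \<psi> (vs ! j)"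
          using \<phi>i \<theta> \<psi> vi ij by (simp add: conv_assoc)
        also have "\<dots> = conv A (\<phi> i) \<theta> ?w"
          using \<phi>i \<theta> vi ij by (intro form_ract[symmetric] conv_form) auto
        also have "\<dots> = (\<Sum>l<n. \<phi> l ?w * conv A (\<phi> i) \<theta> (vs ! l))"
          using \<phi>i \<theta> z w by (intro expf conv_form) auto
        also have "\<dots> = (\<Sum>l<n. \<theta> (a i l) * \<psi> (a l j))"
          using \<phi>w vi \<theta> by (intro sum.cong) (auto simp: a_def form_lact)
        also have "\<dots> = \<theta> (ctr A \<psi> [(a i l, a l j). l \<leftarrow> [0..<n]])"
          using \<theta> sc by (subst form_ctr) (auto simp: o_def sum_list_upt)
        finally show "\<theta> (ctr A \<psi> (comult A (a i j))) = \<theta> (ctr A \<psi> [(a i l, a l j). l \<leftarrow> [0..<n]])" .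
      qed
    qed
  qed
  have "n > 0"
  proof (rule ccontr)
    assume "\<not> n > 0"
    hence "vs = []" by (simp add: n_def)
    thus False using vs(2) W(2) x0(2) by auto
  qed
  then obtain c i0 where c: "i0 < n" "c i0 \<noteq> 0" "fixed_vector A n a c" using fv rep by blast
  \<comment> \<open>The fixed vector \<open>c\<close> of the representation, read in the basis: it
    is fixed modulo \<open>F\<close>, and its nonzero coordinate \<open>c i0\<close> keeps it
    outside \<open>F\<close>.\<close>
  define v where "v = list_sum A (map (\<lambda>j. c j \<odot> vs ! j) [0..<n])"
  have vW: "v \<in> W" unfolding v_def using vi Wc by (intro list_sum_subspace[OF Ws]) auto
  have fv: "\<theta> v = (\<Sum>j<n. c j * \<theta> (vs ! j))" if "linear_form A \<theta>" for \<theta>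
  proof -
    have "\<theta> v = sum_list (map \<theta> (map (\<lambda>j. c j \<odot> vs ! j) [0..<n]))"
      unfolding v_def using that vi by (intro form_list_sum) auto
    also have "\<dots> = (\<Sum>j\<leftarrow>[0..<n]. c j * \<theta> (vs ! j))"
      using that vi by (intro arg_cong[of _ _ sum_list]) (auto simp: fsimps)
    finally show ?thesis by (simp add: sum_list_upt)
  qed
  have "\<phi> i0 v = (\<Sum>j<n. c j * \<phi> i0 (vs ! j))" using \<phi>[of i0, folded n_def, OF c(1)] by (intro fv) simp
  also have "\<dots> = (\<Sum>j<n. if j = i0 then c i0 else 0)"
    using \<phi>[of i0, folded n_def, OF c(1)] by (intro sum.cong) auto
  also have "\<dots> = c i0" using c by simp
  finally have "v \<notin> F" using c \<phi>[of i0, folded n_def, OF c(1)] by auto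
  moreover have "ract A \<psi> v \<in> F" if \<psi>: "aug_form A \<psi>" for \<psi>
  proof -
    let ?w = "ract A \<psi> v"
    have \<psi>': "linear_form A \<psi>" "\<psi> \<one> = 0" using \<psi> by (auto simp: aug_formD)
    have w: "?w \<in> W" using Wst \<psi>' vW by blast
    have vc: "v \<in> carrier A" using vW Wc by blast
    have "\<phi> l ?w = 0" if l: "l < n" for l
    proof -
      note \<phi>l = \<phi>[of l, folded n_def, OF l]
      have "\<phi> l ?w = conv A (\<phi> l) \<psi> v" using \<phi>l vc by (simp add: form_ract)
      also have "\<dots> = (\<Sum>j<n. c j * conv A (\<phi> l) \<psi> (vs ! j))"
        using \<phi>l \<psi>' by (intro fv conv_form) auto
      also have "\<dots> = (\<Sum>j<n. \<psi> (c j \<odot> a l j))"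
        using vi \<psi>' by (intro sum.cong) (auto simp: a_def fsimps form_lact)
      also have "\<dots> = \<psi> (\<Oplus>j\<in>{..<n}. c j \<odot> a l j)"
        using \<psi>' ac by (intro form_finsum[symmetric]) auto
      also have "\<dots> = \<psi> (c l \<odot> \<one>)" using c(3) l by (simp add: fixed_vector_def)
      finally show ?thesis using \<psi>' by (simp add: fsimps)
    qed
    hence "\<theta> (S ?w) = \<theta> \<zero>" if "linear_form A \<theta>" for \<theta> using that by (simp add: fS fsimps)
    hence "S ?w = \<zero>" using Sc by (intro forms_eqI) auto
    thus ?thesis using exp[OF w] w Wc by (simp add: a_minus_def)
  qed
  ultimately show "\<exists>v\<in>carrier A - F. \<forall>\<psi>. aug_form A \<psi> \<longrightarrow> ract A \<psi> v \<in> F"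
    using vW Wc by blast
qed

end

text \<open>Orbits that are not fixed points have a size divisible by \<open>p\<close>. If
  \<open>x0\<close> were the only fixed point, the size of \<open>E\<close> would be 1 modulo
  \<open>p\<close>.\<close>

lemma (in group_action) p_group_fixed_point:
  assumes p: "Factorial_Ring.prime (p::nat)" "Coset.order G = p ^ m" and E: "finite E" "p dvd card E"
    and x0: "x0 \<in> E" "\<And>g. g \<in> carrier G \<Longrightarrow> \<phi> g x0 = x0"
  shows "\<exists>x\<in>E. x \<noteq> x0 \<and> (\<forall>g\<in>carrier G. \<phi> g x = x)"
proof (rule ccontr)
  assume no: "\<not> ?thesis"
  interpret G: group G using group_hom group_hom.axioms(1) by auto
  have o0: "orbit G \<phi> x0 = {x0}" using x0(2) G.one_closed by (force simp: orbit_def)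
  let ?O = "orbits G E \<phi>"
  have fin: "finite ?O" using E(1) by (simp add: orbits_def)
  have mem: "{x0} \<in> ?O" using o0 x0 by (auto simp: orbits_def)
  have dvd: "p dvd card Q" if Q: "Q \<in> ?O - {{x0}}" for Q
  proof -
    obtain x where x: "x \<in> E" "Q = orbit G \<phi> x" using Q by (auto simp: orbits_def)
    have xQ: "x \<in> Q" using x orbit_refl by blast
    have "card Q dvd p ^ m" using orbit_stabilizer_theorem[OF x(1)] p(2) x(2) by (metis dvd_triv_left)
    then obtain k where k: "card Q = p ^ k" using p(1) divides_primepow_nat by blast
    have "k \<noteq> 0"
    proof
      assume "k = 0"
      then obtain y where "Q = {y}" using k card_1_singletonE by (metis power_0)
      hence Qx: "Q = {x}" using xQ by auto
      hence "\<phi> g x = x" if "g \<in> carrier G" for g using that x(2) by (auto simp: orbit_def)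
      hence "x = x0" using no x by blast
      thus False using Q Qx by auto
    qed
    thus ?thesis using k by simp
  qed
  have "card E = (\<Sum>Q\<in>?O. card Q)"
    using disjoint_sum[OF E(1), of "\<lambda>_. 1::nat"] by (simp only: card_eq_sum)
  also have "\<dots> = 1 + (\<Sum>Q\<in>?O - {{x0}}. card Q)" using sum.remove[OF fin mem, of card] by simp
  finally have "card E = 1 + (\<Sum>Q\<in>?O - {{x0}}. card Q)" .
  moreover have "p dvd (\<Sum>Q\<in>?O - {{x0}}. card Q)" using dvd by (rule dvd_sum)
  ultimately have "p dvd 1" using E(2) dvd_add_left_iff[of p _ 1] by metis
  thus False using p(1) by simp
qed

section \<open>Function algebras of groups\<close>

locale constant_hopf = hopf_algebra A + \<Gamma>: group \<Gamma>
  for A :: "('k::field, 'a) hopf" (structure) and \<Gamma> :: "('g, 'm) monoid_scheme" +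
  fixes ev :: "'a \<Rightarrow> 'g \<Rightarrow> 'k"
  assumes bij: "bij_betw ev (carrier A) (carrier \<Gamma> \<rightarrow>\<^sub>E UNIV)"
    and ev_hom: "g \<in> carrier \<Gamma> \<Longrightarrow> algebra_hom A base_algebra (\<lambda>x. ev x g)"
    and ev_comult: "\<lbrakk>x \<in> carrier A; g \<in> carrier \<Gamma>; h \<in> carrier \<Gamma>\<rbrakk> \<Longrightarrow>
           (\<Sum>(u, v)\<leftarrow>comult A x. ev u g * ev v h) = ev x (g \<otimes>\<^bsub>\<Gamma>\<^esub> h)"
begin

abbreviation T :: "'g \<Rightarrow> 'a \<Rightarrow> 'a" where "T g \<equiv> ract A (\<lambda>x. ev x g)"

lemma ev_form: "g \<in> carrier \<Gamma> \<Longrightarrow> linear_form A (\<lambda>x. ev x g)"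
  using ev_hom algebra_homD(1) by blast

lemma ev_eqI:
  assumes "x \<in> carrier A" "y \<in> carrier A" "\<And>g. g \<in> carrier \<Gamma> \<Longrightarrow> ev x g = ev y g"
  shows "x = y"
proof -
  have "ev x = ev y" using assms bij_betwE[OF bij]
    by (intro PiE_ext[of "ev x" "carrier \<Gamma>" "\<lambda>_. UNIV"]) auto
  thus ?thesis using bij_betw_imp_inj_on[OF bij] assms(1,2) by (auto dest: inj_onD)
qed

lemma ev_T: "g \<in> carrier \<Gamma> \<Longrightarrow> h \<in> carrier \<Gamma> \<Longrightarrow> x \<in> carrier A \<Longrightarrow> ev (T g x) h = ev x (h \<otimes>\<^bsub>\<Gamma>\<^esub> g)"
  using form_ract[OF ev_form[of h], of x] ev_comult by (simp add: conv_def)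

lemma T_mult: "g \<in> carrier \<Gamma> \<Longrightarrow> h \<in> carrier \<Gamma> \<Longrightarrow> x \<in> carrier A \<Longrightarrow> T g (T h x) = T (g \<otimes>\<^bsub>\<Gamma>\<^esub> h) x"
  by (intro ev_eqI) (auto simp: ev_T \<Gamma>.m_assoc)

lemma T_one: "x \<in> carrier A \<Longrightarrow> T \<one>\<^bsub>\<Gamma>\<^esub> x = x"
  by (intro ev_eqI) (auto simp: ev_T)

text \<open>Invariance under group elements suffices because they separate functions. If \<chi>
  kills \<open>F\<close>, then \<open>lact A \<chi> v\<close> is the function g \<mapsto> \<chi>(T g
  v), which is constant and so is killed by \<psi>; hence \<chi> vanishes at
  \<open>ract A \<psi> v\<close>.\<close>

lemma invariant_mod:
  assumes F: "lin_subspace A F" and v: "v \<in> carrier A"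
    and inv: "\<And>g. g \<in> carrier \<Gamma> \<Longrightarrow> T g v \<ominus> v \<in> F" and \<psi>: "aug_form A \<psi>"
  shows "ract A \<psi> v \<in> F"
proof (rule ccontr)
  assume "ract A \<psi> v \<notin> F"
  then obtain \<chi> where \<chi>: "linear_form A \<chi>" "\<chi> (ract A \<psi> v) = 1" "\<And>u. u \<in> F \<Longrightarrow> \<chi> u = 0"
    using hyperplane[OF F, of "ract A \<psi> v"] v by auto
  have "lact A \<chi> v = \<chi> v \<odot> \<one>"
  proof (rule ev_eqI)
    fix g assume g: "g \<in> carrier \<Gamma>"
    have "ev (lact A \<chi> v) g = \<chi> (T g v)"
      using form_lact[OF ev_form[OF g] v] form_ract[OF \<chi>(1) v] by simp
    also have "\<dots> = \<chi> v" using \<chi>(3)[OF inv[OF g]] \<chi>(1) v by (simp add: fsimps)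
    also have "\<dots> = ev (\<chi> v \<odot> \<one>) g" using ev_hom[OF g] algebra_homD(2)[OF ev_hom[OF g]]
      by (simp add: fsimps[OF ev_form[OF g]])
    finally show "ev (lact A \<chi> v) g = ev (\<chi> v \<odot> \<one>) g" .
  qed (use v in auto)
  hence "\<psi> (lact A \<chi> v) = 0" using \<psi> by (simp add: aug_formD fsimps)
  thus False using \<chi> \<psi> v by (simp add: form_ract form_lact aug_formD)
qed

text \<open>The finite group acts by translation on the cosets of a proper stable subspace
  \<open>F\<close>. Their number is a power of \<open>p\<close> other than 1 and the coset
  \<open>F\<close> is fixed, so another coset is fixed too; its elements are invariant modulo
  \<open>F\<close>.\<close>

lemma conilpotent_p_group:
  assumes p: "Factorial_Ring.prime (p::nat)" "CARD('k) = p"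
    and fin: "finite (carrier \<Gamma>)" "card (carrier \<Gamma>) = p ^ m"
  shows "conilpotent A"
proof (rule conilpotentI)
  fix F assume F: "stable_subspace A F" "F \<noteq> carrier A"
  have Fs: "lin_subspace A F" and Fst: "\<And>\<psi> x. linear_form A \<psi> \<Longrightarrow> x \<in> F \<Longrightarrow> ract A \<psi> x \<in> F"
    using F by (auto simp: stable_subspace_def)
  note Fc = lin_subspaceD[OF Fs]
  have finA: "finite (carrier A)" "card (carrier A) = p ^ card (carrier \<Gamma>)"
  proof -
    have "finite (UNIV :: 'k set)" using p by (metis card.infinite not_prime_0)
    thus "finite (carrier A)" using bij_betw_finite[OF bij] fin by (auto intro: finite_PiE)
    show "card (carrier A) = p ^ card (carrier \<Gamma>)"
      using bij_betw_same_card[OF bij] fin p(2) by (simp add: card_PiE)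
  qed
  interpret add: group "add_monoid A" by (rule M.a_group)
  have sub: "subgroup F (add_monoid A)"
    using Fc subspace_minus[OF Fs] by (unfold_locales) (auto simp flip: a_inv_def)
  define E where "E = rcosets\<^bsub>add_monoid A\<^esub> F"
  define cos where "cos x = F #>\<^bsub>add_monoid A\<^esub> x" for x
  have cos_eq: "cos x = {h \<oplus> x | h. h \<in> F}" for x by (auto simp: cos_def r_coset_def)
  have E: "E = cos ` carrier A" by (auto simp: E_def cos_def RCOSETS_def)
  have cos_self: "x \<in> cos x" if "x \<in> carrier A" for x using Fc(2) that by (force simp: cos_eq)
  have cos0: "cos x = F \<longleftrightarrow> x \<in> F" if "x \<in> carrier A" for x
    using that add.coset_join1[OF _ _ sub] add.coset_join2[OF _ sub] Fc(1) by (auto simp: cos_def)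
  have img: "T g ` cos x = cos (T g x)" if g: "g \<in> carrier \<Gamma>" and x: "x \<in> carrier A" for g x
  proof (intro equalityI subsetI)
    fix y assume "y \<in> T g ` cos x"
    then obtain h where "h \<in> F" "y = T g (h \<oplus> x)" by (auto simp: cos_eq)
    thus "y \<in> cos (T g x)" using x Fc(1) Fst[OF ev_form[OF g]] by (auto simp: cos_eq ract_linear[OF ev_form[OF g]])
  next
    fix y assume "y \<in> cos (T g x)"
    then obtain h where h: "h \<in> F" "y = h \<oplus> T g x" by (auto simp: cos_eq)
    let ?h = "T (inv\<^bsub>\<Gamma>\<^esub> g) h"
    have "?h \<in> F" using h Fst[OF ev_form] g by auto
    moreover have "T g ?h = h" using h Fc(1) g by (simp add: T_mult T_one)
    hence "T g (?h \<oplus> x) = y" using h x Fc(1) g by (simp add: ract_linear[OF ev_form[OF g]])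
    ultimately show "y \<in> T g ` cos x" by (force simp: cos_eq)
  qed
  define act where "act g = (\<lambda>C\<in>E. T g ` C)" for g
  have act_cos: "act g (cos x) = cos (T g x)" if "g \<in> carrier \<Gamma>" "x \<in> carrier A" for g x
    using that img by (auto simp: act_def E)
  have act_Bij: "act g \<in> Bij E" if g: "g \<in> carrier \<Gamma>" for g
  proof -
    have "bij_betw (act g) E E"
    proof (rule bij_betw_byWitness[of _ "act (inv\<^bsub>\<Gamma>\<^esub> g)"])
      show "\<forall>C\<in>E. act (inv\<^bsub>\<Gamma>\<^esub> g) (act g C) = C" "\<forall>C\<in>E. act g (act (inv\<^bsub>\<Gamma>\<^esub> g) C) = C"
        using g by (auto simp: E act_cos T_mult T_one)
      show "act g ` E \<subseteq> E" "act (inv\<^bsub>\<Gamma>\<^esub> g) ` E \<subseteq> E" using g by (auto simp: E act_cos)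
    qed
    thus ?thesis by (auto simp: Bij_def act_def)
  qed
  have "act (g \<otimes>\<^bsub>\<Gamma>\<^esub> h) = compose E (act g) (act h)" if "g \<in> carrier \<Gamma>" "h \<in> carrier \<Gamma>" for g h
  proof (rule extensionalityI[of _ E])
    show "act (g \<otimes>\<^bsub>\<Gamma>\<^esub> h) C = compose E (act g) (act h) C" if "C \<in> E" for C
      using that \<open>g \<in> carrier \<Gamma>\<close> \<open>h \<in> carrier \<Gamma>\<close> by (auto simp: E act_cos T_mult compose_def)
  qed (auto simp: act_def)
  hence "group_hom \<Gamma> (BijGroup E) act"
    using act_Bij by (intro group_hom.intro group_hom_axioms.intro group_BijGroup \<Gamma>.is_group)
      (auto simp: hom_def BijGroup_def)
  then interpret act: group_action \<Gamma> E act by (rule group_action.intro)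
  have lag: "card E * card F = p ^ card (carrier \<Gamma>)"
    using add.lagrange[OF sub, unfolded Coset.order_def] finA(2) by (simp add: E_def)
  have "finite E" using finA by (simp add: E)
  have FE: "F \<in> E" using cos0[of \<zero>] Fc(2) by (force simp: E)
  obtain x where x: "x \<in> carrier A" "x \<notin> F" using F(2) Fc(1) by blast
  hence "cos x \<in> E" "cos x \<noteq> F" using cos0 by (auto simp: E)
  hence "card E \<noteq> 1" using FE by (metis card_1_singletonE singletonD)
  moreover obtain k where "card E = p ^ k"
    using lag p(1) divides_primepow_nat by (metis dvd_triv_left)
  ultimately have "p dvd card E" by (cases k) auto
  moreover have "act g F = F" if "g \<in> carrier \<Gamma>" for g
  proof -
    have "cos \<zero> = F" using cos0[of \<zero>] Fc(2) by simp
    thus ?thesis using act_cos[OF that, of \<zero>] by (simp add: ract_linear ev_form that)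
  qed
  ultimately have "\<exists>C\<in>E. C \<noteq> F \<and> (\<forall>g\<in>carrier \<Gamma>. act g C = C)"
    using act.p_group_fixed_point[OF p(1), of m F] fin(2) \<open>finite E\<close> FE by (simp add: Coset.order_def)
  then obtain C where C: "C \<in> E" "C \<noteq> F" "\<And>g. g \<in> carrier \<Gamma> \<Longrightarrow> act g C = C"
    by blast
  then obtain v where v: "v \<in> carrier A" "C = cos v" by (auto simp: E)
  have vF: "v \<notin> F" using v C cos0 by auto
  have "T g v \<ominus> v \<in> F" if g: "g \<in> carrier \<Gamma>" for g
  proof -
    have "T g v \<in> cos v" using C(3)[OF g] v act_cos[OF g v(1)] cos_self[of "T g v"] by simp
    then obtain h where h: "h \<in> F" "T g v = h \<oplus> v" by (auto simp: cos_eq)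
    hence "T g v \<ominus> v = h" using v Fc(1) by (simp add: a_minus_def M.a_assoc M.r_neg)
    thus ?thesis using h by simp
  qed
  thus "\<exists>v\<in>carrier A - F. \<forall>\<psi>. aug_form A \<psi> \<longrightarrow> ract A \<psi> v \<in> F"
    using invariant_mod[OF Fs v(1)] v(1) vF by blast
qed

end

text \<open>Fermat's little theorem: a field with \<open>p\<close> elements consists of the
  multiples of 1, and on these the claim follows by induction from the additivity of the
  \<open>p\<close>-th power.\<close>

lemma prime_field_power:
  fixes c :: "'k::field"
  assumes p: "Factorial_Ring.prime (p::nat)" "CARD('k) = p" "CHAR('k) = p"
  shows "c ^ p = c"
proof -
  have fin: "finite (UNIV :: 'k set)" using p by (metis card.infinite not_prime_0)
  have "inj_on (of_nat :: nat \<Rightarrow> 'k) {..<p}"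
    using p(3) by (auto intro!: inj_onI simp: of_nat_eq_iff_cong_CHAR cong_def)
  hence "card ((of_nat :: nat \<Rightarrow> 'k) ` {..<p}) = p" by (simp add: card_image)
  hence "(of_nat :: nat \<Rightarrow> 'k) ` {..<p} = UNIV" using fin p(2) by (intro card_subset_eq) auto
  then obtain n where n: "c = of_nat n" by (metis UNIV_I imageE)
  have "(of_nat n :: 'k) ^ p = of_nat n"
  proof (induction n)
    case 0 thus ?case using p prime_gt_0_nat by (simp add: zero_power)
  next
    case (Suc n)
    have "(1 + of_nat n :: 'k) ^ p = 1 ^ p + of_nat n ^ p"
      by (rule freshmans_dream) (simp_all only: p(1,3))
    thus ?case using Suc by (simp only: of_nat_Suc power_one)
  qed
  thus ?thesis using n by simp
qed

lemma prime_card_CHAR: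
  assumes "Factorial_Ring.prime (CARD('k::field))"
  shows "CHAR('k) = CARD('k)"
proof -
  have "CHAR('k) dvd CARD('k)" by (rule CHAR_dvd_CARD)
  moreover have "CHAR('k) \<noteq> 1" by simp
  ultimately show ?thesis using assms by (metis prime_nat_iff)
qed

text \<open>Functions with values in \<open>F_p\<close> satisfy this pointwise, and it passes to
  direct limits of coordinate rings. In positive characteristic, this and conilpotence are what the
  construction of points retains of the group.\<close>

definition frob_fixed :: "('k::field, 'a) hopf \<Rightarrow> bool" where
  "frob_fixed A \<longleftrightarrow> (\<forall>x\<in>carrier A. x [^]\<^bsub>A\<^esub> CHAR('k) = x)"

lemma algebra_hom_pow:
  assumes "monoid A" "monoid B" "algebra_hom A B f" "x \<in> carrier A"
  shows "f (x [^]\<^bsub>A\<^esub> (n::nat)) = f x [^]\<^bsub>B\<^esub> n"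
proof -
  interpret A: monoid A by fact
  interpret B: monoid B by fact
  show ?thesis by (induction n) (use assms algebra_homD[OF assms(3)] in auto)
qed

lemma monoid_base_algebra: "monoid (base_algebra :: ('k::field, 'k) module)"
  by (rule monoidI) auto

lemma base_algebra_pow [simp]: "(x :: 'k::field) [^]\<^bsub>base_algebra\<^esub> (n::nat) = x ^ n"
  by (induction n) (auto simp: nat_pow_def mult.commute)

lemma unipotent_structure:
  fixes A :: "('k::field, 'a) hopf"
  assumes k: "CHAR('k) = 0 \<or> Factorial_Ring.prime CARD('k)" and A: "unipotent A"
  shows "hopf_algebra A" "conilpotent A" "CHAR('k) \<noteq> 0 \<Longrightarrow> frob_fixed A"
proof -
  show h: "hopf_algebra A" using A by (simp add: unipotent_def)
  interpret hopf_algebra A by fact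
  have pos: "conilpotent A \<and> frob_fixed A" if c: "CHAR('k) \<noteq> 0"
  proof -
    from A c obtain \<Gamma> :: "nat monoid" and m where \<Gamma>: "group \<Gamma>" "finite (carrier \<Gamma>)"
      "card (carrier \<Gamma>) = CHAR('k) ^ m" "constant_group_scheme \<Gamma> A"
      by (auto simp: unipotent_def)
    then obtain ev where ev: "bij_betw ev (carrier A) (carrier \<Gamma> \<rightarrow>\<^sub>E UNIV)"
        "\<forall>g\<in>carrier \<Gamma>. algebra_hom A base_algebra (\<lambda>x. ev x g)"
        "\<forall>x\<in>carrier A. \<forall>g\<in>carrier \<Gamma>. \<forall>h\<in>carrier \<Gamma>.
           (\<Sum>(u, v)\<leftarrow>comult A x. ev u g * ev v h) = ev x (g \<otimes>\<^bsub>\<Gamma>\<^esub> h)"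
      unfolding constant_group_scheme_def by blast
    interpret constant_hopf A \<Gamma> ev
      using ev by (intro constant_hopf.intro constant_hopf_axioms.intro h \<Gamma>(1)) auto
    have p: "Factorial_Ring.prime CARD('k)" using k c by simp
    have "conilpotent A"
      using conilpotent_p_group[OF p refl \<Gamma>(2)] \<Gamma>(3) prime_card_CHAR[OF p] by simp
    moreover have "x [^]\<^bsub>A\<^esub> CHAR('k) = x" if x: "x \<in> carrier A" for x
    proof (rule ev_eqI)
      fix g assume g: "g \<in> carrier \<Gamma>"
      have "ev (x [^]\<^bsub>A\<^esub> CHAR('k)) g = ev x g ^ CHAR('k)"
        using algebra_hom_pow[OF M_cring[THEN cring.axioms(1), THEN ring.is_monoid] monoid_base_algebra ev_hom[OF g] x] by simp
      thus "ev (x [^]\<^bsub>A\<^esub> CHAR('k)) g = ev x g"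
        using prime_field_power[OF p refl prime_card_CHAR[OF p]] prime_card_CHAR[OF p] by simp
    qed (use x in auto)
    ultimately show ?thesis by (simp add: frob_fixed_def)
  qed
  thus "CHAR('k) \<noteq> 0 \<Longrightarrow> frob_fixed A" by blast
  show "conilpotent A"
  proof (cases "CHAR('k) = 0")
    case True
    thus ?thesis using A by (intro conilpotent_if_fixed_vectors) (auto simp: unipotent_def)
  qed (use pos in blast)
qed

lemma prounipotent_structure:
  fixes A :: "('k::field, 'a) hopf"
  assumes k: "CHAR('k) = 0 \<or> Factorial_Ring.prime CARD('k)"
    and A: "prounipotent TYPE('i) TYPE('b) A"
  shows "hopf_algebra A" "conilpotent A" "CHAR('k) \<noteq> 0 \<Longrightarrow> frob_fixed A"
proof -
  from A obtain I :: "'i set" and r and B :: "'i \<Rightarrow> ('k, 'b) hopf" and t u where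
    lim: "inverse_limit I r B t A u" and uni: "\<And>i. i \<in> I \<Longrightarrow> unipotent (B i)"
    by (auto simp: prounipotent_def)
  show h: "hopf_algebra A" using lim by (simp add: inverse_limit_def)
  interpret hopf_algebra A by fact
  have hom: "\<And>i. i \<in> I \<Longrightarrow> hopf_hom (B i) A (u i)"
    and cov: "carrier A = (\<Union>i\<in>I. u i ` carrier (B i))"
    using lim by (auto simp: inverse_limit_def)
  show "conilpotent A"
    by (rule conilpotent_cover[OF h _ cov]) (simp add: unipotent_structure[OF k uni] hom)
  assume c: "CHAR('k) \<noteq> 0"
  show "frob_fixed A"
    unfolding frob_fixed_def
  proof
    fix x assume "x \<in> carrier A"
    then obtain i y where i: "i \<in> I" "y \<in> carrier (B i)" "x = u i y" using cov by auto
    interpret Bi: hopf_algebra "B i" using unipotent_structure[OF k uni[OF i(1)]] by simp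
    have "x [^]\<^bsub>A\<^esub> CHAR('k) = u i (y [^]\<^bsub>B i\<^esub> CHAR('k))"
      using algebra_hom_pow[OF Bi.M_cring[THEN cring.axioms(1), THEN ring.is_monoid] M_cring[THEN cring.axioms(1), THEN ring.is_monoid] hopf_homD(1)[OF hom[OF i(1)]] i(2)] i(3) by simp
    thus "x [^]\<^bsub>A\<^esub> CHAR('k) = x"
      using unipotent_structure(3)[OF k uni[OF i(1)] c] i by (simp add: frob_fixed_def)
  qed
qed

section \<open>Adjoining one element to a stable subalgebra\<close>

text \<open>Polynomials in \<open>x\<close> with coefficients in \<open>C\<close> and degree
  strictly below \<open>n\<close>: the space modulo which leading terms of degree \<open>n\<close>
  are considered.\<close>

fun polys :: "('a, 'm) ring_scheme \<Rightarrow> 'a set \<Rightarrow> 'a \<Rightarrow> nat \<Rightarrow> 'a set" where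
  "polys A C x 0 = {\<zero>\<^bsub>A\<^esub>}"
| "polys A C x (Suc n) = {y \<oplus>\<^bsub>A\<^esub> c \<otimes>\<^bsub>A\<^esub> x [^]\<^bsub>A\<^esub> n | y c. y \<in> polys A C x n \<and> c \<in> C}"

declare polys.simps(2) [simp del]

lemma polys_SucI: "y \<in> polys A C x n \<Longrightarrow> c \<in> C \<Longrightarrow> y \<oplus>\<^bsub>A\<^esub> c \<otimes>\<^bsub>A\<^esub> x [^]\<^bsub>A\<^esub> n \<in> polys A C x (Suc n)"
  by (auto simp: polys.simps(2))

lemma polys_SucE:
  assumes "y \<in> polys A C x (Suc n)"
  obtains a d where "a \<in> polys A C x n" "d \<in> C" "y = a \<oplus>\<^bsub>A\<^esub> d \<otimes>\<^bsub>A\<^esub> x [^]\<^bsub>A\<^esub> n"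
  using assms by (auto simp: polys.simps(2))

definition subalg :: "('k::field, 'a) hopf \<Rightarrow> 'a set \<Rightarrow> bool" where
  "subalg A C \<longleftrightarrow> lin_subspace A C \<and> \<one>\<^bsub>A\<^esub> \<in> C \<and> (\<forall>x\<in>C. \<forall>y\<in>C. x \<otimes>\<^bsub>A\<^esub> y \<in> C)"

context hopf_algebra
begin

lemma one_neq_zero: "\<one> \<noteq> \<zero>"
  using counit_simps(1) form_zero[OF counit_form] by auto

lemma ract_cong: "x \<in> carrier A \<Longrightarrow> (\<And>y. y \<in> carrier A \<Longrightarrow> \<phi> y = \<psi> y) \<Longrightarrow> ract A \<phi> x = ract A \<psi> x"
  unfolding ract_def ctr_def using comult_closed[of x]
  by (intro arg_cong[of _ _ "list_sum A"] map_cong) auto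

lemma conv_cong:
  assumes "x \<in> carrier A" "\<And>y. y \<in> carrier A \<Longrightarrow> \<phi> y = \<phi>' y" "\<And>y. y \<in> carrier A \<Longrightarrow> \<psi> y = \<psi>' y"
  shows "conv A \<phi> \<psi> x = conv A \<phi>' \<psi>' x"
  unfolding conv_def using assms by (intro comult_sum_cong) auto

lemma conv_linear:
  "conv A (\<lambda>x. \<phi> x + \<phi>' x) \<psi> x = conv A \<phi> \<psi> x + conv A \<phi>' \<psi> x"
  "conv A \<phi> (\<lambda>x. \<psi> x + \<psi>' x) x = conv A \<phi> \<psi> x + conv A \<phi> \<psi>' x"
  "conv A (\<lambda>x. c * \<phi> x) \<psi> x = c * conv A \<phi> \<psi> x"
  "conv A \<phi> (\<lambda>x. c * \<psi> x) x = c * conv A \<phi> \<psi> x"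
  by (simp_all add: conv_def case_prod_unfold ring_distribs sum_list_addf mult_ac
        flip: sum_list_const_mult)

text \<open>Stated for an arbitrary representative \<open>s\<close> of the comultiplication of
  \<open>z\<close>, so that an adapted one can be inserted, in which all left factors but the first
  lie in \<open>C\<close>.\<close>

lemma ract_mult:
  assumes z: "z \<in> carrier A" and a: "a \<in> carrier A" and \<psi>: "linear_form A \<psi>"
    and s: "set s \<subseteq> carrier A \<times> carrier A" "tensor_eq A (comult A z) s"
  shows "ract A \<psi> (z \<otimes> a) = list_sum A [u \<otimes> ract A (\<lambda>y. \<psi> (v \<otimes> y)) a. (u, v) \<leftarrow> s]"
proof (rule forms_eqI)
  show "list_sum A [u \<otimes> ract A (\<lambda>y. \<psi> (v \<otimes> y)) a. (u, v) \<leftarrow> s] \<in> carrier A"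
    using s a by (intro list_sum_closed) auto
  fix \<chi> assume \<chi>: "linear_form A \<chi>"
  let ?g = "\<lambda>u v. conv A (\<lambda>y. \<chi> (u \<otimes> y)) (\<lambda>y. \<psi> (v \<otimes> y)) a"
  have b: "bilinear_form A (\<lambda>x y. \<chi> x * \<psi> y)" using bilinear_prod \<chi> \<psi> .
  have g: "bilinear_form A ?g"
    unfolding bilinear_form_def linear_form_def
  proof (intro conjI ballI allI)
    fix x y z c assume "x \<in> carrier A" "y \<in> carrier A" "z \<in> carrier A"
    thus "?g x (y \<oplus> z) = ?g x y + ?g x z" "?g (y \<oplus> z) x = ?g y x + ?g z x"
      using a \<chi> \<psi> by (auto simp: l_distr fsimps simp flip: conv_linear intro!: conv_cong)
  next
    fix x y c assume xy: "x \<in> carrier A" "y \<in> carrier A"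
    have "?g x (c \<odot> y) = conv A (\<lambda>z. \<chi> (x \<otimes> z)) (\<lambda>z. c * \<psi> (y \<otimes> z)) a"
      "?g (c \<odot> y) x = conv A (\<lambda>z. c * \<chi> (y \<otimes> z)) (\<lambda>z. \<psi> (x \<otimes> z)) a"
      by (rule conv_cong; use xy a \<chi> \<psi> in \<open>simp add: fsimps\<close>)+
    thus "?g x (c \<odot> y) = c * ?g x y" "?g (c \<odot> y) x = c * ?g y x"
      by (simp_all only: conv_linear)
  qed
  have "\<chi> (ract A \<psi> (z \<otimes> a)) = (\<Sum>(u, v)\<leftarrow>comult A z. ?g u v)"
    using \<chi> z a by (simp add: form_ract conv_def comult_bilinear(3)[OF b])
  also have "\<dots> = (\<Sum>(u, v)\<leftarrow>s. ?g u v)" using s(2) g by (simp add: tensor_eq_def)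
  also have "\<dots> = (\<Sum>(u, v)\<leftarrow>s. \<chi> (u \<otimes> ract A (\<lambda>y. \<psi> (v \<otimes> y)) a))"
    using s(1) a \<chi> by (intro arg_cong[of _ _ sum_list] map_cong)
      (auto simp: form_ract[OF form_mult(2)])
  also have "\<dots> = \<chi> (list_sum A [u \<otimes> ract A (\<lambda>y. \<psi> (v \<otimes> y)) a. (u, v) \<leftarrow> s])"
    using s(1) a by (subst form_list_sum[OF \<chi>]) (auto simp: o_def case_prod_unfold)
  finally show "\<chi> (ract A \<psi> (z \<otimes> a)) = \<chi> (list_sum A [u \<otimes> ract A (\<lambda>y. \<psi> (v \<otimes> y)) a. (u, v) \<leftarrow> s])" .
qed (use z a in auto)

text \<open>Augmentation forms lower the filtration degree without leaving \<open>I\<close>, and a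
  nonzero element that all of them kill is a nonzero scalar.\<close>

lemma one_in_stable:
  assumes con: "conilpotent A" and I: "stable_subspace A I" and c: "c \<in> I" "c \<noteq> \<zero>"
  shows "\<one> \<in> I"
proof -
  have Is: "lin_subspace A I" using I by (simp add: stable_subspace_def)
  have "c \<in> I \<Longrightarrow> c \<noteq> \<zero> \<Longrightarrow> c \<in> filt A n \<Longrightarrow> \<one> \<in> I" for n
  proof (induction n arbitrary: c)
    case (Suc n)
    show ?case
    proof (cases "\<forall>\<psi>. aug_form A \<psi> \<longrightarrow> ract A \<psi> c = \<zero>")
      case True
      hence c: "c = counit A c \<odot> \<one>" using Suc.prems by (intro invariant_scalar) auto
      hence "counit A c \<noteq> 0" using Suc.prems by auto
      thus ?thesis using subspace_smult_cancel[OF Is, of "counit A c" \<one>] c Suc.prems by simp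
    next
      case False
      then obtain \<psi> where "aug_form A \<psi>" "ract A \<psi> c \<noteq> \<zero>" by blast
      moreover have "ract A \<psi> c \<in> I" "ract A \<psi> c \<in> filt A n"
        using Suc.prems I \<open>aug_form A \<psi>\<close> by (auto simp: stable_subspace_def aug_formD)
      ultimately show ?thesis using Suc.IH by blast
    qed
  qed auto
  moreover have "c \<in> carrier A" using lin_subspaceD(1)[OF Is c(1)] .
  then obtain n where "c \<in> filt A n" using con by (auto simp: conilpotent_def)
  ultimately show ?thesis using c by blast
qed

text \<open>This is \<open>tensor_left_subspace\<close> for \<Delta>(x) - x \<otimes> 1, whose
  contraction by \<psi> is the action on \<open>x\<close> of the augmentation part of
  \<psi>.\<close>

lemma tensor_rep:
  assumes C: "lin_subspace A C" and x: "x \<in> carrier A" "\<And>\<psi>. aug_form A \<psi> \<Longrightarrow> ract A \<psi> x \<in> C"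
  shows "\<exists>t. set t \<subseteq> C \<times> carrier A \<and> tensor_eq A (comult A x) ((x, \<one>) # t)"
proof -
  let ?r = "((-1) \<odot> x, \<one>) # comult A x"
  have r: "set ?r \<subseteq> carrier A \<times> carrier A" using x comult_closed[of x] by auto
  have "ctr A \<psi> ?r \<in> C" if \<psi>: "linear_form A \<psi>" for \<psi>
  proof -
    let ?\<psi> = "\<lambda>x. \<psi> x - \<psi> \<one> * counit A x"
    have e: "ctr A \<psi> ?r = \<psi> \<one> \<odot> ((-1) \<odot> x) \<oplus> ract A \<psi> x" by (simp add: ract_def)
    have "ctr A \<psi> ?r = ract A ?\<psi> x" unfolding e ract_aug_part[OF \<psi> x(1)]
      using x(1) by (intro forms_eqI) (auto simp: fsimps)
    thus ?thesis using x(2)[OF aug_part[OF \<psi>]] by simp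
  qed
  then obtain t where t: "set t \<subseteq> C \<times> carrier A" "tensor_eq A ?r t"
    using tensor_left_subspace[OF C r] by blast
  have "tensor_eq A (comult A x) ((x, \<one>) # t)"
    unfolding tensor_eq_def
  proof (intro allI impI)
    fix \<beta> assume b: "bilinear_form A \<beta>"
    have "(\<Sum>(x, y)\<leftarrow>?r. \<beta> x y) = (\<Sum>(x, y)\<leftarrow>t. \<beta> x y)" using t(2) b by (simp only: tensor_eq_def)
    thus "(\<Sum>(x, y)\<leftarrow>comult A x. \<beta> x y) = (\<Sum>(x, y)\<leftarrow>(x, \<one>) # t. \<beta> x y)"
      using x(1) by (simp add: bilinear_simps[OF b] algebra_simps)
  qed
  thus ?thesis using t(1) by blast
qed

end

text \<open>The list \<open>t\<close> represents \<Delta>(x) - x \<otimes> 1 as an element of C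
  \<otimes> A, which expresses that \<open>x\<close> is invariant modulo \<open>C\<close>. Fixing it
  makes the effect of multiplication by \<open>x\<close> on contractions explicit.\<close>

locale generic_ext = hopf_algebra A for A :: "('k::field, 'a) hopf" (structure) +
  fixes C x t
  assumes subalg: "subalg A C" and stable: "stable_subspace A C" and x: "x \<in> carrier A"
    and t: "set t \<subseteq> C \<times> carrier A" "tensor_eq A (comult A x) ((x, \<one>) # t)"
begin

lemma subalgD: "lin_subspace A C" "\<one> \<in> C" "y \<in> C \<Longrightarrow> z \<in> C \<Longrightarrow> y \<otimes> z \<in> C" "y \<in> C \<Longrightarrow> y \<in> carrier A"
  using subalg lin_subspaceD(1)[of A C] by (auto simp: subalg_def)

lemmas Cs = lin_subspaceD[OF subalgD(1)]

lemma ract_x_mem: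
  assumes \<psi>: "aug_form A \<psi>"
  shows "ract A \<psi> x \<in> C"
proof -
  have tc: "set t \<subseteq> carrier A \<times> carrier A" using t(1) subalgD(4) by auto
  have "ract A \<psi> x = ctr A \<psi> ((x, \<one>) # t)"
    unfolding ract_def using t(2) tc x by (intro ctr_cong aug_formD(1)[OF \<psi>] comult_closed) auto
  also have "\<dots> = ctr A \<psi> t" using \<psi> x tc by (simp add: aug_formD ctr_closed)
  also have "\<dots> \<in> C" unfolding ctr_def using t(1) Cs(4) by (intro list_sum_subspace[OF subalgD(1)]) auto
  finally show ?thesis .
qed

lemma stableD: "linear_form A \<psi> \<Longrightarrow> y \<in> C \<Longrightarrow> ract A \<psi> y \<in> C"
  using stable by (auto simp: stable_subspace_def)

section \<open>Polynomials in x over C and the action of forms on them\<close>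

abbreviation P where "P \<equiv> polys A C x"

lemma xpow [simp]: "x [^] (n::nat) \<in> carrier A"
  using x by simp

lemma P_subspace: "lin_subspace A (P n)"
proof (induction n)
  case 0 show ?case using subspace_zero by simp
next
  case (Suc n)
  note Pc = lin_subspaceD[OF Suc]
  show ?case unfolding lin_subspace_def
  proof (intro conjI ballI allI)
    show "P (Suc n) \<subseteq> carrier A" using Pc(1) subalgD(4) by (auto elim!: polys_SucE)
    have "\<zero> = \<zero> \<oplus> \<zero> \<otimes> x [^] n" by simp
    thus "\<zero> \<in> P (Suc n)" using polys_SucI[OF Pc(2) Cs(2)] by simp
  next
    fix y z assume "y \<in> P (Suc n)" "z \<in> P (Suc n)"
    then obtain a b c d where *: "a \<in> P n" "b \<in> P n" "c \<in> C" "d \<in> C"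
      "y = a \<oplus> c \<otimes> x [^] n" "z = b \<oplus> d \<otimes> x [^] n" by (auto elim!: polys_SucE)
    have "y \<oplus> z = (a \<oplus> b) \<oplus> (c \<oplus> d) \<otimes> x [^] n"
      using * Pc(1) subalgD(4) by (simp add: l_distr M.a_ac)
    thus "y \<oplus> z \<in> P (Suc n)" using * Pc(3) Cs(3) by (auto intro: polys_SucI)
  next
    fix r y assume "y \<in> P (Suc n)"
    then obtain a c where *: "a \<in> P n" "c \<in> C" "y = a \<oplus> c \<otimes> x [^] n" by (auto elim!: polys_SucE)
    have "r \<odot> y = r \<odot> a \<oplus> (r \<odot> c) \<otimes> x [^] n"
      using * Pc(1) subalgD(4) by (simp add: smult_simps)
    thus "r \<odot> y \<in> P (Suc n)" using * Pc(4) Cs(4) by (auto intro: polys_SucI)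
  qed
qed

lemmas Ps = lin_subspaceD[OF P_subspace]

lemma P_Suc: "y \<in> P n \<Longrightarrow> y \<in> P (Suc n)"
proof -
  assume y: "y \<in> P n"
  hence "y = y \<oplus> \<zero> \<otimes> x [^] n" using Ps(1) by simp
  thus ?thesis using polys_SucI[OF y Cs(2)] by simp
qed

lemma P_mono: "m \<le> n \<Longrightarrow> P m \<subseteq> P n"
  by (induction rule: dec_induct) (use P_Suc in blast)+

lemma P_monom: "c \<in> C \<Longrightarrow> c \<otimes> x [^] n \<in> P (Suc n)"
proof -
  assume c: "c \<in> C"
  have "\<zero> \<oplus> c \<otimes> x [^] n \<in> P (Suc n)" using polys_SucI[OF Ps(2) c] .
  thus ?thesis using subalgD(4)[OF c] by simp
qed

lemma P_one: "P (Suc 0) = C"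
proof (intro equalityI subsetI)
  show "y \<in> C" if "y \<in> P (Suc 0)" for y using that subalgD(4) by (auto elim!: polys_SucE)
  show "y \<in> P (Suc 0)" if "y \<in> C" for y using P_monom[OF that, of 0] subalgD(4)[OF that] by simp
qed

lemma C_sub_P: "C \<subseteq> P (Suc n)"
  using P_mono[of "Suc 0" "Suc n"] P_one by simp

lemma P_C_mult: "c \<in> C \<Longrightarrow> y \<in> P n \<Longrightarrow> c \<otimes> y \<in> P n"
proof (induction n arbitrary: y)
  case (Suc n)
  then obtain a d where *: "a \<in> P n" "d \<in> C" "y = a \<oplus> d \<otimes> x [^] n" by (auto elim!: polys_SucE)
  have "c \<otimes> y = c \<otimes> a \<oplus> (c \<otimes> d) \<otimes> x [^] n"
    using * Suc.prems subalgD(4) Ps(1) by (simp add: r_distr m_assoc)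
  thus ?case using * Suc subalgD(3) by (auto intro: polys_SucI)
qed (use subalgD in auto)

lemma P_x_mult: "y \<in> P n \<Longrightarrow> x \<otimes> y \<in> P (Suc n)"
proof (induction n arbitrary: y)
  case (Suc n)
  then obtain a d where *: "a \<in> P n" "d \<in> C" "y = a \<oplus> d \<otimes> x [^] n" by (auto elim!: polys_SucE)
  have "x \<otimes> y = x \<otimes> a \<oplus> d \<otimes> x [^] Suc n"
    using * subalgD(4) Ps(1) x by (simp add: r_distr m_ac)
  thus ?case using polys_SucI[OF Suc.IH[OF *(1)] *(2)] by simp
qed (use x P_Suc Ps(2) in simp)

lemma P_mult: "y \<in> P m \<Longrightarrow> z \<in> P n \<Longrightarrow> y \<otimes> z \<in> P (m + n)"
proof (induction m arbitrary: y)
  case 0 thus ?case using Ps by simp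
next
  case (Suc m)
  then obtain a d where *: "a \<in> P m" "d \<in> C" "y = a \<oplus> d \<otimes> x [^] m" by (auto elim!: polys_SucE)
  have "x [^] m \<otimes> z \<in> P (m + n)" for m :: nat
  proof (induction m)
    case (Suc m)
    have "x [^] Suc m \<otimes> z = x \<otimes> (x [^] m \<otimes> z)" using x Ps(1)[OF \<open>z \<in> P n\<close>] by (simp add: m_ac)
    thus ?case using P_x_mult[OF Suc] by simp
  qed (use Suc.prems Ps(1) in auto)
  hence "d \<otimes> (x [^] m \<otimes> z) \<in> P (m + n)" using * P_C_mult by blast
  moreover have "y \<otimes> z = a \<otimes> z \<oplus> d \<otimes> (x [^] m \<otimes> z)"
    using * subalgD(4) Ps(1)[OF *(1)] Ps(1)[OF Suc.prems(2)] by (simp add: l_distr m_assoc)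
  ultimately have "y \<otimes> z \<in> P (m + n)" using Suc.IH[OF *(1) Suc.prems(2)] Ps(3) by simp
  thus ?case using P_Suc by simp
qed

text \<open>The error made by treating \<open>x\<close> as invariant:
  \<open>ract A \<psi> (x \<otimes> a)\<close> is \<open>x \<otimes> ract A \<psi> a\<close> plus
  this term, which comes from the tail \<open>t\<close>.\<close>

definition Y where "Y \<psi> a = list_sum A [u \<otimes> ract A (\<lambda>y. \<psi> (v \<otimes> y)) a. (u, v) \<leftarrow> t]"

lemma tc: "set t \<subseteq> carrier A \<times> carrier A"
  using t(1) subalgD(4) by auto

lemma tD: "(u, v) \<in> set t \<Longrightarrow> u \<in> C \<and> u \<in> carrier A \<and> v \<in> carrier A"
  using t(1) subalgD(4) by auto

lemma Y_closed [simp]: "a \<in> carrier A \<Longrightarrow> Y \<psi> a \<in> carrier A"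
  unfolding Y_def using tD by (intro list_sum_closed) auto

lemma ract_x_mult:
  assumes "linear_form A \<psi>" "a \<in> carrier A"
  shows "ract A \<psi> (x \<otimes> a) = x \<otimes> ract A \<psi> a \<oplus> Y \<psi> a"
proof -
  have "ract A (\<lambda>y. \<psi> (\<one> \<otimes> y)) a = ract A \<psi> a" using assms(2) by (intro ract_cong) auto
  thus ?thesis using ract_mult[OF x assms(2,1) _ t(2)] x tc by (simp add: Y_def)
qed

lemma Y_mem:
  assumes "linear_form A \<psi>" "stable_subspace A S" "\<And>c y. c \<in> C \<Longrightarrow> y \<in> S \<Longrightarrow> c \<otimes> y \<in> S" "a \<in> S"
  shows "Y \<psi> a \<in> S"
proof -
  have "u \<otimes> ract A (\<lambda>y. \<psi> (v \<otimes> y)) a \<in> S" if "(u, v) \<in> set t" for u v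
  proof -
    have "linear_form A (\<lambda>y. \<psi> (v \<otimes> y))" using form_mult(2) assms(1) tD[OF that] by auto
    thus ?thesis using assms tD[OF that] by (auto simp: stable_subspace_def)
  qed
  thus ?thesis unfolding Y_def using assms(2)
    by (intro list_sum_subspace) (auto simp: stable_subspace_def)
qed

lemma subspace_coset:
  assumes "lin_subspace A U" "y \<ominus> z \<in> U" "y' \<ominus> z' \<in> U" "y \<in> carrier A" "z \<in> carrier A" "y' \<in> carrier A" "z' \<in> carrier A"
  shows "(y \<oplus> y') \<ominus> (z \<oplus> z') \<in> U"
proof -
  have "(y \<oplus> y') \<ominus> (z \<oplus> z') = (y \<ominus> z) \<oplus> (y' \<ominus> z')"
    using assms by (intro forms_eqI) (auto simp: fsimps)
  thus ?thesis using lin_subspaceD(3)[OF assms(1)] assms by simp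
qed

text \<open>Modulo lower degree a form acts on the leading coefficient alone. The two claims need a
  common induction: leading terms of degree \<open>n\<close> give the stability of
  \<open>P (Suc n)\<close>, and that stability bounds the term \<open>Y\<close> one degree
  higher.\<close>

lemma P_stable_lead:
  "stable_subspace A (P n)"
  "c \<in> C \<Longrightarrow> linear_form A \<psi> \<Longrightarrow> ract A \<psi> (c \<otimes> x [^] n) \<ominus> ract A \<psi> c \<otimes> x [^] n \<in> P n"
proof (induction n arbitrary: c \<psi>)
  case 0
  case 1 show ?case using subspace_zero by (auto simp: stable_subspace_def ract_linear)
  case 2 thus ?case using subalgD(4)[of c] by (simp add: a_minus_def M.r_neg)
next
  case (Suc n)
  have st: "stable_subspace A (P (Suc n))"
    unfolding stable_subspace_def
  proof (intro conjI P_subspace allI ballI impI)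
    fix \<psi> y assume \<psi>: "linear_form A \<psi>" and "y \<in> P (Suc n)"
    then obtain a d where *: "a \<in> P n" "d \<in> C" "y = a \<oplus> d \<otimes> x [^] n" by (auto elim!: polys_SucE)
    have ac: "a \<in> carrier A" "d \<in> carrier A" using * Ps(1) subalgD(4) by auto
    define w where "w = ract A \<psi> (d \<otimes> x [^] n) \<ominus> ract A \<psi> d \<otimes> x [^] n"
    have w: "w \<in> P n" unfolding w_def using Suc.IH(2) * \<psi> by blast
    have "ract A \<psi> y = (ract A \<psi> a \<oplus> w) \<oplus> ract A \<psi> d \<otimes> x [^] n"
      unfolding *(3) w_def using \<psi> ac
      by (intro forms_eqI) (auto simp: ract_linear fsimps)
    moreover have "ract A \<psi> a \<oplus> w \<in> P n"
      using w Suc.IH(1) *(1) \<psi> Ps(3) by (auto simp: stable_subspace_def)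
    ultimately show "ract A \<psi> y \<in> P (Suc n)" using stableD[OF \<psi> *(2)] by (auto intro: polys_SucI)
  qed
  case 1 show ?case by (rule st)
  case 2
  have cc: "c \<in> carrier A" using 2 subalgD(4) by auto
  define w where "w = ract A \<psi> (c \<otimes> x [^] n) \<ominus> ract A \<psi> c \<otimes> x [^] n"
  have w: "w \<in> P n" unfolding w_def using Suc.IH(2) 2 by blast
  have wc: "w \<in> carrier A" using w Ps(1) by blast
  have w': "ract A \<psi> (c \<otimes> x [^] n) = w \<oplus> ract A \<psi> c \<otimes> x [^] n"
    unfolding w_def using cc by (intro forms_eqI) (auto simp: fsimps)
  have Yc: "Y \<psi> (c \<otimes> x [^] n) \<in> P (Suc n)"
    using Y_mem[OF 2(2) st P_C_mult P_monom[OF 2(1)]] .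
  have "c \<otimes> x [^] Suc n = x \<otimes> (c \<otimes> x [^] n)" using cc x by (simp add: m_ac)
  hence "ract A \<psi> (c \<otimes> x [^] Suc n) = x \<otimes> (w \<oplus> ract A \<psi> c \<otimes> x [^] n) \<oplus> Y \<psi> (c \<otimes> x [^] n)"
    using ract_x_mult[OF 2(2), of "c \<otimes> x [^] n"] cc w' by simp
  also have "x \<otimes> (w \<oplus> ract A \<psi> c \<otimes> x [^] n) = x \<otimes> w \<oplus> ract A \<psi> c \<otimes> x [^] Suc n"
    using x wc cc by (simp add: r_distr m_ac)
  finally have "ract A \<psi> (c \<otimes> x [^] Suc n) \<ominus> ract A \<psi> c \<otimes> x [^] Suc n = x \<otimes> w \<oplus> Y \<psi> (c \<otimes> x [^] n)"
    using x wc cc by (simp del: nat_pow_Suc) (intro forms_eqI; auto simp: fsimps)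
  thus ?case using P_x_mult[OF w] Yc Ps(3) by simp
qed

lemma ract_P: "linear_form A \<psi> \<Longrightarrow> y \<in> P n \<Longrightarrow> ract A \<psi> y \<in> P n"
  using P_stable_lead(1) by (auto simp: stable_subspace_def)

lemma ract_monom_exp:
  assumes "c \<in> C" "linear_form A \<psi>"
  shows "\<exists>w\<in>P n. ract A \<psi> (c \<otimes> x [^] n) = w \<oplus> ract A \<psi> c \<otimes> x [^] n"
proof
  show "ract A \<psi> (c \<otimes> x [^] n) \<ominus> ract A \<psi> c \<otimes> x [^] n \<in> P n" using P_stable_lead(2) assms .
  show "ract A \<psi> (c \<otimes> x [^] n) = ract A \<psi> (c \<otimes> x [^] n) \<ominus> ract A \<psi> c \<otimes> x [^] n \<oplus> ract A \<psi> c \<otimes> x [^] n"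
    using subalgD(4)[OF assms(1)] by (intro forms_eqI) (auto simp: fsimps)
qed

lemma Y_one: "aug_form A \<psi> \<Longrightarrow> Y \<psi> \<one> = ract A \<psi> x"
  using ract_x_mult[of \<psi> \<one>] x by (simp add: ract_linear aug_formD)

text \<open>Summand by summand this is \<open>P_stable_lead\<close> with leading coefficient
  1.\<close>

lemma Y_pow:
  assumes \<psi>: "linear_form A \<psi>"
  shows "Y \<psi> (x [^] n) \<ominus> Y \<psi> \<one> \<otimes> x [^] (n::nat) \<in> P n"
proof -
  have "set s \<subseteq> set t \<Longrightarrow> list_sum A [u \<otimes> ract A (\<lambda>y. \<psi> (v \<otimes> y)) (x [^] n). (u, v) \<leftarrow> s] \<ominus>
     list_sum A [u \<otimes> ract A (\<lambda>y. \<psi> (v \<otimes> y)) \<one>. (u, v) \<leftarrow> s] \<otimes> x [^] n \<in> P n" for s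
  proof (induction s)
    case Nil thus ?case using Ps(2) by (simp add: a_minus_def)
  next
    case (Cons p s)
    obtain u v where p: "p = (u, v)" by force
    have uv: "u \<in> C" "u \<in> carrier A" "v \<in> carrier A" using tD[of u v] Cons.prems p by auto
    have f: "linear_form A (\<lambda>y. \<psi> (v \<otimes> y))" using form_mult(2) \<psi> uv by auto
    let ?a = "ract A (\<lambda>y. \<psi> (v \<otimes> y)) (x [^] n)" and ?b = "ract A (\<lambda>y. \<psi> (v \<otimes> y)) \<one>"
    let ?S = "list_sum A [u \<otimes> ract A (\<lambda>y. \<psi> (v \<otimes> y)) (x [^] n). (u, v) \<leftarrow> s]"
    let ?R = "list_sum A [u \<otimes> ract A (\<lambda>y. \<psi> (v \<otimes> y)) \<one>. (u, v) \<leftarrow> s]"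
    have SR: "?S \<in> carrier A" "?R \<in> carrier A"
      using Cons.prems tD by (force intro!: list_sum_closed)+
    have "?a \<ominus> ?b \<otimes> x [^] n \<in> P n" using P_stable_lead(2)[OF subalgD(2) f, of n] by simp
    hence "u \<otimes> (?a \<ominus> ?b \<otimes> x [^] n) \<in> P n" using uv P_C_mult by blast
    moreover have "u \<otimes> (?a \<ominus> ?b \<otimes> x [^] n) = u \<otimes> ?a \<ominus> (u \<otimes> ?b) \<otimes> x [^] n"
      using uv by (simp add: a_minus_def r_distr r_minus m_assoc)
    ultimately have "(u \<otimes> ?a \<oplus> ?S) \<ominus> ((u \<otimes> ?b) \<otimes> x [^] n \<oplus> ?R \<otimes> x [^] n) \<in> P n"
      using Cons SR uv by (intro subspace_coset[OF P_subspace]) auto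
    thus ?case using p uv SR by (simp add: l_distr)
  qed
  thus ?thesis unfolding Y_def by blast
qed

text \<open>To top order an augmentation form acts as a derivation: every further factor
  \<open>x\<close> contributes, through \<open>Y\<close>, one more copy of
  \<open>ract A \<psi> x\<close>. The resulting factor n + 1 is the reason why small integers have
  to be invertible.\<close>

lemma ract_pow:
  assumes \<psi>: "aug_form A \<psi>"
  shows "ract A \<psi> (x [^] Suc n) \<ominus> of_nat (Suc n) \<odot> (ract A \<psi> x \<otimes> x [^] n) \<in> P n"
proof (induction n)
  case 0
  show ?case using x by (simp add: a_minus_def M.r_neg)
next
  case (Suc n)
  have \<psi>': "linear_form A \<psi>" using \<psi> by (simp add: aug_formD)
  let ?r = "ract A \<psi> (x [^] Suc n)" and ?q = "ract A \<psi> x"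
  define w where "w = ?r \<ominus> of_nat (Suc n) \<odot> (?q \<otimes> x [^] n)"
  define v where "v = Y \<psi> (x [^] Suc n) \<ominus> ?q \<otimes> x [^] Suc n"
  have w: "w \<in> P n" "w \<in> carrier A" using Suc Ps(1) by (auto simp: w_def)
  have v: "v \<in> P (Suc n)" "v \<in> carrier A"
    using Y_pow[OF \<psi>', of "Suc n"] Y_one[OF \<psi>] Ps(1) unfolding v_def by auto
  have w': "?r = w \<oplus> of_nat (Suc n) \<odot> (?q \<otimes> x [^] n)"
    unfolding w_def using x by (intro forms_eqI) (auto simp: fsimps)
  have v': "Y \<psi> (x [^] Suc n) = v \<oplus> ?q \<otimes> x [^] Suc n"
    unfolding v_def using x by (intro forms_eqI) (auto simp: fsimps)
  have "x [^] Suc (Suc n) = x \<otimes> x [^] Suc n" using x by (simp add: m_ac)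
  hence "ract A \<psi> (x [^] Suc (Suc n)) = x \<otimes> ?r \<oplus> Y \<psi> (x [^] Suc n)"
    using ract_x_mult[OF \<psi>'] x by simp
  also have "\<dots> = x \<otimes> (w \<oplus> of_nat (Suc n) \<odot> (?q \<otimes> x [^] n)) \<oplus> (v \<oplus> ?q \<otimes> x [^] Suc n)"
    by (simp only: w' v')
  also have "x \<otimes> (w \<oplus> of_nat (Suc n) \<odot> (?q \<otimes> x [^] n)) = x \<otimes> w \<oplus> of_nat (Suc n) \<odot> (?q \<otimes> x [^] Suc n)"
    using x w by (simp add: r_distr m_ac)
  finally have "ract A \<psi> (x [^] Suc (Suc n)) \<ominus> of_nat (Suc (Suc n)) \<odot> (?q \<otimes> x [^] Suc n) = x \<otimes> w \<oplus> v"
    using x w v by (simp del: nat_pow_Suc) (intro forms_eqI; auto simp: fsimps algebra_simps)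
  thus ?case using P_x_mult[OF w(1)] v Ps(3) by simp
qed

text \<open>The coefficient of \<open>x [^] m\<close> collects the derivative of \<open>d\<close>
  and, from the term one degree higher, m + 1 times the derivative of \<gamma> x. Together they are
  the derivative of one element of C + k x, to which invariance arguments apply.\<close>

lemma ract_second_coeff:
  assumes \<psi>: "aug_form A \<psi>" and y: "y \<in> P m" and d: "d \<in> C"
  shows "\<exists>w\<in>P m. ract A \<psi> (y \<oplus> d \<otimes> x [^] m \<oplus> \<gamma> \<odot> x [^] Suc m) =
     w \<oplus> ract A \<psi> (d \<oplus> (\<gamma> * of_nat (Suc m)) \<odot> x) \<otimes> x [^] m"
proof -
  have \<psi>': "linear_form A \<psi>" using \<psi> by (simp add: aug_formD)
  obtain w1 where w1: "w1 \<in> P m" "ract A \<psi> (d \<otimes> x [^] m) = w1 \<oplus> ract A \<psi> d \<otimes> x [^] m"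
    using ract_monom_exp[OF d \<psi>'] by blast
  let ?q = "ract A \<psi> x"
  define w2 where "w2 = ract A \<psi> (x [^] Suc m) \<ominus> of_nat (Suc m) \<odot> (?q \<otimes> x [^] m)"
  have w2: "w2 \<in> P m" using ract_pow[OF \<psi>] by (simp only: w2_def)
  have w2': "ract A \<psi> (x [^] Suc m) = w2 \<oplus> of_nat (Suc m) \<odot> (?q \<otimes> x [^] m)"
    unfolding w2_def using x by (intro forms_eqI) (auto simp: fsimps)
  have c: "y \<in> carrier A" "d \<in> carrier A" "w1 \<in> carrier A" "w2 \<in> carrier A"
    using y d w1 w2 Ps(1) subalgD(4) by auto
  have "ract A \<psi> (y \<oplus> d \<otimes> x [^] m \<oplus> \<gamma> \<odot> x [^] Suc m) =
     ract A \<psi> y \<oplus> (w1 \<oplus> ract A \<psi> d \<otimes> x [^] m) \<oplus> \<gamma> \<odot> (w2 \<oplus> of_nat (Suc m) \<odot> (?q \<otimes> x [^] m))"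
    unfolding w2'[symmetric] w1(2)[symmetric] using c x \<psi>' by (simp add: ract_linear del: nat_pow_Suc)
  also have "\<dots> = (ract A \<psi> y \<oplus> w1 \<oplus> \<gamma> \<odot> w2) \<oplus> ract A \<psi> (d \<oplus> (\<gamma> * of_nat (Suc m)) \<odot> x) \<otimes> x [^] m"
    using c x \<psi>' by (intro forms_eqI) (auto simp: ract_linear l_distr fsimps algebra_simps)
  finally have e: "ract A \<psi> (y \<oplus> d \<otimes> x [^] m \<oplus> \<gamma> \<odot> x [^] Suc m) = \<dots>" .
  have "ract A \<psi> y \<oplus> w1 \<oplus> \<gamma> \<odot> w2 \<in> P m" using ract_P[OF \<psi>' y] w1(1) w2 Ps(3,4) by simp
  thus ?thesis using e by (rule bexI[rotated])
qed

end

section \<open>Linear independence of the powers of x\<close>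

locale proper_ext = generic_ext A C x t for A :: "('k::field, 'a) hopf" (structure) and C x t +
  assumes con: "conilpotent A" and xC: "x \<notin> C"
begin

text \<open>An invariant element is a scalar, so for nonzero \<gamma> the element \<open>x\<close>
  could be solved for inside \<open>C\<close>.\<close>

lemma invariant_coeff:
  assumes d: "d \<in> C" and inv: "\<And>\<psi>. aug_form A \<psi> \<Longrightarrow> ract A \<psi> (d \<oplus> \<gamma> \<odot> x) = \<zero>"
  shows "\<gamma> = 0"
proof (rule ccontr)
  assume "\<gamma> \<noteq> 0"
  have dc: "d \<in> carrier A" using d subalgD(4) by blast
  have "d \<oplus> \<gamma> \<odot> x = counit A (d \<oplus> \<gamma> \<odot> x) \<odot> \<one>" using dc x inv by (intro invariant_scalar) auto
  hence "\<gamma> \<odot> x \<oplus> d \<in> C" using Cs(4)[OF subalgD(2)] dc x by (metis M.a_comm smult_closed')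
  hence "\<gamma> \<odot> x \<in> C" using subspace_add_cancel[OF subalgD(1) d, of "\<gamma> \<odot> x"] x by simp
  thus False using subspace_smult_cancel[OF subalgD(1), of \<gamma> x] \<open>\<gamma> \<noteq> 0\<close> x xC by simp
qed

text \<open>The coefficients \<open>c\<close> for which \<open>c \<otimes> x [^] n\<close> has lower
  degree form a subcomodule. If it were nonzero, it would contain 1 and give a monic relation.
  Comparing coefficients one degree below the top then makes d - n x invariant for some
  \<open>d\<close> in \<open>C\<close>, which contradicts \<open>invariant_coeff\<close>.\<close>

lemma free:
  assumes "\<And>i. 0 < i \<Longrightarrow> i \<le> n \<Longrightarrow> of_nat i \<noteq> (0 :: 'k)" "y \<in> P n" "c \<in> C" "y \<oplus> c \<otimes> x [^] n \<in> P n"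
  shows "c = \<zero>"
  using assms
proof (induction n arbitrary: y c rule: less_induct)
  case (less n)
  define I where "I = {c \<in> C. c \<otimes> x [^] n \<in> P n}"
  have "stable_subspace A I"
    unfolding stable_subspace_def lin_subspace_def
  proof (intro conjI ballI allI impI)
    show "I \<subseteq> carrier A" using subalgD(4) by (auto simp: I_def)
    show "\<zero> \<in> I" using Cs(2) Ps(2) by (simp add: I_def)
    show "a \<oplus> b \<in> I" if "a \<in> I" "b \<in> I" for a b
      using that Cs(3) Ps(3) subalgD(4) by (auto simp: I_def l_distr)
    show "r \<odot> a \<in> I" if "a \<in> I" for r a
      using that Cs(4) Ps(4) subalgD(4) by (auto simp: I_def)
    show "ract A \<psi> a \<in> I" if a: "a \<in> I" and \<psi>: "linear_form A \<psi>" for \<psi> a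
    proof -
      obtain w where w: "w \<in> P n" "ract A \<psi> (a \<otimes> x [^] n) = w \<oplus> ract A \<psi> a \<otimes> x [^] n"
        using ract_monom_exp[of a \<psi>] a \<psi> by (auto simp: I_def)
      have ac: "a \<in> carrier A" using a subalgD(4) by (auto simp: I_def)
      have "ract A \<psi> a \<otimes> x [^] n \<oplus> w \<in> P n"
        using w ract_P[OF \<psi>, of "a \<otimes> x [^] n" n] a ac Ps(1) by (simp add: I_def M.a_comm)
      hence "ract A \<psi> a \<otimes> x [^] n \<in> P n"
          by (rule subspace_add_cancel[OF P_subspace w(1), rotated]) (use ac in simp)
      thus ?thesis using stableD[OF \<psi>] a by (auto simp: I_def)
    qed
  qed
  moreover have "c \<in> I"
  proof -
    have "c \<otimes> x [^] n \<oplus> y \<in> P n" using less.prems subalgD(4) Ps(1) by (simp add: M.a_comm)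
    hence "c \<otimes> x [^] n \<in> P n" using subspace_add_cancel[OF P_subspace less.prems(2)] subalgD(4)[OF less.prems(3)] by simp
    thus ?thesis using less.prems by (simp add: I_def)
  qed
  moreover have "\<one> \<notin> I"
  proof
    assume "\<one> \<in> I"
    hence xn: "x [^] n \<in> P n" by (simp add: I_def)
    show False
    proof (cases n)
      case 0 thus False using xn one_neq_zero by simp
    next
      case (Suc m)
      then obtain z d where z: "z \<in> P m" "d \<in> C" "x [^] n = z \<oplus> d \<otimes> x [^] m"
        using xn by (auto elim!: polys_SucE)
      have zc: "z \<in> carrier A" "d \<in> carrier A" using z Ps(1) subalgD(4) by auto
      \<comment> \<open>The monic relation with \<gamma> = -1, in the shape that
        \<open>ract_second_coeff\<close> expects.\<close>
      have rel: "z \<oplus> d \<otimes> x [^] m \<oplus> (-1) \<odot> x [^] Suc m = \<zero>"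
        using zc x by (subst Suc[symmetric], subst z(3)) (intro forms_eqI; auto simp: fsimps)
      have "ract A \<psi> (d \<oplus> (-1 * of_nat (Suc m)) \<odot> x) = \<zero>" if \<psi>: "aug_form A \<psi>" for \<psi>
      proof -
        have \<psi>': "linear_form A \<psi>" using \<psi> by (simp add: aug_formD)
        obtain w where w: "w \<in> P m" "ract A \<psi> \<zero> = w \<oplus> ract A \<psi> (d \<oplus> (-1 * of_nat (Suc m)) \<odot> x) \<otimes> x [^] m"
          using ract_second_coeff[OF \<psi> z(1,2), of "-1"] rel by auto
        have "ract A \<psi> (d \<oplus> (-1 * of_nat (Suc m)) \<odot> x) \<in> C"
          using z(2) Cs(3,4) stableD[OF \<psi>'] ract_x_mem[OF \<psi>] zc x by (simp add: ract_linear[OF \<psi>'])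
        moreover have "w \<oplus> ract A \<psi> (d \<oplus> (-1 * of_nat (Suc m)) \<odot> x) \<otimes> x [^] m \<in> P m"
          using w(2) Ps(2) \<psi>' by (simp only: ract_linear[OF \<psi>'])
        moreover have "of_nat i \<noteq> (0 :: 'k)" if "0 < i" "i \<le> m" for i using less.prems(1) that Suc by simp
        ultimately show ?thesis using w(1) Suc by (intro less.IH[of m w]) simp_all
      qed
      hence "-1 * of_nat (Suc m) = (0 :: 'k)" using invariant_coeff[OF z(2)] by blast
      hence "of_nat (Suc m) = (0 :: 'k)" by (simp only: mult_minus1 neg_equal_0_iff_equal)
      thus False using less.prems(1)[of "Suc m"] Suc by (simp del: of_nat_Suc)
    qed
  qed
  ultimately show "c = \<zero>" using one_in_stable[OF con] by blast
qed

end

section \<open>Extension of points\<close>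

text \<open>A point of the stable subalgebra \<open>C = K + k\<close> is given by its kernel \<open>K\<close>: its value at \<open>y\<close> is the
  unique scalar \<open>c\<close> with \<open>y - c \<in> K\<close>.\<close>

definition partial_point :: "('k::field, 'a) hopf \<Rightarrow> 'a set \<Rightarrow> bool" where
  "partial_point A K \<longleftrightarrow> lin_subspace A K \<and> (\<forall>x\<in>K. \<forall>y\<in>K. x \<otimes>\<^bsub>A\<^esub> y \<in> K) \<and> \<one>\<^bsub>A\<^esub> \<notin> K \<and>
     stable_subspace A (lspan A K [\<one>\<^bsub>A\<^esub>])"

text \<open>Only primitive elements in the domain K + k are constrained: the value \<open>c\<close>
  that the partial point takes there has to be the prescribed one.\<close>

definition prim_compatible :: "('k::field, 'a) hopf \<Rightarrow> ('a \<Rightarrow> 'k) \<Rightarrow> 'a set \<Rightarrow> bool" where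
  "prim_compatible A \<mu> K \<longleftrightarrow> (\<forall>q\<in>prim A. \<forall>c. q \<ominus>\<^bsub>A\<^esub> c \<odot>\<^bsub>A\<^esub> \<one>\<^bsub>A\<^esub> \<in> K \<longrightarrow> c = \<mu> q)"

context proper_ext
begin

text \<open>The hypothesis of \<open>free\<close>. It holds for all \<open>n\<close> in
  characteristic zero and for n < p in characteristic \<open>p\<close>.\<close>

definition good :: "nat \<Rightarrow> bool" where
  "good n \<longleftrightarrow> (\<forall>i. 0 < i \<and> i \<le> n \<longrightarrow> of_nat i \<noteq> (0 :: 'k))"

lemma free': "good n \<Longrightarrow> y \<in> P n \<Longrightarrow> c \<in> C \<Longrightarrow> y \<oplus> c \<otimes> x [^] n \<in> P n \<Longrightarrow> c = \<zero>"
  using free[of n y c] by (auto simp: good_def)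

text \<open>In positive degree m the leading coefficient of \<open>q\<close> is invariant, hence a
  scalar \<gamma>. For m \<ge> 2 the next coefficient yields m \<gamma> = 0, so the degree drops
  until it is at most 1.\<close>

lemma linear_of_invariant_derivatives:
  assumes "q \<in> P n" "good (n - 1)" "\<And>\<psi>. aug_form A \<psi> \<Longrightarrow> \<exists>r. ract A \<psi> q = r \<odot> \<one>"
  shows "\<exists>d\<in>C. \<exists>\<gamma>. q = d \<oplus> \<gamma> \<odot> x"
  using assms
proof (induction n arbitrary: q)
  case 0
  have "q = \<zero> \<oplus> 0 \<odot> x" using 0 x by simp
  thus ?case using Cs(2) by blast
next
  case (Suc m)
  show ?case
  proof (cases m)
    case 0
    hence "q \<in> C" using Suc.prems(1) P_one by simp
    moreover from this have "q = q \<oplus> 0 \<odot> x" using x subalgD(4) by simp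
    ultimately show ?thesis by blast
  next
    case (Suc k)
    have gm: "good m" using Suc.prems by simp
    obtain y c where y: "y \<in> P m" "c \<in> C" "q = y \<oplus> c \<otimes> x [^] m"
      using Suc.prems(1) by (auto elim!: polys_SucE)
    have cc: "c \<in> carrier A" "y \<in> carrier A" using y subalgD(4) Ps(1) by auto
    have scal: "r \<odot> \<one> \<in> P (Suc j)" for r j using C_sub_P[of j] Cs(4)[OF subalgD(2)] by blast
    have "ract A \<psi> c = \<zero>" if \<psi>: "aug_form A \<psi>" for \<psi>
    proof -
      have \<psi>': "linear_form A \<psi>" using \<psi> by (simp add: aug_formD)
      obtain w where w: "w \<in> P m" "ract A \<psi> (c \<otimes> x [^] m) = w \<oplus> ract A \<psi> c \<otimes> x [^] m"
        using ract_monom_exp[OF y(2) \<psi>'] by blast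
      obtain r where "ract A \<psi> q = r \<odot> \<one>" using Suc.prems(3)[OF \<psi>] by blast
      hence "(ract A \<psi> y \<oplus> w) \<oplus> ract A \<psi> c \<otimes> x [^] m = r \<odot> \<one>"
        unfolding y(3) using w cc Ps(1)[OF w(1)] by (simp add: ract_linear[OF \<psi>'] M.a_assoc)
      hence "(ract A \<psi> y \<oplus> w) \<oplus> ract A \<psi> c \<otimes> x [^] m \<in> P m" using scal Suc by simp
      moreover have "ract A \<psi> y \<oplus> w \<in> P m" using ract_P[OF \<psi>' y(1)] w(1) Ps(3) by blast
      ultimately show ?thesis using free'[OF gm] stableD[OF \<psi>' y(2)] by blast
    qed
    hence ce: "c = counit A c \<odot> \<one>" using cc by (intro invariant_scalar) auto
    define \<gamma> where "\<gamma> = counit A c"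
    have q: "q = y \<oplus> \<gamma> \<odot> x [^] m" unfolding y(3) using cc by (subst ce) (simp add: \<gamma>_def)
    show ?thesis
    proof (cases k)
      case 0
      hence "y \<in> C" using y(1) Suc P_one by simp
      thus ?thesis using q Suc 0 x by auto
    next
      case (Suc j)
      obtain z d where z: "z \<in> P k" "d \<in> C" "y = z \<oplus> d \<otimes> x [^] k"
        using y(1) \<open>m = Suc k\<close> by (auto elim!: polys_SucE)
      have gk: "good k" using gm \<open>m = Suc k\<close> by (auto simp: good_def)
      have "ract A \<psi> (d \<oplus> (\<gamma> * of_nat (Suc k)) \<odot> x) = \<zero>" if \<psi>: "aug_form A \<psi>" for \<psi>
      proof -
        have \<psi>': "linear_form A \<psi>" using \<psi> by (simp add: aug_formD)
        let ?e = "ract A \<psi> (d \<oplus> (\<gamma> * of_nat (Suc k)) \<odot> x)"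
        obtain w where w: "w \<in> P k" "ract A \<psi> q = w \<oplus> ?e \<otimes> x [^] k"
          using ract_second_coeff[OF \<psi> z(1,2), of \<gamma>] unfolding q z(3) \<open>m = Suc k\<close> by auto
        obtain r where "ract A \<psi> q = r \<odot> \<one>" using Suc.prems(3)[OF \<psi>] by blast
        \<comment> \<open>Since k \<ge> 1, the scalar on the right has degree below \<open>k\<close>
          and does not interfere with the coefficient of \<open>x [^] k\<close>.\<close>
        hence "w \<oplus> ?e \<otimes> x [^] k \<in> P k" using scal w \<open>k = Suc j\<close> by simp
        moreover have "?e \<in> C"
          using z(2) Cs(3,4) stableD[OF \<psi>'] ract_x_mem[OF \<psi>] subalgD(4) x by (simp add: ract_linear[OF \<psi>'])
        ultimately show ?thesis using free'[OF gk w(1)] by blast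
      qed
      hence "\<gamma> * of_nat (Suc k) = 0" using invariant_coeff[OF z(2)] by blast
      moreover have "of_nat (Suc k) \<noteq> (0 :: 'k)" using gm \<open>m = Suc k\<close> unfolding good_def by blast
      ultimately have "\<gamma> = 0" by (simp del: of_nat_Suc)
      hence "q = y" using q cc x by simp
      moreover have "good (m - 1)" using gk \<open>m = Suc k\<close> by simp
      ultimately show ?thesis using Suc.IH[of q] y(1) Suc.prems(3) by blast
    qed
  qed
qed

end

section \<open>The algebra C[x] and the point that vanishes at x\<close>

locale char_ext = proper_ext A C x t for A :: "('k::field, 'a) hopf" (structure) and C x t +
  assumes char: "CHAR('k) = 0 \<or> Factorial_Ring.prime CHAR('k) \<and> frob_fixed A"
begin

definition D where "D = (\<Union>n. P n)"

lemma D_subspace: "lin_subspace A D"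
  unfolding lin_subspace_def
proof (intro conjI ballI allI)
  show "D \<subseteq> carrier A" using Ps(1) by (auto simp: D_def)
  show "\<zero> \<in> D" using Ps(2) by (auto simp: D_def)
  show "c \<odot> y \<in> D" if "y \<in> D" for c y using Ps(4) that by (auto simp: D_def)
  show "y \<oplus> z \<in> D" if yz: "y \<in> D" "z \<in> D" for y z
  proof -
    obtain m n where "y \<in> P m" "z \<in> P n" using yz by (auto simp: D_def)
    hence "y \<in> P (max m n)" "z \<in> P (max m n)"
      using P_mono[of m "max m n"] P_mono[of n "max m n"] by auto
    thus ?thesis using Ps(3) by (auto simp: D_def)
  qed
qed

lemmas Ds = lin_subspaceD[OF D_subspace]

lemma D_mult: "y \<in> D \<Longrightarrow> z \<in> D \<Longrightarrow> y \<otimes> z \<in> D"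
  using P_mult unfolding D_def by blast

lemma C_sub_D: "C \<subseteq> D"
  using P_one by (auto simp: D_def)

lemma x_in_D: "x \<in> D"
proof -
  have "\<one> \<otimes> x [^] Suc 0 \<in> P (Suc (Suc 0))" by (rule P_monom[OF subalgD(2)])
  thus ?thesis using x by (auto simp: D_def)
qed

lemma D_stable: "stable_subspace A D"
  using D_subspace ract_P by (auto simp: stable_subspace_def D_def)

lemma P_decomp: "y \<in> P n \<Longrightarrow> \<exists>c\<in>C. \<exists>d\<in>D. y = c \<oplus> x \<otimes> d"
proof (induction n arbitrary: y)
  case 0
  hence "y = \<zero> \<oplus> x \<otimes> \<zero>" using x by simp
  thus ?case using Cs(2) Ds(2) by blast
next
  case (Suc n)
  then obtain z a where z: "z \<in> P n" "a \<in> C" "y = z \<oplus> a \<otimes> x [^] n" by (auto elim!: polys_SucE)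
  obtain c d where cd: "c \<in> C" "d \<in> D" "z = c \<oplus> x \<otimes> d" using Suc.IH[OF z(1)] by blast
  have ac: "a \<in> carrier A" "c \<in> carrier A" "d \<in> carrier A" using z cd subalgD(4) Ds(1) by auto
  show ?case
  proof (cases n)
    case 0
    hence "y = (c \<oplus> a) \<oplus> x \<otimes> d" unfolding z(3) cd(3) using ac x by (simp add: M.a_ac)
    thus ?thesis using Cs(3) cd z by blast
  next
    case (Suc k)
    have "y = c \<oplus> x \<otimes> (d \<oplus> a \<otimes> x [^] k)" unfolding z(3) cd(3) Suc using ac x
      by (simp add: M.a_ac r_distr m_ac)
    moreover have "d \<oplus> a \<otimes> x [^] k \<in> D" using cd(2) P_monom[OF z(2), of k] Ds(3) by (auto simp: D_def)
    ultimately show ?thesis using cd(1) by blast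
  qed
qed

text \<open>In characteristic \<open>p\<close> the relation \<open>x\<^sup>p = x\<close> removes the degrees at which freeness fails.\<close>

lemma x_mult_good:
  assumes "d \<in> D"
  shows "\<exists>m. \<exists>y\<in>P m. good m \<and> x \<otimes> d = x \<otimes> y"
proof (cases "CHAR('k) = 0")
  case True
  obtain n where "d \<in> P n" using assms by (auto simp: D_def)
  moreover have "good n" using True by (auto simp: good_def of_nat_eq_0_iff_char_dvd)
  ultimately show ?thesis by blast
next
  case False
  define p where "p = CHAR('k)"
  have p: "Factorial_Ring.prime p" "x [^] p = x" using char False x by (auto simp: p_def frob_fixed_def)
  have p2: "p \<ge> 2" using p by (simp add: prime_ge_2_nat)
  \<comment> \<open>The terms of these products have degrees 1 to p - 1, the range where freeness is
    available. The factor \<open>x\<close> is kept so that the reduction by \<open>x^p = x\<close>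
    never reaches degree 0, where the value at x = 0 is read off.\<close>
  define Q where "Q = {x \<otimes> y | y. y \<in> P (p - 1)}"
  have monom: "x \<otimes> (a \<otimes> x [^] n) \<in> Q" if a: "a \<in> C" for a and n :: nat
  proof (induction n rule: less_induct)
    case (less n)
    have ac: "a \<in> carrier A" using a subalgD(4) by blast
    show ?case
    proof (cases "n < p - 1")
      case True
      hence "a \<otimes> x [^] n \<in> P (p - 1)" using P_monom[OF a, of n] P_mono[of "Suc n" "p - 1"] by auto
      thus ?thesis by (auto simp: Q_def)
    next
      case False
      \<comment> \<open>Replacing \<open>x^p\<close> by \<open>x\<close> lowers the exponent by p -
        1.\<close>
      have "p + (n - (p - 1)) = Suc n" using False p2 by simp
      hence "x \<otimes> (a \<otimes> x [^] n) = a \<otimes> x [^] (p + (n - (p - 1)))"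
        using ac x by (simp add: m_ac)
      also have "\<dots> = a \<otimes> (x [^] p \<otimes> x [^] (n - (p - 1)))" using x by (simp add: nat_pow_mult)
      also have "\<dots> = x \<otimes> (a \<otimes> x [^] (n - (p - 1)))" using ac x by (simp add: p(2) m_ac)
      also have "\<dots> \<in> Q" using less.IH False p2 by simp
      finally show ?thesis .
    qed
  qed
  have "x \<otimes> y \<in> Q" if "y \<in> P n" for y n
    using that
  proof (induction n arbitrary: y)
    case 0 thus ?case using Ps(2)[of "p - 1"] by (auto simp: Q_def)
  next
    case (Suc n)
    then obtain z a where z: "z \<in> P n" "a \<in> C" "y = z \<oplus> a \<otimes> x [^] n" by (auto elim!: polys_SucE)
    obtain u v where uv: "u \<in> P (p - 1)" "x \<otimes> z = x \<otimes> u" "v \<in> P (p - 1)" "x \<otimes> (a \<otimes> x [^] n) = x \<otimes> v"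
      using Suc.IH[OF z(1)] monom[OF z(2), of n] by (auto simp: Q_def)
    have "x \<otimes> y = x \<otimes> (u \<oplus> v)"
      unfolding z(3) using z uv x Ps(1) subalgD(4) by (simp add: r_distr)
    thus ?case using uv Ps(3) by (auto simp: Q_def)
  qed
  hence "x \<otimes> d \<in> Q" using assms by (auto simp: D_def)
  moreover have "good (p - 1)" using p2
    by (auto simp: good_def of_nat_eq_0_iff_char_dvd p_def dest: dvd_imp_le)
  ultimately show ?thesis by (auto simp: Q_def)
qed

text \<open>Freeness removes the coefficients of x y from the top down. This makes the constant term
  of a polynomial in \<open>x\<close> well defined, so that one may set x = 0.\<close>

lemma const_coeff_zero: "c \<in> C \<Longrightarrow> y \<in> P m \<Longrightarrow> good m \<Longrightarrow> c \<oplus> x \<otimes> y = \<zero> \<Longrightarrow> c = \<zero>"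
proof (induction m arbitrary: y)
  case 0 thus ?case using x subalgD(4) by simp
next
  case (Suc m)
  then obtain z a where z: "z \<in> P m" "a \<in> C" "y = z \<oplus> a \<otimes> x [^] m" by (auto elim!: polys_SucE)
  have ac: "a \<in> carrier A" "c \<in> carrier A" "z \<in> carrier A" using z Suc.prems subalgD(4) Ps(1) by auto
  have e: "c \<oplus> x \<otimes> y = (c \<oplus> x \<otimes> z) \<oplus> a \<otimes> x [^] Suc m"
    unfolding z(3) using ac x by (simp add: r_distr m_ac M.a_ac)
  have "c \<oplus> x \<otimes> z \<in> P (Suc m)" using P_x_mult[OF z(1)] C_sub_P Suc.prems(1) Ps(3) by blast
  moreover have "(c \<oplus> x \<otimes> z) \<oplus> a \<otimes> x [^] Suc m \<in> P (Suc m)" using e Suc.prems(4) Ps(2) by simp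
  ultimately have "a = \<zero>" using free'[OF Suc.prems(3)] z(2) by blast
  hence "y = z" using z ac by simp
  thus ?case using Suc z by (auto simp: good_def)
qed

text \<open>Augmentation forms send a primitive element to scalars, so
  \<open>linear_of_invariant_derivatives\<close> applies once the degree has been brought into the
  range of freeness.\<close>

lemma prim_in_D:
  assumes "q \<in> prim A" "q \<in> D"
  shows "\<exists>d\<in>C. \<exists>\<gamma>. q = d \<oplus> \<gamma> \<odot> x"
proof -
  obtain n where "q \<in> P n" using assms by (auto simp: D_def)
  then obtain c d where cd: "c \<in> C" "d \<in> D" "q = c \<oplus> x \<otimes> d" using P_decomp by blast
  obtain m y where y: "y \<in> P m" "good m" "x \<otimes> d = x \<otimes> y" using x_mult_good[OF cd(2)] by blast
  have "q \<in> P (Suc m)" using cd(1,3) y(3) P_x_mult[OF y(1)] C_sub_P[of m] Ps(3)[of c "Suc m" "x \<otimes> y"] by auto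
  moreover have "\<exists>r. ract A \<psi> q = r \<odot> \<one>" if "aug_form A \<psi>" for \<psi>
    using assms(1) that by (auto simp: prim_def aug_formD)
  ultimately show ?thesis using linear_of_invariant_derivatives[of q "Suc m"] y by simp
qed

text \<open>The kernel of the extension of the point of \<open>C\<close> to \<open>D = C[x]\<close> that vanishes at \<open>x\<close>.\<close>

definition ext_ker :: "'a set \<Rightarrow> 'a set" where
  "ext_ker K = {k \<oplus> x \<otimes> d | k d. k \<in> K \<and> d \<in> D}"

lemma ext_ker_partial:
  assumes K: "partial_point A K" and CK: "C = lspan A K [\<one>]"
  shows "partial_point A (ext_ker K)" "K \<subseteq> ext_ker K" "x \<in> ext_ker K" "lspan A (ext_ker K) [\<one>] = D"
proof -
  have Ksub: "lin_subspace A K" and Kmult: "\<And>y z. y \<in> K \<Longrightarrow> z \<in> K \<Longrightarrow> y \<otimes> z \<in> K" and K1: "\<one> \<notin> K"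
    using K by (auto simp: partial_point_def)
  note Kc = lin_subspaceD[OF Ksub]
  have KC: "K \<subseteq> C" unfolding CK by (rule lspan_base[OF Ksub]) simp
  have extI: "k \<oplus> x \<otimes> d \<in> ext_ker K" if "k \<in> K" "d \<in> D" for k d using that by (auto simp: ext_ker_def)
  show KK: "K \<subseteq> ext_ker K"
  proof
    fix k assume "k \<in> K"
    thus "k \<in> ext_ker K" using extI[of k \<zero>] Ds(2) Kc(1) x by simp
  qed
  show "x \<in> ext_ker K" using extI[of \<zero> \<one>] Kc(2) subalgD(2) C_sub_D x by auto
  have sub: "lin_subspace A (ext_ker K)"
    unfolding lin_subspace_def
  proof (intro conjI ballI allI)
    show "ext_ker K \<subseteq> carrier A" using Kc(1) Ds(1) x by (auto simp: ext_ker_def)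
    show "\<zero> \<in> ext_ker K" using KK Kc(2) by blast
  next
    fix y z assume "y \<in> ext_ker K" "z \<in> ext_ker K"
    then obtain k d l e where *: "k \<in> K" "d \<in> D" "l \<in> K" "e \<in> D" "y = k \<oplus> x \<otimes> d" "z = l \<oplus> x \<otimes> e"
      by (auto simp: ext_ker_def)
    have "y \<oplus> z = (k \<oplus> l) \<oplus> x \<otimes> (d \<oplus> e)" using * Kc(1) Ds(1) x by (simp add: r_distr M.a_ac)
    thus "y \<oplus> z \<in> ext_ker K" using * Kc(3) Ds(3) extI by simp
  next
    fix c y assume "y \<in> ext_ker K"
    then obtain k d where *: "k \<in> K" "d \<in> D" "y = k \<oplus> x \<otimes> d" by (auto simp: ext_ker_def)
    have "c \<odot> y = c \<odot> k \<oplus> x \<otimes> (c \<odot> d)" using * Kc(1) Ds(1) x by (simp add: smult_simps)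
    thus "c \<odot> y \<in> ext_ker K" using * Kc(4) Ds(4) extI by simp
  qed
  have mult: "y \<otimes> z \<in> ext_ker K" if "y \<in> ext_ker K" "z \<in> ext_ker K" for y z
  proof -
    from that obtain k d l e where *: "k \<in> K" "d \<in> D" "l \<in> K" "e \<in> D" "y = k \<oplus> x \<otimes> d" "z = l \<oplus> x \<otimes> e"
      by (auto simp: ext_ker_def)
    have "y \<otimes> z = k \<otimes> l \<oplus> x \<otimes> ((k \<otimes> e \<oplus> l \<otimes> d) \<oplus> x \<otimes> (d \<otimes> e))"
      using * Kc(1) Ds(1) x by (simp add: r_distr l_distr m_ac M.a_ac)
    moreover have "(k \<otimes> e \<oplus> l \<otimes> d) \<oplus> x \<otimes> (d \<otimes> e) \<in> D"
      by (intro Ds(3) D_mult x_in_D *(2,4) subsetD[OF C_sub_D] subsetD[OF KC] *(1,3))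
    ultimately show ?thesis using * Kmult extI by simp
  qed
  have one: "\<one> \<notin> ext_ker K"
  proof
    assume "\<one> \<in> ext_ker K"
    then obtain k d where *: "k \<in> K" "d \<in> D" "\<one> = k \<oplus> x \<otimes> d" by (auto simp: ext_ker_def)
    obtain m y where y: "y \<in> P m" "good m" "x \<otimes> d = x \<otimes> y" using x_mult_good[OF *(2)] by blast
    have c: "k \<in> carrier A" "y \<in> carrier A" using * Kc(1) y Ps(1) by auto
    \<comment> \<open>The constant term k - 1 of this relation has to vanish, so 1 would already lie
      in \<open>K\<close>.\<close>
    have "(k \<oplus> (-1) \<odot> \<one>) \<oplus> x \<otimes> y = (k \<oplus> x \<otimes> y) \<oplus> (-1) \<odot> \<one>"
      using c x by (simp add: M.a_ac)
    also have "\<dots> = \<one> \<oplus> (-1) \<odot> \<one>" using *(3) y(3) by simp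
    also have "\<dots> = \<zero>" using M.r_neg[OF one_closed] by (simp add: minus_conv)
    finally have e: "(k \<oplus> (-1) \<odot> \<one>) \<oplus> x \<otimes> y = \<zero>" .
    have "k \<oplus> (-1) \<odot> \<one> \<in> C" by (intro Cs(3) Cs(4) subalgD(2) subsetD[OF KC] *(1))
    hence "k \<oplus> (-1) \<odot> \<one> = \<zero>" using const_coeff_zero[OF _ y(1,2) e] by blast
    hence "k = \<one>" using c by (metis M.minus_equality M.minus_minus minus_conv one_closed M.a_comm smult_closed')
    thus False using * K1 by simp
  qed
  show D: "lspan A (ext_ker K) [\<one>] = D"
  proof (intro equalityI subsetI)
    fix y assume "y \<in> lspan A (ext_ker K) [\<one>]"
    then obtain k d c where *: "k \<in> K" "d \<in> D" "y = k \<oplus> x \<otimes> d \<oplus> c \<odot> \<one>" by (auto simp: ext_ker_def)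
    show "y \<in> D" unfolding *(3)
      by (intro Ds(3) Ds(4) D_mult x_in_D *(2) subsetD[OF C_sub_D] subsetD[OF KC] *(1) subalgD(2))
  next
    fix y assume "y \<in> D"
    then obtain c d where cd: "c \<in> C" "d \<in> D" "y = c \<oplus> x \<otimes> d" using P_decomp unfolding D_def by blast
    then obtain k r where k: "k \<in> K" "c = k \<oplus> r \<odot> \<one>" by (auto simp: CK)
    have "y = (k \<oplus> x \<otimes> d) \<oplus> r \<odot> \<one>" unfolding cd(3) k(2) using k cd Kc(1) Ds(1) x by (simp add: M.a_ac)
    thus "y \<in> lspan A (ext_ker K) [\<one>]" using extI[OF k(1) cd(2)] by auto
  qed
  show "partial_point A (ext_ker K)"
    unfolding partial_point_def using sub mult one D D_stable by simp
qed

text \<open>A primitive element of \<open>D\<close> is d + \<gamma> x with \<open>d\<close> in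
  \<open>C\<close>. If it is not in \<open>C\<close>, then x = x0 - \<mu>(x0) with \<open>x0\<close>
  primitive: vanishing at \<open>x\<close> gives the prescribed value at \<open>x0\<close>, and
  subtracting \<gamma> x0 leaves a primitive element of \<open>C\<close>.\<close>

lemma ext_ker_compatible:
  assumes K: "partial_point A K" and CK: "C = lspan A K [\<one>]" and comp: "prim_compatible A \<mu> K"
    and l: "linear_form A \<mu>"
    and xp: "prim A \<subseteq> C \<or> (\<exists>x0\<in>prim A. x = x0 \<ominus> \<mu> x0 \<odot> \<one>)"
  shows "prim_compatible A \<mu> (ext_ker K)"
  unfolding prim_compatible_def
proof (intro ballI allI impI)
  fix q c assume q: "q \<in> prim A" "q \<ominus> c \<odot> \<one> \<in> ext_ker K"
  note E = ext_ker_partial[OF K CK]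
  have Es: "lin_subspace A (ext_ker K)" and E1: "\<one> \<notin> ext_ker K" using E(1) by (auto simp: partial_point_def)
  note Ec = lin_subspaceD[OF Es]
  have primC: "p \<ominus> \<mu> p \<odot> \<one> \<in> K" if p: "p \<in> prim A" "p \<in> C" for p
  proof -
    from p(2) obtain k r where k: "k \<in> K" "p = k \<oplus> r \<odot> \<one>" by (auto simp: CK)
    have kc: "k \<in> carrier A" using k K by (auto simp: partial_point_def lin_subspace_def)
    have "p \<ominus> r \<odot> \<one> = k" unfolding k(2) using kc by (simp add: a_minus_def M.a_assoc M.r_neg)
    thus ?thesis using comp p(1) k(1) by (auto simp: prim_compatible_def)
  qed
  note prims = lin_subspaceD[OF prim_subspace]
  have qc: "q \<in> carrier A" using q prims(1) by blast
  have "q \<ominus> \<mu> q \<odot> \<one> \<in> ext_ker K"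
  proof (cases "q \<in> C")
    case True thus ?thesis using primC q E(2) by blast
  next
    case False
    with xp q obtain x0 where x0: "x0 \<in> prim A" "x = x0 \<ominus> \<mu> x0 \<odot> \<one>" by blast
    have x0c: "x0 \<in> carrier A" using x0 prims(1) by blast
    have "q = (q \<ominus> c \<odot> \<one>) \<oplus> c \<odot> \<one>" using qc by (intro forms_eqI) (auto simp: fsimps)
    hence "q \<in> D" using E(4) q(2) by auto
    then obtain d \<gamma> where d: "d \<in> C" "q = d \<oplus> \<gamma> \<odot> x" using prim_in_D[OF q(1)] by blast
    have dc: "d \<in> carrier A" using d subalgD(4) by blast
    define p where "p = q \<oplus> (-\<gamma>) \<odot> x0"
    have pp: "p \<in> prim A" unfolding p_def by (intro prims(3) prims(4) q(1) x0(1))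
    have "p = d \<oplus> (- \<gamma> * \<mu> x0) \<odot> \<one>" unfolding p_def d(2) x0(2) using dc x0c
      by (intro forms_eqI) (auto simp: fsimps algebra_simps)
    hence "p \<in> C" using d(1) Cs(3,4) subalgD(2) by simp
    hence "p \<ominus> \<mu> p \<odot> \<one> \<in> ext_ker K" using primC[OF pp] E(2) by blast
    hence "(p \<ominus> \<mu> p \<odot> \<one>) \<oplus> \<gamma> \<odot> x \<in> ext_ker K" by (intro Ec(3) Ec(4) E(3))
    moreover have "(p \<ominus> \<mu> p \<odot> \<one>) \<oplus> \<gamma> \<odot> x = q \<ominus> \<mu> q \<odot> \<one>"
      unfolding p_def x0(2) using qc x0c l by (intro forms_eqI) (auto simp: fsimps algebra_simps)
    ultimately show ?thesis by simp
  qed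
  hence "(q \<ominus> \<mu> q \<odot> \<one>) \<ominus> (q \<ominus> c \<odot> \<one>) \<in> ext_ker K" using q(2) subspace_diff[OF Es] by blast
  moreover have "(q \<ominus> \<mu> q \<odot> \<one>) \<ominus> (q \<ominus> c \<odot> \<one>) = (c - \<mu> q) \<odot> \<one>"
    using qc by (intro forms_eqI) (auto simp: fsimps algebra_simps)
  ultimately have "(c - \<mu> q) \<odot> \<one> \<in> ext_ker K" by simp
  thus "c = \<mu> q" using subspace_smult_cancel[OF Es, of "c - \<mu> q" \<one>] E1 by auto
qed

end

section \<open>Maximal partial points\<close>

context hopf_algebra
begin

lemma partial_point_subalg:
  assumes "partial_point A K"
  shows "subalg A (lspan A K [\<one>])"
proof -
  have K: "lin_subspace A K" and Kmult: "\<And>y z. y \<in> K \<Longrightarrow> z \<in> K \<Longrightarrow> y \<otimes> z \<in> K"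
    using assms by (auto simp: partial_point_def)
  note Kc = lin_subspaceD[OF K]
  have "y \<otimes> z \<in> lspan A K [\<one>]" if "y \<in> lspan A K [\<one>]" "z \<in> lspan A K [\<one>]" for y z
  proof -
    from that obtain k c l d where *: "k \<in> K" "l \<in> K" "y = k \<oplus> c \<odot> \<one>" "z = l \<oplus> d \<odot> \<one>" by auto
    have "y \<otimes> z = (k \<otimes> l \<oplus> d \<odot> k \<oplus> c \<odot> l) \<oplus> (c * d) \<odot> \<one>"
      unfolding * using *(1,2) Kc(1)
      by (intro forms_eqI) (auto simp: l_distr r_distr fsimps algebra_simps)
    moreover have "k \<otimes> l \<oplus> d \<odot> k \<oplus> c \<odot> l \<in> K" by (intro Kmult Kc(3) Kc(4) *(1,2))
    ultimately show ?thesis by auto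
  qed
  moreover have "\<one> \<in> lspan A K [\<one>]" using lspan_mem[OF K, of "[\<one>]"] by simp
  ultimately show ?thesis using lspan_subspace[OF K, of "[\<one>]"] by (simp add: subalg_def del: lspan.simps)
qed

text \<open>Any element outside \<open>C\<close> in the first filtration step that is not contained
  in \<open>C\<close> works, because augmentation forms carry it into the previous step.\<close>

lemma stable_extension_element:
  assumes con: "conilpotent A" and C: "lin_subspace A C" "C \<noteq> carrier A"
  shows "\<exists>x\<in>carrier A - C. \<forall>\<psi>. aug_form A \<psi> \<longrightarrow> ract A \<psi> x \<in> C"
proof -
  have "\<exists>n. \<not> filt A n \<subseteq> C" using con C lin_subspaceD(1)[OF C(1)] by (fastforce simp: conilpotent_def)
  define n where "n = (LEAST n. \<not> filt A n \<subseteq> C)"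
  have n: "\<not> filt A n \<subseteq> C" unfolding n_def by (rule LeastI_ex) fact
  moreover have "n \<noteq> 0" using n lin_subspaceD(2)[OF C(1)] by (cases n) auto
  ultimately obtain m where m: "n = Suc m" by (cases n) auto
  have "filt A m \<subseteq> C" using not_less_Least[of m "\<lambda>n. \<not> filt A n \<subseteq> C"] m by (simp add: n_def)
  moreover obtain x where "x \<in> filt A (Suc m)" "x \<notin> C" using n m by blast
  ultimately show ?thesis by auto
qed

text \<open>Zorn's lemma yields a maximal partial point; if its domain were proper, one could adjoin a further
  element on which the augmentation forms act with values in the domain.\<close>

lemma extend_point:
  assumes con: "conilpotent A" and char: "CHAR('k) = 0 \<or> Factorial_Ring.prime CHAR('k) \<and> frob_fixed A"
    and K0: "partial_point A K0" "prim_compatible A \<mu> K0" and l: "linear_form A \<mu>"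
  shows "\<exists>g\<in>points A. (\<forall>y\<in>K0. g y = 0) \<and> (\<forall>q\<in>prim A. g q = \<mu> q)"
proof -
  define S where "S = {K. partial_point A K \<and> prim_compatible A \<mu> K \<and> K0 \<subseteq> K}"
  have "\<exists>M\<in>S. \<forall>K\<in>S. M \<subseteq> K \<longrightarrow> K = M"
  proof (rule subset_Zorn_nonempty)
    show "S \<noteq> {}" using K0 by (auto simp: S_def)
    fix \<C> assume ch: "\<C> \<noteq> {}" "subset.chain S \<C>"
    have mem: "partial_point A K" "prim_compatible A \<mu> K" "K0 \<subseteq> K" if "K \<in> \<C>" for K
      using ch that by (auto simp: subset.chain_def S_def)
    have pp: "lin_subspace A K" "\<And>y z. y \<in> K \<Longrightarrow> z \<in> K \<Longrightarrow> y \<otimes> z \<in> K" "\<one> \<notin> K"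
      "stable_subspace A (lspan A K [\<one>])" if "K \<in> \<C>" for K
      using mem(1)[OF that] by (auto simp: partial_point_def)
    have two: "\<exists>K\<in>\<C>. a \<in> K \<and> b \<in> K" if ab: "a \<in> \<Union>\<C>" "b \<in> \<Union>\<C>" for a b
    proof -
      from ab obtain K L where KL: "K \<in> \<C>" "L \<in> \<C>" "a \<in> K" "b \<in> L" by auto
      with ch(2) have "K \<subseteq> L \<or> L \<subseteq> K" by (auto simp: subset.chain_def)
      with KL show ?thesis by blast
    qed
    obtain K1 where K1: "K1 \<in> \<C>" using ch(1) by auto
    have sub: "lin_subspace A (\<Union>\<C>)"
      unfolding lin_subspace_def
    proof (intro conjI ballI allI)
      show "\<Union>\<C> \<subseteq> carrier A" using pp(1) by (intro Union_least) (auto simp: lin_subspace_def)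
      show "\<zero> \<in> \<Union>\<C>" using lin_subspaceD(2)[OF pp(1)[OF K1]] K1 by blast
      show "a \<oplus> b \<in> \<Union>\<C>" if ab: "a \<in> \<Union>\<C>" "b \<in> \<Union>\<C>" for a b
      proof -
        obtain K where K: "K \<in> \<C>" "a \<in> K" "b \<in> K" using two[OF ab] by blast
        thus ?thesis using lin_subspaceD(3)[OF pp(1)[OF K(1)]] by blast
      qed
      show "c \<odot> a \<in> \<Union>\<C>" if a: "a \<in> \<Union>\<C>" for c a
      proof -
        obtain K where K: "K \<in> \<C>" "a \<in> K" using a by blast
        thus ?thesis using lin_subspaceD(4)[OF pp(1)[OF K(1)]] by blast
      qed
    qed
    have "partial_point A (\<Union>\<C>)"
      unfolding partial_point_def
    proof (intro conjI ballI sub)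
      show "a \<otimes> b \<in> \<Union>\<C>" if ab: "a \<in> \<Union>\<C>" "b \<in> \<Union>\<C>" for a b
      proof -
        obtain K where K: "K \<in> \<C>" "a \<in> K" "b \<in> K" using two[OF ab] by blast
        thus ?thesis using pp(2)[OF K(1)] by blast
      qed
      show "\<one> \<notin> \<Union>\<C>" using pp(3) by blast
      have "ract A \<psi> y \<in> lspan A (\<Union>\<C>) [\<one>]" if \<psi>: "linear_form A \<psi>" and y: "y \<in> lspan A (\<Union>\<C>) [\<one>]" for \<psi> y
      proof -
        obtain k c where k: "k \<in> \<Union>\<C>" "y = k \<oplus> c \<odot> \<one>" using y by auto
        then obtain K where K: "K \<in> \<C>" "k \<in> K" by blast
        hence "y \<in> lspan A K [\<one>]" using k by auto
        hence "ract A \<psi> y \<in> lspan A K [\<one>]" using pp(4)[OF K(1)] \<psi> by (simp add: stable_subspace_def del: lspan.simps)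
        thus ?thesis using K(1) by auto
      qed
      thus "stable_subspace A (lspan A (\<Union>\<C>) [\<one>])"
        using lspan_subspace[OF sub, of "[\<one>]"] by (simp add: stable_subspace_def del: lspan.simps)
    qed
    moreover have "prim_compatible A \<mu> (\<Union>\<C>)" using mem(2) unfolding prim_compatible_def by blast
    moreover have "K0 \<subseteq> \<Union>\<C>" using mem(3)[OF K1] K1 by blast
    ultimately show "\<Union>\<C> \<in> S" by (simp add: S_def)
  qed
  then obtain K where K: "partial_point A K" "prim_compatible A \<mu> K" "K0 \<subseteq> K"
    and max: "\<And>L. partial_point A L \<Longrightarrow> prim_compatible A \<mu> L \<Longrightarrow> K \<subseteq> L \<Longrightarrow> L = K"
    by (auto simp: S_def)
  have Ks: "lin_subspace A K" and Kmult: "\<And>y z. y \<in> K \<Longrightarrow> z \<in> K \<Longrightarrow> y \<otimes> z \<in> K" and K1: "\<one> \<notin> K"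
    using K by (auto simp: partial_point_def)
  note Kc = lin_subspaceD[OF Ks]
  define C where "C = lspan A K [\<one>]"
  have Calg: "subalg A C" unfolding C_def using partial_point_subalg[OF K(1)] .
  have Csub: "lin_subspace A C" using Calg by (simp add: subalg_def)
  have Cst: "stable_subspace A C" using K(1) by (simp only: C_def partial_point_def)
  note Cc = lin_subspaceD[OF Csub]
  have C1: "\<one> \<in> C" using Calg by (simp add: subalg_def)
  have KC: "K \<subseteq> C" unfolding C_def by (rule lspan_base[OF Ks]) simp
  have "C = carrier A"
  proof (rule ccontr)
    assume "C \<noteq> carrier A"
    \<comment> \<open>A primitive element outside \<open>C\<close> has priority; it is shifted so
      that the value 0 at \<open>x\<close> is the prescribed one. Other elements are adjoined only
      when \<open>C\<close> contains all primitive elements, and then the value 0 is a free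
      choice.\<close>
    have "\<exists>x\<in>carrier A - C. (\<forall>\<psi>. aug_form A \<psi> \<longrightarrow> ract A \<psi> x \<in> C) \<and>
      (prim A \<subseteq> C \<or> (\<exists>x0\<in>prim A. x = x0 \<ominus> \<mu> x0 \<odot> \<one>))"
    proof (cases "prim A \<subseteq> C")
      case True
      thus ?thesis using stable_extension_element[OF con Csub \<open>C \<noteq> carrier A\<close>] by blast
    next
      case False
      then obtain x0 where x0: "x0 \<in> prim A" "x0 \<notin> C" by blast
      have x0c: "x0 \<in> carrier A" using x0 by (simp add: prim_def)
      let ?x = "x0 \<ominus> \<mu> x0 \<odot> \<one>"
      have "?x \<notin> C"
      proof
        assume "?x \<in> C"
        hence "?x \<oplus> \<mu> x0 \<odot> \<one> \<in> C" by (intro Cc(3) Cc(4) C1)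
        moreover have "?x \<oplus> \<mu> x0 \<odot> \<one> = x0" using x0c by (intro forms_eqI) (auto simp: fsimps)
        ultimately show False using x0 by simp
      qed
      moreover have "ract A \<psi> ?x \<in> C" if \<psi>: "aug_form A \<psi>" for \<psi>
      proof -
        have \<psi>': "linear_form A \<psi>" "\<psi> \<one> = 0" using \<psi> by (auto simp: aug_formD)
        have "ract A \<psi> x0 = \<psi> x0 \<odot> \<one>" using x0(1) \<psi>' x0c by (simp add: prim_def)
        hence "ract A \<psi> ?x = \<psi> x0 \<odot> \<one>" using x0c \<psi>'
          by (simp add: ract_diff ract_linear) (simp add: a_minus_def)
        thus ?thesis using Cc(4) C1 by simp
      qed
      ultimately show ?thesis using x0 x0c by (intro bexI[of _ ?x]) auto
    qed
    then obtain x where x: "x \<in> carrier A" "x \<notin> C" "\<And>\<psi>. aug_form A \<psi> \<Longrightarrow> ract A \<psi> x \<in> C"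
      and xp: "prim A \<subseteq> C \<or> (\<exists>x0\<in>prim A. x = x0 \<ominus> \<mu> x0 \<odot> \<one>)" by blast
    obtain t where t: "set t \<subseteq> C \<times> carrier A" "tensor_eq A (comult A x) ((x, \<one>) # t)"
      using tensor_rep[OF Csub x(1,3)] by blast
    interpret E: char_ext A C x t
      by unfold_locales (fact Calg Cst x(1) t con x(2) char)+
    have "E.ext_ker K = K"
      by (rule max) (use E.ext_ker_partial[OF K(1) C_def] E.ext_ker_compatible[OF K(1) C_def K(2) l xp] in blast)+
    thus False using E.ext_ker_partial(3)[OF K(1) C_def] KC x(2) by blast
  qed
  \<comment> \<open>The maximal domain K + k is everything, so \<open>K\<close> has codimension 1
    and the point is read off as the coefficient of 1.\<close>
  have dec: "\<exists>!c. y \<ominus> c \<odot> \<one> \<in> K" if y: "y \<in> carrier A" for y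
  proof -
    obtain k c where k: "k \<in> K" "y = k \<oplus> c \<odot> \<one>"
      using y unfolding \<open>C = carrier A\<close>[symmetric] C_def by auto
    have "y \<ominus> c \<odot> \<one> = k" unfolding k(2) using k Kc(1) by (intro forms_eqI) (auto simp: fsimps)
    moreover have "c = d" if cd: "y \<ominus> c \<odot> \<one> \<in> K" "y \<ominus> d \<odot> \<one> \<in> K" for c d
    proof (rule ccontr)
      assume "c \<noteq> d"
      have "(y \<ominus> c \<odot> \<one>) \<ominus> (y \<ominus> d \<odot> \<one>) = (d - c) \<odot> \<one>"
        using y by (intro forms_eqI) (auto simp: fsimps algebra_simps)
      hence "(d - c) \<odot> \<one> \<in> K" using subspace_diff[OF Ks cd] by simp
      thus False using subspace_smult_cancel[OF Ks, of "d - c" \<one>] \<open>c \<noteq> d\<close> K1 by simp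
    qed
    ultimately show ?thesis using k(1) by blast
  qed
  define g where "g = (\<lambda>y\<in>carrier A. THE c. y \<ominus> c \<odot> \<one> \<in> K)"
  have gK: "y \<ominus> g y \<odot> \<one> \<in> K" if "y \<in> carrier A" for y
    using theI'[OF dec[OF that]] that by (simp add: g_def)
  have gI: "g y = c" if "y \<in> carrier A" "y \<ominus> c \<odot> \<one> \<in> K" for y c
    using dec[OF that(1)] gK[OF that(1)] that(2) by blast
  have g_add: "g (y \<oplus> z) = g y + g z" and g_mult: "g (y \<otimes> z) = g y * g z"
    if yz: "y \<in> carrier A" "z \<in> carrier A" for y z
  proof -
    have "(y \<ominus> g y \<odot> \<one>) \<oplus> (z \<ominus> g z \<odot> \<one>) \<in> K" by (intro Kc(3) gK yz)
    moreover have "(y \<ominus> g y \<odot> \<one>) \<oplus> (z \<ominus> g z \<odot> \<one>) = (y \<oplus> z) \<ominus> (g y + g z) \<odot> \<one>"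
      using yz by (intro forms_eqI) (auto simp: fsimps algebra_simps)
    ultimately show "g (y \<oplus> z) = g y + g z" using yz by (intro gI) auto
    \<comment> \<open>\<open>K\<close> is known to be closed under products of its own elements, not
      to be an ideal. So y z - g(y) g(z) is expanded around the elements y - g(y) and z - g(z) of
      \<open>K\<close>.\<close>
    have "(y \<ominus> g y \<odot> \<one>) \<otimes> (z \<ominus> g z \<odot> \<one>) \<oplus> g y \<odot> (z \<ominus> g z \<odot> \<one>) \<oplus> g z \<odot> (y \<ominus> g y \<odot> \<one>) \<in> K"
      by (intro Kmult Kc(3) Kc(4) gK yz)
    moreover have "(y \<ominus> g y \<odot> \<one>) \<otimes> (z \<ominus> g z \<odot> \<one>) \<oplus> g y \<odot> (z \<ominus> g z \<odot> \<one>) \<oplus> g z \<odot> (y \<ominus> g y \<odot> \<one>)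
       = (y \<otimes> z) \<ominus> (g y * g z) \<odot> \<one>"
      using yz by (intro forms_eqI) (auto simp: a_minus_def l_distr r_distr l_minus r_minus fsimps algebra_simps)
    ultimately show "g (y \<otimes> z) = g y * g z" using yz by (intro gI) auto
  qed
  have g_smult: "g (c \<odot> y) = c * g y" if y: "y \<in> carrier A" for c y
  proof -
    have "c \<odot> (y \<ominus> g y \<odot> \<one>) \<in> K" by (intro Kc(4) gK y)
    moreover have "c \<odot> (y \<ominus> g y \<odot> \<one>) = (c \<odot> y) \<ominus> (c * g y) \<odot> \<one>"
      using y by (intro forms_eqI) (auto simp: fsimps algebra_simps)
    ultimately show ?thesis using y by (intro gI) auto
  qed
  have "\<one> \<ominus> 1 \<odot> \<one> \<in> K" using Kc(2) by (simp add: a_minus_def M.r_neg)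
  hence "g \<one> = 1" by (intro gI) auto
  hence "algebra_hom A base_algebra g"
    using g_add g_mult g_smult by (simp add: algebra_hom_def linear_form_def ring_hom_def)
  hence "g \<in> points A" by (auto simp: points_def g_def)
  moreover have "g y = 0" if "y \<in> K0" for y
  proof -
    have "y \<in> K" "y \<in> carrier A" using that K(3) Kc(1) by auto
    thus ?thesis by (intro gI) (auto simp: a_minus_def)
  qed
  moreover have "g q = \<mu> q" if "q \<in> prim A" for q
  proof -
    have "q \<in> carrier A" using that by (simp add: prim_def)
    thus ?thesis using gK[of q] K(2) that by (auto simp: prim_compatible_def)
  qed
  ultimately show ?thesis by blast
qed

end

section \<open>Generating systems and linear algebra\<close>

text \<open>The space \<open>k^e\<close>, realised as functions that vanish outside {1..e}, so that
  systems of different length have their coordinates in one vector space.\<close>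

definition coord_space :: "nat \<Rightarrow> (nat \<Rightarrow> 'k::field) set" where
  "coord_space e = {w. \<forall>i. i \<notin> {1..e} \<longrightarrow> w i = 0}"

interpretation fun_space: vector_space "\<lambda>(c::'k::field) (w :: nat \<Rightarrow> 'k) i. c * w i"
  by unfold_locales (auto simp: algebra_simps)

interpretation fun_pair: vector_space_pair
  "\<lambda>(c::'k::field) (w :: nat \<Rightarrow> 'k) i. c * w i" "\<lambda>(c::'k::field) (w :: nat \<Rightarrow> 'k) i. c * w i"
  by unfold_locales

lemma coord_space_span:
  "coord_space e \<subseteq> fun_space.span ((\<lambda>j i. if i = j then 1 else 0 :: 'k::field) ` {1..e})"
proof
  fix w :: "nat \<Rightarrow> 'k" assume w: "w \<in> coord_space e"
  let ?u = "\<lambda>j i. if i = j then 1 else 0 :: 'k"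
  have "w = (\<Sum>j\<in>{1..e}. (\<lambda>i. w j * ?u j i))"
  proof
    fix i
    have "(\<Sum>j\<in>{1..e}. (\<lambda>i. w j * ?u j i)) i = (\<Sum>j\<in>{1..e}. w j * ?u j i)"
      by (induction rule: infinite_finite_induct) auto
    also have "\<dots> = (\<Sum>j\<in>{1..e}. if i = j then w j else 0)" by (intro sum.cong) auto
    also have "\<dots> = w i" using w by (auto simp: coord_space_def)
    finally show "w i = (\<Sum>j\<in>{1..e}. (\<lambda>i. w j * ?u j i)) i" by simp
  qed
  also have "\<dots> \<in> fun_space.span (?u ` {1..e})"
    by (intro fun_space.span_sum fun_space.span_scale fun_space.span_base) auto
  finally show "w \<in> fun_space.span (?u ` {1..e})" .
qed

lemma independent_coord_space_finite:
  assumes "B \<subseteq> coord_space e" "fun_space.independent B"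
  shows "finite B"
  using fun_space.independent_span_bound[OF _ assms(2) order_trans[OF assms(1) coord_space_span]] by simp

text \<open>Extend a basis of \<open>U\<close> to one of \<open>V\<close>, and its image under
  \<open>l\<close> to a basis of \<open>k^e\<close>. Since the dimension of \<open>V\<close> is at
  most \<open>e\<close>, the target has at least as many new basis vectors as the source, and any
  injection between them extends \<open>l\<close>.\<close>

lemma extend_injective:
  fixes U V :: "(nat \<Rightarrow> 'k::field) set"
  assumes U: "fun_space.subspace U" "U \<subseteq> V" and V: "fun_space.subspace V" "V \<subseteq> coord_space e"
    and l: "\<And>w. w \<in> U \<Longrightarrow> l w \<in> coord_space e"
      "\<And>v w. v \<in> U \<Longrightarrow> w \<in> U \<Longrightarrow> l (v + w) = l v + l w"
      "\<And>c w. w \<in> U \<Longrightarrow> l (\<lambda>i. c * w i) = (\<lambda>i. c * l w i)"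
      "\<And>w. w \<in> U \<Longrightarrow> l w = 0 \<Longrightarrow> w = 0"
  shows "\<exists>l'. Vector_Spaces.linear (\<lambda>c w i. c * w i) (\<lambda>c w i. c * w i) l' \<and> (\<forall>w\<in>U. l' w = l w) \<and>
     (\<forall>w\<in>V. l' w \<in> coord_space e) \<and> (\<forall>w\<in>V. l' w = 0 \<longrightarrow> w = 0)"
proof -
  obtain B1 where B1: "B1 \<subseteq> U" "fun_space.independent B1" "U \<subseteq> fun_space.span B1"
    using fun_space.maximal_independent_subset by blast
  have "B1 \<subseteq> V" using B1(1) U(2) by blast
  then obtain B2 where B2: "B1 \<subseteq> B2" "B2 \<subseteq> V" "fun_space.independent B2" "V \<subseteq> fun_space.span B2"
    using fun_space.maximal_independent_subset_extend[of B1 V] B1(2) by blast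
  define l0 where "l0 = fun_pair.construct B1 l"
  have l0: "Vector_Spaces.linear (\<lambda>c w i. c * w i) (\<lambda>c w i. c * w i) l0"
    unfolding l0_def by (rule fun_pair.linear_construct[OF B1(2)])
  have l00: "l 0 = 0" using l(3)[of 0 0] fun_space.subspace_0[OF U(1)] by (simp add: zero_fun_def)
  have l0_eq: "l0 w = l w" if "w \<in> U" for w
  proof -
    have "w \<in> fun_space.span B1" using that B1(3) by blast
    hence "w \<in> U \<and> l0 w = l w"
    proof (induction rule: fun_space.span_induct_alt)
      case base show ?case
        using l00 fun_space.subspace_0[OF U(1)] fun_pair.linear_0[OF l0] by (simp add: zero_fun_def)
    next
      case (step c x y)
      have xU: "x \<in> U" using step B1(1) by blast
      have "l0 x = l x" unfolding l0_def by (rule fun_pair.construct_basis[OF B1(2) step(1)])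
      have cU: "(\<lambda>i. c * x i) \<in> U" by (rule fun_space.subspace_scale[OF U(1) xU])
      have "(\<lambda>i. c * x i) + y \<in> U" using cU step by (intro fun_space.subspace_add[OF U(1)]) simp_all
      moreover have "l0 ((\<lambda>i. c * x i) + y) = l ((\<lambda>i. c * x i) + y)"
        using step cU xU \<open>l0 x = l x\<close>
        by (simp only: fun_pair.linear_add[OF l0] fun_pair.linear_scale[OF l0] l(2,3))
      ultimately show ?case ..
    qed
    thus ?thesis by simp
  qed
  have fin: "finite B2" using B2 V independent_coord_space_finite by blast
  have inj0: "inj_on l0 (fun_space.span B1)"
  proof -
    have "fun_space.span B1 = U" using B1 U(1) fun_space.span_minimal by blast
    thus ?thesis
      using l(4) l0_eq fun_pair.linear_inj_on_iff_eq_0[OF l0 U(1)] by simp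
  qed
  define C1 where "C1 = l0 ` B1"
  have C1: "C1 \<subseteq> coord_space e" using l(1) l0_eq B1(1) by (auto simp: C1_def)
  have C1i: "fun_space.independent C1"
    unfolding C1_def by (rule fun_pair.linear_independent_injective_image[OF l0 B1(2) inj0])
  obtain C2 where C2: "C1 \<subseteq> C2" "C2 \<subseteq> coord_space e" "fun_space.independent C2" "coord_space e \<subseteq> fun_space.span C2"
    using fun_space.maximal_independent_subset_extend[OF C1 C1i] by blast
  have finC: "finite C2" using C2 independent_coord_space_finite by blast
  have "card B2 \<le> card C2"
    using fun_space.independent_span_bound[OF finC B2(3)] B2(2) V(2) C2(4) by auto
  moreover have injB1: "inj_on l0 B1" using inj0 fun_space.span_superset inj_on_subset by blast
  hence "card C1 = card B1" by (simp add: C1_def card_image)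
  ultimately have "card (B2 - B1) \<le> card (C2 - C1)"
    using finite_subset[OF B2(1) fin] finite_subset[OF C2(1) finC] B2(1) C2(1)
    by (simp add: card_Diff_subset)
  then obtain j where j: "j ` (B2 - B1) \<subseteq> C2 - C1" "inj_on j (B2 - B1)"
    using card_le_inj[of "B2 - B1" "C2 - C1"] fin finC by blast
  define m where "m b = (if b \<in> B1 then l0 b else j b)" for b
  define l' where "l' = fun_pair.construct B2 m"
  have l': "Vector_Spaces.linear (\<lambda>c w i. c * w i) (\<lambda>c w i. c * w i) l'"
    unfolding l'_def by (rule fun_pair.linear_construct[OF B2(3)])
  have l'_m: "l' b = m b" if "b \<in> B2" for b unfolding l'_def by (rule fun_pair.construct_basis[OF B2(3) that])
  have mC: "m ` B2 \<subseteq> C2" using j(1) C2(1) by (auto simp: m_def C1_def)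
  have minj: "inj_on m B2"
  proof (rule inj_onI)
    fix a b assume ab: "a \<in> B2" "b \<in> B2" "m a = m b"
    have m1: "m b \<in> C1 \<longleftrightarrow> b \<in> B1" if "b \<in> B2" for b
      using j(1) that by (cases "b \<in> B1") (auto simp: m_def C1_def)
    have iff: "a \<in> B1 \<longleftrightarrow> b \<in> B1" using m1[OF ab(1)] m1[OF ab(2)] ab(3) by simp
    show "a = b"
    proof (cases "a \<in> B1")
      case True
      thus ?thesis using ab iff inj_onD[OF injB1, of a b] by (simp add: m_def)
    next
      case False
      thus ?thesis using ab iff inj_onD[OF j(2), of a b] by (simp add: m_def)
    qed
  qed
  have im: "l' ` B2 = m ` B2" "inj_on l' B2" using l'_m minj by (auto simp: inj_on_def)
  have ind: "fun_space.independent (l' ` B2)" using im mC C2(3) fun_space.independent_mono by metis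
  have "l' w = 0 \<Longrightarrow> w = 0" if "w \<in> V" for w
    using fun_pair.linear_indep_image_lemma[OF l' fin ind im(2)] that B2(4) by blast
  moreover have "l' w = l w" if "w \<in> U" for w
  proof -
    have "l' w = l0 w"
    proof (rule fun_pair.linear_eq_on[OF l' l0])
      show "w \<in> fun_space.span B1" using that B1(3) by blast
      show "l' b = l0 b" if "b \<in> B1" for b using that l'_m B2(1) by (auto simp: m_def)
    qed
    thus ?thesis using l0_eq that by simp
  qed
  moreover have "l' w \<in> coord_space e" if "w \<in> V" for w
  proof -
    have sub: "fun_space.subspace (coord_space e :: (nat \<Rightarrow> 'k) set)"
      by (auto simp: fun_space.subspace_def coord_space_def)
    have "w \<in> fun_space.span B2" using that B2(4) by blast
    thus ?thesis
    proof (induction rule: fun_space.span_induct_alt)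
      case base show ?case using fun_pair.linear_0[OF l'] fun_space.subspace_0[OF sub] by (simp add: zero_fun_def)
    next
      case (step c x y)
      have "l' x \<in> coord_space e" using l'_m step(1) mC C2(2) by auto
      hence "(\<lambda>i. c * l' x i) + l' y \<in> coord_space e"
        using step by (intro fun_space.subspace_add[OF sub] fun_space.subspace_scale[OF sub])
      thus ?case by (simp only: fun_pair.linear_add[OF l'] fun_pair.linear_scale[OF l'])
    qed
  qed
  ultimately show ?thesis using l' by blast
qed

lemma rank_leD:
  assumes "rank G \<le> enat e"
  shows "\<exists>n\<le>e. \<exists>g. generating_system G n g"
proof -
  let ?S = "{enat n |n. \<exists>g. generating_system G n g}"
  have "?S \<noteq> {}" using assms unfolding rank_def Inf_enat_def by (auto split: if_splits)
  then obtain s where "s \<in> ?S" by blast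
  hence "(LEAST x. x \<in> ?S) \<in> ?S" by (rule LeastI)
  moreover have "rank G = (LEAST x. x \<in> ?S)" using \<open>?S \<noteq> {}\<close> unfolding rank_def Inf_enat_def by (simp only: if_False)
  ultimately obtain n g where "rank G = enat n" "generating_system G n g" by auto
  thus ?thesis using assms by auto
qed

text \<open>A comorphism preserves primitive elements. For the converse each test form on O(H) has
  to come from a form on O(G); it does, because the comorphism is injective and forms on a subspace
  extend.\<close>

lemma prim_epimorphism:
  fixes G :: "('k::field, 'a) hopf" and H :: "('k, 'b) hopf"
  assumes "hopf_algebra G" "hopf_algebra H" and f: "epimorphism G H f" and b: "b \<in> carrier H"
  shows "f b \<in> prim G \<longleftrightarrow> b \<in> prim H"
proof -
  interpret G: hopf_algebra G by fact
  interpret H: hopf_algebra H by fact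
  have hom: "hopf_hom H G f" and inj: "inj_on f (carrier H)" using f by (auto simp: epimorphism_def)
  note fl = linear_mapD[OF hopf_homD(2)[OF hom]]
  have f1: "f \<one>\<^bsub>H\<^esub> = \<one>\<^bsub>G\<^esub>" using algebra_homD(2)[OF hopf_homD(1)[OF hom]] .
  note act = hopf_hom_ract[OF assms(2,1) hom _ b]
  show ?thesis
  proof
    assume p: "f b \<in> prim G"
    have "ract H \<theta> b = \<theta> \<one>\<^bsub>H\<^esub> \<odot>\<^bsub>H\<^esub> b \<oplus>\<^bsub>H\<^esub> \<theta> b \<odot>\<^bsub>H\<^esub> \<one>\<^bsub>H\<^esub>" if \<theta>: "linear_form H \<theta>" for \<theta>
    proof -
      define \<phi> where "\<phi> y = \<theta> (inv_into (carrier H) f y)" for y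
      have \<phi>f: "\<phi> (f y) = \<theta> y" if "y \<in> carrier H" for y using that inj by (simp add: \<phi>_def)
      have sub: "lin_subspace G (f ` carrier H)"
        unfolding lin_subspace_def
      proof (intro conjI ballI allI)
        show "f ` carrier H \<subseteq> carrier G" using fl(1) by auto
        have "f (0 \<odot>\<^bsub>H\<^esub> \<zero>\<^bsub>H\<^esub>) = 0 \<odot>\<^bsub>G\<^esub> f \<zero>\<^bsub>H\<^esub>" by (rule fl) simp
        hence "f \<zero>\<^bsub>H\<^esub> = \<zero>\<^bsub>G\<^esub>" using fl(1)[of "\<zero>\<^bsub>H\<^esub>"] by simp
        thus "\<zero>\<^bsub>G\<^esub> \<in> f ` carrier H" by (metis H.M.zero_closed imageI)
      next
        fix x y assume "x \<in> f ` carrier H" "y \<in> f ` carrier H"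
        thus "x \<oplus>\<^bsub>G\<^esub> y \<in> f ` carrier H" by (auto simp flip: fl(2))
      next
        fix c x assume "x \<in> f ` carrier H"
        thus "c \<odot>\<^bsub>G\<^esub> x \<in> f ` carrier H" by (auto simp flip: fl(3))
      qed
      have "\<exists>\<psi>. linear_form G \<psi> \<and> (\<forall>x\<in>f ` carrier H. \<psi> x = \<phi> x) \<and> (\<forall>x\<in>{\<zero>\<^bsub>G\<^esub>}. \<psi> x = 0)"
      proof (rule G.form_extend[OF sub G.subspace_zero])
        fix x y assume "x \<in> f ` carrier H" "y \<in> f ` carrier H"
        then obtain a c where *: "a \<in> carrier H" "c \<in> carrier H" "x = f a" "y = f c" by auto
        have "x \<oplus>\<^bsub>G\<^esub> y = f (a \<oplus>\<^bsub>H\<^esub> c)" using * fl by simp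
        thus "\<phi> (x \<oplus>\<^bsub>G\<^esub> y) = \<phi> x + \<phi> y" using * \<theta> by (simp add: \<phi>f form_simps)
      next
        fix c x assume "x \<in> f ` carrier H"
        then obtain a where *: "a \<in> carrier H" "x = f a" by auto
        have "c \<odot>\<^bsub>G\<^esub> x = f (c \<odot>\<^bsub>H\<^esub> a)" using * fl by simp
        thus "\<phi> (c \<odot>\<^bsub>G\<^esub> x) = c * \<phi> x" using * \<theta> by (simp add: \<phi>f form_simps)
      qed auto
      then obtain \<psi> where \<psi>: "linear_form G \<psi>" "\<And>y. y \<in> carrier H \<Longrightarrow> \<psi> (f y) = \<theta> y"
        using \<phi>f by auto
      have "f (ract H \<theta> b) = f (ract H (\<psi> \<circ> f) b)" using \<psi>(2) b by (intro arg_cong[of _ _ f] H.ract_cong) auto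
      also have "\<dots> = ract G \<psi> (f b)" using act[OF \<psi>(1)] by simp
      also have "\<dots> = \<theta> \<one>\<^bsub>H\<^esub> \<odot>\<^bsub>G\<^esub> f b \<oplus>\<^bsub>G\<^esub> \<theta> b \<odot>\<^bsub>G\<^esub> f \<one>\<^bsub>H\<^esub>"
        using p \<psi> b by (simp add: prim_def flip: f1)
      also have "\<dots> = f (\<theta> \<one>\<^bsub>H\<^esub> \<odot>\<^bsub>H\<^esub> b \<oplus>\<^bsub>H\<^esub> \<theta> b \<odot>\<^bsub>H\<^esub> \<one>\<^bsub>H\<^esub>)" using b fl by simp
      finally show ?thesis using inj_onD[OF inj] b by auto
    qed
    thus "b \<in> prim H" using b by (simp add: prim_def)
  next
    assume p: "b \<in> prim H"
    have "ract G \<psi> (f b) = \<psi> \<one>\<^bsub>G\<^esub> \<odot>\<^bsub>G\<^esub> f b \<oplus>\<^bsub>G\<^esub> \<psi> (f b) \<odot>\<^bsub>G\<^esub> \<one>\<^bsub>G\<^esub>" if \<psi>: "linear_form G \<psi>" for \<psi>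
      using act[OF \<psi>] p linear_form_comp[OF hopf_homD(2)[OF hom] \<psi>] b fl f1 by (simp add: prim_def)
    thus "f b \<in> prim G" using b fl(1) by (simp add: prim_def)
  qed
qed

text \<open>Seen inside O(G), the point \<open>h\<close> is a partial point whose domain K + k is
  the image of O(H); this image is stable because a comorphism commutes with contractions.\<close>

lemma point_ker_partial:
  fixes G :: "('k::field, 'a) hopf" and H :: "('k, 'b) hopf"
  assumes G: "hopf_algebra G" and H: "hopf_algebra H" and f: "epimorphism G H f" and h: "h \<in> points H"
  defines "K \<equiv> f ` {b \<in> carrier H. h b = 0}"
  shows "partial_point G K"
proof -
  interpret G: hopf_algebra G by fact
  interpret H: hopf_algebra H by fact
  have hom: "hopf_hom H G f" and inj: "inj_on f (carrier H)" using f by (auto simp: epimorphism_def)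
  note fl = linear_mapD[OF hopf_homD(2)[OF hom]]
  note fm = algebra_homD(2,3)[OF hopf_homD(1)[OF hom]]
  note hp = H.points_simps[OF h]
  have f0: "f \<zero>\<^bsub>H\<^esub> = \<zero>\<^bsub>G\<^esub>"
  proof -
    have "f (0 \<odot>\<^bsub>H\<^esub> \<zero>\<^bsub>H\<^esub>) = 0 \<odot>\<^bsub>G\<^esub> f \<zero>\<^bsub>H\<^esub>" by (rule fl) simp
    thus ?thesis using fl(1)[of "\<zero>\<^bsub>H\<^esub>"] by simp
  qed
  have KI: "f b \<in> K" if "b \<in> carrier H" "h b = 0" for b using that by (auto simp: K_def)
  have sub: "lin_subspace G K"
    unfolding lin_subspace_def
  proof (intro conjI ballI allI)
    show "K \<subseteq> carrier G" using fl(1) by (auto simp: K_def)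
    show "\<zero>\<^bsub>G\<^esub> \<in> K" using KI[of "\<zero>\<^bsub>H\<^esub>"] f0 H.form_zero[OF hp(1)] by simp
  next
    fix x y assume "x \<in> K" "y \<in> K"
    thus "x \<oplus>\<^bsub>G\<^esub> y \<in> K" using hp(1) by (auto simp: K_def form_simps simp flip: fl(2) intro!: KI[unfolded K_def])
  next
    fix c x assume "x \<in> K"
    thus "c \<odot>\<^bsub>G\<^esub> x \<in> K" using hp(1) by (auto simp: K_def form_simps simp flip: fl(3) intro!: KI[unfolded K_def])
  qed
  have C: "lspan G K [\<one>\<^bsub>G\<^esub>] = f ` carrier H"
  proof (intro equalityI subsetI)
    fix y assume "y \<in> lspan G K [\<one>\<^bsub>G\<^esub>]"
    then obtain b c where b: "b \<in> carrier H" "y = f b \<oplus>\<^bsub>G\<^esub> c \<odot>\<^bsub>G\<^esub> \<one>\<^bsub>G\<^esub>" by (auto simp: K_def)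
    have "y = f (b \<oplus>\<^bsub>H\<^esub> c \<odot>\<^bsub>H\<^esub> \<one>\<^bsub>H\<^esub>)" using b fl fm by simp
    thus "y \<in> f ` carrier H" using b by blast
  next
    fix y assume "y \<in> f ` carrier H"
    then obtain b where b: "b \<in> carrier H" "y = f b" by auto
    define b' where "b' = b \<oplus>\<^bsub>H\<^esub> (- h b) \<odot>\<^bsub>H\<^esub> \<one>\<^bsub>H\<^esub>"
    have b': "b' \<in> carrier H" "h b' = 0" using b hp(1,2) by (auto simp: b'_def form_simps)
    have "b = b' \<oplus>\<^bsub>H\<^esub> h b \<odot>\<^bsub>H\<^esub> \<one>\<^bsub>H\<^esub>"
      unfolding b'_def using b by (intro H.forms_eqI) (auto simp: H.fsimps)
    hence "y = f b' \<oplus>\<^bsub>G\<^esub> h b \<odot>\<^bsub>G\<^esub> \<one>\<^bsub>G\<^esub>" using b b' fl fm by (metis H.one_closed H.smult_closed')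
    thus "y \<in> lspan G K [\<one>\<^bsub>G\<^esub>]" using KI[OF b'] by auto
  qed
  have "\<one>\<^bsub>G\<^esub> \<notin> K"
  proof
    assume "\<one>\<^bsub>G\<^esub> \<in> K"
    then obtain b where b: "b \<in> carrier H" "h b = 0" "f b = f \<one>\<^bsub>H\<^esub>" using fm(1) by (auto simp: K_def)
    hence "b = \<one>\<^bsub>H\<^esub>" using inj_onD[OF inj] by auto
    thus False using b hp(2) by simp
  qed
  moreover have "x \<otimes>\<^bsub>G\<^esub> y \<in> K" if "x \<in> K" "y \<in> K" for x y
    using that hp(3) by (auto simp: K_def simp flip: fm(2) intro!: KI[unfolded K_def])
  moreover have "stable_subspace G (f ` carrier H)"
    unfolding stable_subspace_def
  proof (intro conjI allI ballI impI)
    show "lin_subspace G (f ` carrier H)"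
      unfolding C[symmetric] using sub by (rule G.lspan_subspace) simp
    fix \<psi> x assume "x \<in> f ` carrier H" "linear_form G \<psi>"
    thus "ract G \<psi> x \<in> f ` carrier H" using hopf_hom_ract[OF H G hom] by auto
  qed
  ultimately show ?thesis unfolding partial_point_def using sub C by simp
qed

theorem proposition13:
  fixes G :: "('k::field, 'a) hopf" and H :: "('k, 'b) hopf"
    and f :: "'b \<Rightarrow> 'a"
    and e :: nat and h :: "nat \<Rightarrow> 'b \<Rightarrow> 'k"
  assumes "CHAR('k) = 0 \<or> prime CARD('k)"
    and "prounipotent TYPE('i) TYPE('c) G"
    and "prounipotent TYPE('j) TYPE('d) H"
    and "epimorphism G H f"
    and "rank G \<le> enat e"
    and "generating_system H e h"
  shows "\<exists>g. generating_system G e g \<and> (\<forall>i\<in>{1..e}. on_points H f (g i) = h i)"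
proof -
  note G = prounipotent_structure[OF assms(1,2)]
  have H: "hopf_algebra H" using assms(3) by (auto simp: prounipotent_def inverse_limit_def)
  interpret G: hopf_algebra G by (rule G(1))
  interpret H: hopf_algebra H by (rule H)
  have char: "CHAR('k) = 0 \<or> Factorial_Ring.prime CHAR('k) \<and> frob_fixed G"
    using assms(1) G(3) prime_card_CHAR[where ?'k = 'k] by auto
  have hom: "hopf_hom H G f" and inj: "inj_on f (carrier H)" using assms(4) by (auto simp: epimorphism_def)
  note fl = linear_mapD[OF hopf_homD(2)[OF hom]]
  note fm = algebra_homD(2,3)[OF hopf_homD(1)[OF hom]]
  note prim_f = prim_epimorphism[OF G(1) H assms(4)]
  note Gp = lin_subspaceD[OF G.prim_subspace] and Hp = lin_subspaceD[OF H.prim_subspace]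
  have hpt: "h i \<in> points H" if "i \<in> {1..e}" for i
    using assms(6) that by (auto simp: generating_system_def)
  note hform = H.points_simps(1)[OF hpt]
  obtain n g0 where g0: "n \<le> e" "generating_system G n g0" using rank_leD[OF assms(5)] by blast
  have gform: "linear_form G (g0 i)" if "i \<in> {1..n}" for i
  proof -
    have "g0 i \<in> points G" using g0(2) that unfolding generating_system_def by blast
    thus ?thesis by (rule G.points_simps(1))
  qed
  \<comment> \<open>The rank may be smaller than \<open>e\<close>, so missing coordinates are filled
    with 0. Both coordinate maps then take values in \<open>k^e\<close>, and \<open>gv\<close> stays
    injective on primitive elements.\<close>
  define gv where "gv q = (\<lambda>i. if i \<in> {1..n} then g0 i q else 0)" for q
  define hv where "hv b = (\<lambda>i. if i \<in> {1..e} then h i b else 0)" for b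
  have gv_add: "gv (x \<oplus>\<^bsub>G\<^esub> y) = gv x + gv y" if "x \<in> carrier G" "y \<in> carrier G" for x y
    using that gform by (auto simp: gv_def fun_eq_iff form_simps)
  have gv_smult: "gv (c \<odot>\<^bsub>G\<^esub> x) = (\<lambda>i. c * gv x i)" if "x \<in> carrier G" for x c
    using that gform by (auto simp: gv_def fun_eq_iff form_simps)
  have hv_add: "hv (x \<oplus>\<^bsub>H\<^esub> y) = hv x + hv y" if "x \<in> carrier H" "y \<in> carrier H" for x y
    using that hform by (auto simp: hv_def fun_eq_iff form_simps)
  have hv_smult: "hv (c \<odot>\<^bsub>H\<^esub> x) = (\<lambda>i. c * hv x i)" if "x \<in> carrier H" for x c
    using that hform by (auto simp: hv_def fun_eq_iff form_simps)
  have gv0: "q = \<zero>\<^bsub>G\<^esub>" if "q \<in> prim G" "gv q = 0" for q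
    using G.generating_prim[OF g0(2) that(1)] that(2) by (auto simp: gv_def fun_eq_iff split: if_splits)
  have hv0: "b = \<zero>\<^bsub>H\<^esub>" if "b \<in> prim H" "hv b = 0" for b
    using H.generating_prim[OF assms(6) that(1)] that(2) by (auto simp: hv_def fun_eq_iff split: if_splits)
  have gv_inj: "inj_on gv (prim G)"
  proof (rule inj_onI)
    fix x y assume xy: "x \<in> prim G" "y \<in> prim G" "gv x = gv y"
    hence c: "x \<in> carrier G" "y \<in> carrier G" using Gp(1) by auto
    have "gv (x \<oplus>\<^bsub>G\<^esub> (-1) \<odot>\<^bsub>G\<^esub> y) = 0" using c xy(3) gv_add[of _ "(-1) \<odot>\<^bsub>G\<^esub> y"] gv_smult[of y]
      by (simp add: fun_eq_iff)
    hence "x \<oplus>\<^bsub>G\<^esub> (-1) \<odot>\<^bsub>G\<^esub> y = \<zero>\<^bsub>G\<^esub>" using gv0 Gp(3,4) xy by blast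
    thus "x = y" using c by (metis G.M.minus_equality G.M.minus_minus G.minus_conv G.M.a_comm G.smult_closed')
  qed
  have gf_inj: "inj_on (\<lambda>b. gv (f b)) (prim H)"
  proof (rule inj_onI)
    fix a b assume ab: "a \<in> prim H" "b \<in> prim H" "gv (f a) = gv (f b)"
    hence c: "a \<in> carrier H" "b \<in> carrier H" using Hp(1) by auto
    hence "f a = f b" using ab prim_f inj_onD[OF gv_inj] by auto
    thus "a = b" using inj_onD[OF inj] c by blast
  qed
  define V where "V = gv ` prim G"
  define U where "U = (\<lambda>b. gv (f b)) ` prim H"
  \<comment> \<open>The map to be extended: on primitive elements coming from O(H) it passes from
    the coordinates under \<open>g0\<close> to those under \<open>h\<close>. It is injective because
    the \<open>h i\<close> generate H.\<close>
  define l where "l w = hv (inv_into (prim H) (\<lambda>b. gv (f b)) w)" for w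
  have l_eq: "l (gv (f b)) = hv b" if "b \<in> prim H" for b
    using inv_into_f_f[OF gf_inj that] by (simp add: l_def)
  have gf_add: "gv (f (a \<oplus>\<^bsub>H\<^esub> b)) = gv (f a) + gv (f b)" if "a \<in> prim H" "b \<in> prim H" for a b
    using that Hp(1) fl gv_add by auto
  have gf_smult: "gv (f (c \<odot>\<^bsub>H\<^esub> a)) = (\<lambda>i. c * gv (f a) i)" if "a \<in> prim H" for a c
    using that Hp(1) fl gv_smult by auto
  have subV: "fun_space.subspace V"
    unfolding fun_space.subspace_def
  proof (intro conjI ballI allI)
    have "gv \<zero>\<^bsub>G\<^esub> = 0" using gform by (auto simp: gv_def fun_eq_iff G.form_zero)
    thus "0 \<in> V" using Gp(2) by (force simp: V_def)
    show "v + w \<in> V" if "v \<in> V" "w \<in> V" for v w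
      using that Gp(1,3) by (auto simp: V_def simp flip: gv_add)
    show "(\<lambda>i. c * w i) \<in> V" if "w \<in> V" for c w
      using that Gp(1,4) by (auto simp: V_def simp flip: gv_smult)
  qed
  have subU: "fun_space.subspace U"
    unfolding fun_space.subspace_def
  proof (intro conjI ballI allI)
    have "f \<zero>\<^bsub>H\<^esub> = \<zero>\<^bsub>G\<^esub>" using fl(3)[of "\<zero>\<^bsub>H\<^esub>" 0] fl(1)[of "\<zero>\<^bsub>H\<^esub>"] by simp
    hence "gv (f \<zero>\<^bsub>H\<^esub>) = 0" using gform by (auto simp: gv_def fun_eq_iff G.form_zero)
    thus "0 \<in> U" using Hp(2) by (force simp: U_def)
    show "v + w \<in> U" if "v \<in> U" "w \<in> U" for v w
      using that Hp(3) by (auto simp: U_def simp flip: gf_add)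
    show "(\<lambda>i. c * w i) \<in> U" if "w \<in> U" for c w
      using that Hp(4) by (auto simp: U_def simp flip: gf_smult)
  qed
  have UV: "U \<subseteq> V" using prim_f Hp(1) by (auto simp: U_def V_def)
  have VE: "V \<subseteq> coord_space e" using g0(1) by (auto simp: V_def coord_space_def gv_def)
  have "\<exists>l'. Vector_Spaces.linear (\<lambda>c w i. c * w i) (\<lambda>c w i. c * w i) l' \<and> (\<forall>w\<in>U. l' w = l w) \<and>
     (\<forall>w\<in>V. l' w \<in> coord_space e) \<and> (\<forall>w\<in>V. l' w = 0 \<longrightarrow> w = 0)"
  proof (rule extend_injective[OF subU UV subV VE])
    show "l w \<in> coord_space e" if "w \<in> U" for w
      using that l_eq by (auto simp: U_def coord_space_def hv_def)
    show "l (v + w) = l v + l w" if "v \<in> U" "w \<in> U" for v w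
      using that Hp(1,3) by (auto simp: U_def l_eq hv_add simp flip: gf_add)
    show "l (\<lambda>i. c * w i) = (\<lambda>i. c * l w i)" if "w \<in> U" for c w
      using that Hp(1,4) by (auto simp: U_def l_eq hv_smult simp flip: gf_smult)
    show "w = 0" if w: "w \<in> U" "l w = 0" for w
    proof -
      obtain b where b: "b \<in> prim H" "w = gv (f b)" using w(1) by (auto simp: U_def)
      hence "b = \<zero>\<^bsub>H\<^esub>" using w(2) l_eq hv0 by simp
      moreover have "f \<zero>\<^bsub>H\<^esub> = \<zero>\<^bsub>G\<^esub>" using fl(3)[of "\<zero>\<^bsub>H\<^esub>" 0] fl(1)[of "\<zero>\<^bsub>H\<^esub>"] by simp
      ultimately show ?thesis using b gform by (auto simp: gv_def fun_eq_iff G.form_zero)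
    qed
  qed
  then obtain l' where l': "Vector_Spaces.linear (\<lambda>c w i. c * w i) (\<lambda>c w i. c * w i) l'"
    "\<And>w. w \<in> U \<Longrightarrow> l' w = l w" "\<And>w. w \<in> V \<Longrightarrow> l' w \<in> coord_space e" "\<And>w. w \<in> V \<Longrightarrow> l' w = 0 \<Longrightarrow> w = 0"
    by blast
  \<comment> \<open>The values that the \<open>i\<close>-th new generator is to take on primitive
    elements; injectivity of \<open>l'\<close> on \<open>V\<close> will make the new system generate
    G.\<close>
  define \<mu> where "\<mu> i q = l' (gv q) i" for i q
  have \<mu>_form: "linear_form G (\<mu> i)" for i
    unfolding linear_form_def \<mu>_def
    using gv_add gv_smult fun_pair.linear_add[OF l'(1)] fun_pair.linear_scale[OF l'(1)] by (auto simp: plus_fun_def)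
  have \<mu>_f: "\<mu> i (f b) = h i b" if "b \<in> prim H" "i \<in> {1..e}" for b i
    using l'(2) l_eq that by (simp add: \<mu>_def U_def hv_def)
  have ex: "\<exists>g. g \<in> points G \<and> (\<forall>b\<in>carrier H. g (f b) = h i b) \<and> (\<forall>q\<in>prim G. g q = \<mu> i q)"
    if i: "i \<in> {1..e}" for i
  proof -
    define K where "K = f ` {b \<in> carrier H. h i b = 0}"
    note hp = H.points_simps[OF hpt[OF i]]
    have K: "partial_point G K"
      unfolding K_def by (rule point_ker_partial[OF G(1) H assms(4) hpt[OF i]])
    moreover have "prim_compatible G (\<mu> i) K"
      unfolding prim_compatible_def
    proof (intro ballI allI impI)
      fix q c assume q: "q \<in> prim G" "q \<ominus>\<^bsub>G\<^esub> c \<odot>\<^bsub>G\<^esub> \<one>\<^bsub>G\<^esub> \<in> K"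
      then obtain b where b: "b \<in> carrier H" "h i b = 0" "q \<ominus>\<^bsub>G\<^esub> c \<odot>\<^bsub>G\<^esub> \<one>\<^bsub>G\<^esub> = f b" by (auto simp: K_def)
      \<comment> \<open>The preimage of \<open>q\<close> in O(H). It is primitive by
        \<open>prim_epimorphism\<close>, and on such elements \<open>\<mu> i\<close> is given by
        \<open>h i\<close>.\<close>
      define b' where "b' = b \<oplus>\<^bsub>H\<^esub> c \<odot>\<^bsub>H\<^esub> \<one>\<^bsub>H\<^esub>"
      have qc: "q \<in> carrier G" using q Gp(1) by blast
      have "f b' = f b \<oplus>\<^bsub>G\<^esub> c \<odot>\<^bsub>G\<^esub> \<one>\<^bsub>G\<^esub>" using b fl fm by (simp add: b'_def)
      also have "\<dots> = q" unfolding b(3)[symmetric] using qc by (intro G.forms_eqI) (auto simp: G.fsimps)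
      finally have fb': "f b' = q" .
      have "b' \<in> prim H" using prim_f[of b'] fb' q(1) b by (simp add: b'_def)
      hence "\<mu> i q = h i b'" using \<mu>_f i fb' by blast
      also have "\<dots> = c" using b hp(1,2) by (simp add: b'_def form_simps)
      finally show "c = \<mu> i q" by simp
    qed
    ultimately obtain g where g: "g \<in> points G" "\<And>y. y \<in> K \<Longrightarrow> g y = 0" "\<And>q. q \<in> prim G \<Longrightarrow> g q = \<mu> i q"
      using G.extend_point[OF G(2) char _ _ \<mu>_form] by blast
    have "g (f b) = h i b" if b: "b \<in> carrier H" for b
    proof -
      define b' where "b' = b \<oplus>\<^bsub>H\<^esub> (- h i b) \<odot>\<^bsub>H\<^esub> \<one>\<^bsub>H\<^esub>"
      have "f b' \<in> K" using b hp(1,2) by (auto simp: K_def b'_def form_simps)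
      moreover have "f b' = f b \<oplus>\<^bsub>G\<^esub> (- h i b) \<odot>\<^bsub>G\<^esub> \<one>\<^bsub>G\<^esub>" using b fl fm by (simp add: b'_def)
      ultimately have "g (f b \<oplus>\<^bsub>G\<^esub> (- h i b) \<odot>\<^bsub>G\<^esub> \<one>\<^bsub>G\<^esub>) = 0" using g(2) by simp
      thus ?thesis using G.points_simps(1,2)[OF g(1)] b fl(1) by (simp add: form_simps)
    qed
    thus ?thesis using g by blast
  qed
  have "\<exists>g. \<forall>i\<in>{1..e}. g i \<in> points G \<and> (\<forall>b\<in>carrier H. g i (f b) = h i b) \<and>
      (\<forall>q\<in>prim G. g i q = \<mu> i q)"
    by (intro bchoice ballI ex)
  then obtain g where g: "\<And>i. i \<in> {1..e} \<Longrightarrow> g i \<in> points G"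
    "\<And>i b. i \<in> {1..e} \<Longrightarrow> b \<in> carrier H \<Longrightarrow> g i (f b) = h i b"
    "\<And>i q. i \<in> {1..e} \<Longrightarrow> q \<in> prim G \<Longrightarrow> g i q = \<mu> i q"
    by blast
  have "generating_system G e g"
  proof (rule G.generating_systemI[OF G(2)])
    show "g ` {1..e} \<subseteq> points G" using g(1) by blast
    fix q assume q: "q \<in> prim G" "\<And>i. i \<in> {1..e} \<Longrightarrow> g i q = 0"
    have "gv q \<in> V" using q(1) by (auto simp: V_def)
    \<comment> \<open>The coordinates in {1..e} are the values \<open>g i q\<close>; the others
      vanish because \<open>l'\<close> maps \<open>V\<close> into \<open>k^e\<close>.\<close>
    moreover have "l' (gv q) = 0"
    proof
      fix i show "l' (gv q) i = 0 i"
        using g(3)[of i q] q l'(3)[OF \<open>gv q \<in> V\<close>] by (cases "i \<in> {1..e}") (auto simp: \<mu>_def coord_space_def)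
    qed
    ultimately have "gv q = 0" using l'(4) by blast
    thus "q = \<zero>\<^bsub>G\<^esub>" using gv0 q(1) by blast
  qed
  moreover have "on_points H f (g i) = h i" if i: "i \<in> {1..e}" for i
  proof
    fix b
    show "on_points H f (g i) b = h i b"
      using g(2)[OF i] hpt[OF i] by (auto simp: on_points_def points_def extensional_def)
  qed
  ultimately show ?thesis by blast
qed

end
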